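(* Let $\Bbbk$ be a commutative ring, let $t\in\Bbbk$, and let $k,l$ be nonnegative integers. The $\Bbbk$-module $\mathrm{Hom}_{\mathcal{PR}(t)}(k,l)$ in the planar rook category $\mathcal{PR}(t)$ has a linear basis given by all planar rook diagrams of type $\binom{l}{k}$. (That is: each planar rook diagram $D$ of type $\binom{l}{k}$ is represented by a morphism of $\mathcal{PR}(t)$, this morphism is independent of the choice of representative, and the family of these morphisms, indexed by the planar rook diagrams of type $\binom{l}{k}$, is a $\Bbbk$-basis of $\mathrm{Hom}_{\mathcal{PR}(t)}(k,l)$.)
   Context: Partition diagrams. A partition of type $\binom{l}{k}$, written $D\colon k\to l$, is a set partition of $\{1,\dots,k,1',\dots,l'\}$; its elements are called blocks. It is drawn as a partition diagram with $k$ vertices $1,\dots,k$ (left to right) in the bottom row and $l$ vertices $1',\dots,l'$ (left to right) in the top row, with edges chosen so that the connected components are the blocks; diagrams giving the same set partition are identified. $D$ is planar if it can be drawn without edge crossings inside the rectangle formed by its vertices. $D$ is a rook diagram if all blocks have size at most 2 and any two distinct vertices in the same block lie in distinct rows. A planar rook diagram is a rook diagram that is planar. Partition category. $\mathcal{P}ar(t)$ is the strict $\Bbbk$-linear monoidal category with objects the nonnegative integers, $\mathrm{Hom}(k,l)$ the free $\Bbbk$-module on partitions of type $\binom{l}{k}$, composition $D\circ D'=t^{\alpha(D,D')}D\star D'$ extended bilinearly, where, stacking $D\colon k\to l$ on top of $D'\colon m\to k$, $\alpha(D,D')$ is the number of connected components all of whose vertices are in the middle row, and $D\star D'\colon m\to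 l$ is the partition in which vertices lie in the same block iff the corresponding top/bottom vertices are connected in the stacked diagram; tensor product is $k\otimes l=k+l$ on objects (unit object $0$) and horizontal juxtaposition ($D$ on the left, $D'$ on the right) for $D\otimes D'$. Planar rook category. $\mathcal{PR}(t)$ is the strict $\Bbbk$-linear monoidal category generated by one object $1$ and morphisms $\eta\colon 0\to1$, $\varepsilon\colon1\to0$, subject to the single relation $\varepsilon\circ\eta=t\,\mathrm{id}_0$. Here $0$ is the unit object and the object $k$ is the $k$-fold tensor power of $1$. Diagrams as morphisms. There is a canonical strict $\Bbbk$-linear monoidal functor $F\colon\mathcal{PR}(t)\to\mathcal{P}ar(t)$ with $1\mapsto1$, sending $\eta$ and $\varepsilon$ to the unique partitions of type $\binom10$ and $\binom01$ (single isolated vertex). A morphism of $\mathcal{PR}(t)$ represents a planar rook diagram $D$ if it is obtained from the generators and identity morphisms by finitely many compositions and tensor products and its image under $F$ is $D$. A planar rook diagram is regarded as a morphism of $\mathcal{PR}(t)$ via such a representing morphism. *)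

theory Defs
  imports "HOL-Analysis.Analysis" "HOL-Library.Disjoint_Sets" "HOL-Algebra.Module"
begin

hide_const (open) Modules.module

section \<open>Partition diagrams\<close>

text \<open>A partition \<open>D : k \<rightarrow> l\<close> lives on the vertices \<open>Bottom 1, \<dots>, Bottom k\<close> (for \<open>1, \<dots>, k\<close>) and
  \<open>Top 1, \<dots>, Top l\<close> (for \<open>1', \<dots>, l'\<close>).\<close>

datatype vertex = is_bottom: Bottom nat | is_top: Top nat

type_synonym diagram = "vertex set set"

definition vertices :: "nat \<Rightarrow> nat \<Rightarrow> vertex set" where
  "vertices k l = Bottom ` {1..k} \<union> Top ` {1..l}"

definition partitions :: "nat \<Rightarrow> nat \<Rightarrow> diagram set" where
  "partitions k l = {D. partition_on (vertices k l) D}"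

definition is_rook :: "diagram \<Rightarrow> bool" where
  "is_rook D \<longleftrightarrow>
     (\<forall>B\<in>D. card B \<le> 2 \<and> (\<forall>u\<in>B. \<forall>v\<in>B. u \<noteq> v \<longrightarrow> is_top u \<noteq> is_top v))"

text \<open>The bottom row is drawn on the line \<open>y = 0\<close> and the top row on the line \<open>y = 1\<close>.\<close>

primrec position :: "vertex \<Rightarrow> real ^ 2" where
  "position (Bottom i) = vector [real i, 0]"
| "position (Top i) = vector [real i, 1]"

definition rectangle :: "nat \<Rightarrow> nat \<Rightarrow> (real ^ 2) set" where
  "rectangle k l = cbox (vector [1, 0]) (vector [real (max k l), 1])"

definition edge_components :: "vertex set \<Rightarrow> vertex set set \<Rightarrow> vertex set set" where
  "edge_components V E = V // {(u, v). {u, v} \<in> E}\<^sup>*"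

text \<open>A crossing-free drawing of \<open>D\<close>: a set \<open>E\<close> of edges whose connected components are the blocks
  of \<open>D\<close>, and for every edge \<open>e\<close> an arc \<open>\<gamma> e\<close> in the rectangle which joins its end vertices and
  passes through no other vertex; two different arcs meet at most in common end vertices.\<close>

definition is_drawing ::
  "nat \<Rightarrow> nat \<Rightarrow> diagram \<Rightarrow> vertex set set \<Rightarrow> (vertex set \<Rightarrow> real \<Rightarrow> real ^ 2) \<Rightarrow> bool" where
  "is_drawing k l D E \<gamma> \<longleftrightarrow>
     (\<forall>e\<in>E. e \<subseteq> vertices k l \<and> card e = 2) \<and>
     edge_components (vertices k l) E = D \<and>
     (\<forall>e\<in>E. arc (\<gamma> e) \<and>
        {pathstart (\<gamma> e), pathfinish (\<gamma> e)} = position ` e \<and>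
        path_image (\<gamma> e) \<subseteq> rectangle k l \<and>
        path_image (\<gamma> e) \<inter> position ` vertices k l = position ` e) \<and>
     (\<forall>e\<in>E. \<forall>e'\<in>E. e \<noteq> e' \<longrightarrow>
        path_image (\<gamma> e) \<inter> path_image (\<gamma> e') \<subseteq> position ` (e \<inter> e'))"

definition is_planar :: "nat \<Rightarrow> nat \<Rightarrow> diagram \<Rightarrow> bool" where
  "is_planar k l D \<longleftrightarrow> (\<exists>E \<gamma>. is_drawing k l D E \<gamma>)"

definition planar_rook_diagrams :: "nat \<Rightarrow> nat \<Rightarrow> diagram set" where
  "planar_rook_diagrams k l = {D \<in> partitions k l. is_rook D \<and> is_planar k l D}"


section \<open>Stacking and juxtaposing diagrams\<close>

datatype stack_vertex = Lower nat | Middle nat | Upper nat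

text \<open>\<open>D : k \<rightarrow> l\<close> is stacked on top of \<open>D' : m \<rightarrow> k\<close>: the bottom row of \<open>D\<close> and the top row of
  \<open>D'\<close> become the middle row.\<close>

primrec in_upper :: "vertex \<Rightarrow> stack_vertex" where
  "in_upper (Bottom i) = Middle i"
| "in_upper (Top i) = Upper i"

primrec in_lower :: "vertex \<Rightarrow> stack_vertex" where
  "in_lower (Bottom i) = Lower i"
| "in_lower (Top i) = Middle i"

primrec in_outer :: "vertex \<Rightarrow> stack_vertex" where
  "in_outer (Bottom i) = Lower i"
| "in_outer (Top i) = Upper i"

definition stack_blocks :: "diagram \<Rightarrow> diagram \<Rightarrow> stack_vertex set set" where
  "stack_blocks D D' = (`) in_upper ` D \<union> (`) in_lower ` D'"

definition stack_components :: "diagram \<Rightarrow> diagram \<Rightarrow> stack_vertex set set" where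
  "stack_components D D' = \<Union>(stack_blocks D D') // (\<Union>B\<in>stack_blocks D D'. B \<times> B)\<^sup>*"

definition alpha :: "diagram \<Rightarrow> diagram \<Rightarrow> nat" where
  "alpha D D' = card {C \<in> stack_components D D'. C \<subseteq> range Middle}"

definition star :: "diagram \<Rightarrow> diagram \<Rightarrow> diagram" where
  "star D D' = (\<lambda>C. in_outer -` C) ` stack_components D D' - {{}}"

primrec shift :: "nat \<Rightarrow> nat \<Rightarrow> vertex \<Rightarrow> vertex" where
  "shift k l (Bottom i) = Bottom (k + i)"
| "shift k l (Top i) = Top (l + i)"

text \<open>The diagram \<open>D : k \<rightarrow> l\<close> is put to the left of \<open>D'\<close>.\<close>

definition juxtapose :: "nat \<Rightarrow> nat \<Rightarrow> diagram \<Rightarrow> diagram \<Rightarrow> diagram" where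
  "juxtapose k l D D' = D \<union> (`) (shift k l) ` D'"


section \<open>The partition category\<close>

text \<open>\<open>Hom(k, l)\<close> is the free module on the finite set of partitions \<open>k \<rightarrow> l\<close>, realised as the
  module of coefficient functions. In the module records below, the fields \<open>mult\<close> and \<open>one\<close>,
  which HOL-Algebra ignores for modules, carry no meaning.\<close>

definition par_hom :: "('a, 'b) ring_scheme \<Rightarrow> nat \<Rightarrow> nat \<Rightarrow> ('a, diagram \<Rightarrow> 'a) module" where
  "par_hom R k l =
     \<lparr>carrier = partitions k l \<rightarrow>\<^sub>E carrier R,
      mult = undefined, one = undefined,
      zero = (\<lambda>D\<in>partitions k l. \<zero>\<^bsub>R\<^esub>),
      add = (\<lambda>x y. \<lambda>D\<in>partitions k l. x D \<oplus>\<^bsub>R\<^esub> y D),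
      smult = (\<lambda>a x. \<lambda>D\<in>partitions k l. a \<otimes>\<^bsub>R\<^esub> x D)\<rparr>"

definition par_diagram :: "('a, 'b) ring_scheme \<Rightarrow> nat \<Rightarrow> nat \<Rightarrow> diagram \<Rightarrow> diagram \<Rightarrow> 'a" where
  "par_diagram R k l D = (\<lambda>E\<in>partitions k l. if E = D then \<one>\<^bsub>R\<^esub> else \<zero>\<^bsub>R\<^esub>)"

definition par_id :: "('a, 'b) ring_scheme \<Rightarrow> nat \<Rightarrow> diagram \<Rightarrow> 'a" where
  "par_id R k = par_diagram R k k ((\<lambda>i. {Bottom i, Top i}) ` {1..k})"

text \<open>The bilinear extension of \<open>D \<circ> D' = t\<^sup>\<alpha> (D \<star> D')\<close>, for \<open>D : k \<rightarrow> l\<close> and \<open>D' : m \<rightarrow> k\<close>.\<close>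

definition par_comp ::
  "('a, 'b) ring_scheme \<Rightarrow> 'a \<Rightarrow> nat \<Rightarrow> nat \<Rightarrow> nat \<Rightarrow>
   (diagram \<Rightarrow> 'a) \<Rightarrow> (diagram \<Rightarrow> 'a) \<Rightarrow> diagram \<Rightarrow> 'a" where
  "par_comp R t m k l x y = (\<lambda>E\<in>partitions m l.
     finsum R (\<lambda>(D, D'). t [^]\<^bsub>R\<^esub> alpha D D' \<otimes>\<^bsub>R\<^esub> (x D \<otimes>\<^bsub>R\<^esub> y D'))
       {(D, D'). D \<in> partitions k l \<and> D' \<in> partitions m k \<and> star D D' = E})"

text \<open>The bilinear extension of juxtaposition, for \<open>D : k \<rightarrow> l\<close> and \<open>D' : k' \<rightarrow> l'\<close>.\<close>

definition par_tensor ::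
  "('a, 'b) ring_scheme \<Rightarrow> nat \<Rightarrow> nat \<Rightarrow> nat \<Rightarrow> nat \<Rightarrow>
   (diagram \<Rightarrow> 'a) \<Rightarrow> (diagram \<Rightarrow> 'a) \<Rightarrow> diagram \<Rightarrow> 'a" where
  "par_tensor R k l k' l' x y = (\<lambda>E\<in>partitions (k + k') (l + l').
     finsum R (\<lambda>(D, D'). x D \<otimes>\<^bsub>R\<^esub> y D')
       {(D, D'). D \<in> partitions k l \<and> D' \<in> partitions k' l' \<and> juxtapose k l D D' = E})"


section \<open>The planar rook category\<close>

text \<open>The category presented by \<open>\<eta> : 0 \<rightarrow> 1\<close>, \<open>\<epsilon> : 1 \<rightarrow> 0\<close> and \<open>\<epsilon> \<circ> \<eta> = t id\<^sub>0\<close>: its morphisms are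
  the well-typed formal expressions modulo the smallest congruence that contains the relation and
  the axioms of a strict linear monoidal category. The free monoid of objects on one generator is
  \<open>nat\<close> under addition.\<close>

datatype 'a expr =
    Eta
  | Eps
  | Ident nat
  | Comp "'a expr" "'a expr"
  | Tensor "'a expr" "'a expr"
  | Zero nat nat
  | Add "'a expr" "'a expr"
  | Scale 'a "'a expr"

primrec src :: "'a expr \<Rightarrow> nat" where
  "src Eta = 0"
| "src Eps = 1"
| "src (Ident k) = k"
| "src (Comp f g) = src g"
| "src (Tensor f g) = src f + src g"
| "src (Zero k l) = k"
| "src (Add f g) = src f"
| "src (Scale a f) = src f"

primrec tgt :: "'a expr \<Rightarrow> nat" where
  "tgt Eta = 1"
| "tgt Eps = 0"
| "tgt (Ident k) = k"
| "tgt (Comp f g) = tgt f"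
| "tgt (Tensor f g) = tgt f + tgt g"
| "tgt (Zero k l) = l"
| "tgt (Add f g) = tgt f"
| "tgt (Scale a f) = tgt f"

primrec well_typed :: "('a, 'b) ring_scheme \<Rightarrow> 'a expr \<Rightarrow> bool" where
  "well_typed R Eta \<longleftrightarrow> True"
| "well_typed R Eps \<longleftrightarrow> True"
| "well_typed R (Ident k) \<longleftrightarrow> True"
| "well_typed R (Comp f g) \<longleftrightarrow> well_typed R f \<and> well_typed R g \<and> src f = tgt g"
| "well_typed R (Tensor f g) \<longleftrightarrow> well_typed R f \<and> well_typed R g"
| "well_typed R (Zero k l) \<longleftrightarrow> True"
| "well_typed R (Add f g) \<longleftrightarrow> well_typed R f \<and> well_typed R g \<and> src f = src g \<and> tgt f = tgt g"
| "well_typed R (Scale a f) \<longleftrightarrow> a \<in> carrier R \<and> well_typed R f"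

definition exprs :: "('a, 'b) ring_scheme \<Rightarrow> nat \<Rightarrow> nat \<Rightarrow> 'a expr set" where
  "exprs R k l = {f. well_typed R f \<and> src f = k \<and> tgt f = l}"

inductive pr_eq :: "('a, 'b) ring_scheme \<Rightarrow> 'a \<Rightarrow> 'a expr \<Rightarrow> 'a expr \<Rightarrow> bool" for R t where
  refl: "well_typed R f \<Longrightarrow> pr_eq R t f f"
| sym: "pr_eq R t f g \<Longrightarrow> pr_eq R t g f"
| trans: "pr_eq R t f g \<Longrightarrow> pr_eq R t g h \<Longrightarrow> pr_eq R t f h"

| comp_cong: "pr_eq R t f f' \<Longrightarrow> pr_eq R t g g' \<Longrightarrow> src f = tgt g \<Longrightarrow>
    pr_eq R t (Comp f g) (Comp f' g')"
| tensor_cong: "pr_eq R t f f' \<Longrightarrow> pr_eq R t g g' \<Longrightarrow> pr_eq R t (Tensor f g) (Tensor f' g')"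
| add_cong: "pr_eq R t f f' \<Longrightarrow> pr_eq R t g g' \<Longrightarrow> src f = src g \<Longrightarrow> tgt f = tgt g \<Longrightarrow>
    pr_eq R t (Add f g) (Add f' g')"
| scale_cong: "a \<in> carrier R \<Longrightarrow> pr_eq R t f f' \<Longrightarrow> pr_eq R t (Scale a f) (Scale a f')"

| comp_assoc: "f \<in> exprs R m n \<Longrightarrow> g \<in> exprs R l m \<Longrightarrow> h \<in> exprs R k l \<Longrightarrow>
    pr_eq R t (Comp (Comp f g) h) (Comp f (Comp g h))"
| ident_left: "f \<in> exprs R k l \<Longrightarrow> pr_eq R t (Comp (Ident l) f) f"
| ident_right: "f \<in> exprs R k l \<Longrightarrow> pr_eq R t (Comp f (Ident k)) f"

| tensor_assoc: "well_typed R f \<Longrightarrow> well_typed R g \<Longrightarrow> well_typed R h \<Longrightarrow>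
    pr_eq R t (Tensor (Tensor f g) h) (Tensor f (Tensor g h))"
| unit_left: "well_typed R f \<Longrightarrow> pr_eq R t (Tensor (Ident 0) f) f"
| unit_right: "well_typed R f \<Longrightarrow> pr_eq R t (Tensor f (Ident 0)) f"
| tensor_ident: "pr_eq R t (Tensor (Ident k) (Ident l)) (Ident (k + l))"
| interchange: "f \<in> exprs R l m \<Longrightarrow> g \<in> exprs R k l \<Longrightarrow>
    f' \<in> exprs R l' m' \<Longrightarrow> g' \<in> exprs R k' l' \<Longrightarrow>
    pr_eq R t (Tensor (Comp f g) (Comp f' g')) (Comp (Tensor f f') (Tensor g g'))"

| add_assoc: "f \<in> exprs R k l \<Longrightarrow> g \<in> exprs R k l \<Longrightarrow> h \<in> exprs R k l \<Longrightarrow>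
    pr_eq R t (Add (Add f g) h) (Add f (Add g h))"
| add_comm: "f \<in> exprs R k l \<Longrightarrow> g \<in> exprs R k l \<Longrightarrow> pr_eq R t (Add f g) (Add g f)"
| add_zero: "f \<in> exprs R k l \<Longrightarrow> pr_eq R t (Add (Zero k l) f) f"
| add_neg: "f \<in> exprs R k l \<Longrightarrow> pr_eq R t (Add (Scale (\<ominus>\<^bsub>R\<^esub> \<one>\<^bsub>R\<^esub>) f) f) (Zero k l)"
| scale_add_left: "a \<in> carrier R \<Longrightarrow> b \<in> carrier R \<Longrightarrow> well_typed R f \<Longrightarrow>
    pr_eq R t (Scale (a \<oplus>\<^bsub>R\<^esub> b) f) (Add (Scale a f) (Scale b f))"
| scale_add_right: "a \<in> carrier R \<Longrightarrow> f \<in> exprs R k l \<Longrightarrow> g \<in> exprs R k l \<Longrightarrow>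
    pr_eq R t (Scale a (Add f g)) (Add (Scale a f) (Scale a g))"
| scale_scale: "a \<in> carrier R \<Longrightarrow> b \<in> carrier R \<Longrightarrow> well_typed R f \<Longrightarrow>
    pr_eq R t (Scale (a \<otimes>\<^bsub>R\<^esub> b) f) (Scale a (Scale b f))"
| scale_one: "well_typed R f \<Longrightarrow> pr_eq R t (Scale \<one>\<^bsub>R\<^esub> f) f"

| comp_add_left: "f \<in> exprs R l m \<Longrightarrow> g \<in> exprs R l m \<Longrightarrow> h \<in> exprs R k l \<Longrightarrow>
    pr_eq R t (Comp (Add f g) h) (Add (Comp f h) (Comp g h))"
| comp_add_right: "f \<in> exprs R l m \<Longrightarrow> g \<in> exprs R k l \<Longrightarrow> h \<in> exprs R k l \<Longrightarrow>
    pr_eq R t (Comp f (Add g h)) (Add (Comp f g) (Comp f h))"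
| comp_scale_left: "a \<in> carrier R \<Longrightarrow> f \<in> exprs R l m \<Longrightarrow> g \<in> exprs R k l \<Longrightarrow>
    pr_eq R t (Comp (Scale a f) g) (Scale a (Comp f g))"
| comp_scale_right: "a \<in> carrier R \<Longrightarrow> f \<in> exprs R l m \<Longrightarrow> g \<in> exprs R k l \<Longrightarrow>
    pr_eq R t (Comp f (Scale a g)) (Scale a (Comp f g))"

| tensor_add_left: "f \<in> exprs R k l \<Longrightarrow> g \<in> exprs R k l \<Longrightarrow> well_typed R h \<Longrightarrow>
    pr_eq R t (Tensor (Add f g) h) (Add (Tensor f h) (Tensor g h))"
| tensor_add_right: "well_typed R f \<Longrightarrow> g \<in> exprs R k l \<Longrightarrow> h \<in> exprs R k l \<Longrightarrow>
    pr_eq R t (Tensor f (Add g h)) (Add (Tensor f g) (Tensor f h))"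
| tensor_scale_left: "a \<in> carrier R \<Longrightarrow> well_typed R f \<Longrightarrow> well_typed R g \<Longrightarrow>
    pr_eq R t (Tensor (Scale a f) g) (Scale a (Tensor f g))"
| tensor_scale_right: "a \<in> carrier R \<Longrightarrow> well_typed R f \<Longrightarrow> well_typed R g \<Longrightarrow>
    pr_eq R t (Tensor f (Scale a g)) (Scale a (Tensor f g))"

| eps_eta: "pr_eq R t (Comp Eps Eta) (Scale t (Ident 0))"

definition pr_class :: "('a, 'b) ring_scheme \<Rightarrow> 'a \<Rightarrow> 'a expr \<Rightarrow> 'a expr set" where
  "pr_class R t f = {g. pr_eq R t f g}"

definition pr_hom ::
  "('a, 'b) ring_scheme \<Rightarrow> 'a \<Rightarrow> nat \<Rightarrow> nat \<Rightarrow> ('a, 'a expr set) module" where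
  "pr_hom R t k l =
     \<lparr>carrier = pr_class R t ` exprs R k l,
      mult = undefined, one = undefined,
      zero = pr_class R t (Zero k l),
      add = (\<lambda>x y. \<Union>f\<in>x. \<Union>g\<in>y. pr_class R t (Add f g)),
      smult = (\<lambda>a x. \<Union>f\<in>x. pr_class R t (Scale a f))\<rparr>"


section \<open>Planar rook diagrams as morphisms\<close>

primrec expr_to_par :: "('a, 'b) ring_scheme \<Rightarrow> 'a \<Rightarrow> 'a expr \<Rightarrow> diagram \<Rightarrow> 'a" where
  "expr_to_par R t Eta = par_diagram R 0 1 {{Top 1}}"
| "expr_to_par R t Eps = par_diagram R 1 0 {{Bottom 1}}"
| "expr_to_par R t (Ident k) = par_id R k"
| "expr_to_par R t (Comp f g) =
     par_comp R t (src g) (src f) (tgt f) (expr_to_par R t f) (expr_to_par R t g)"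
| "expr_to_par R t (Tensor f g) =
     par_tensor R (src f) (tgt f) (src g) (tgt g) (expr_to_par R t f) (expr_to_par R t g)"
| "expr_to_par R t (Zero k l) = \<zero>\<^bsub>par_hom R k l\<^esub>"
| "expr_to_par R t (Add f g) =
     expr_to_par R t f \<oplus>\<^bsub>par_hom R (src f) (tgt f)\<^esub> expr_to_par R t g"
| "expr_to_par R t (Scale a f) = a \<odot>\<^bsub>par_hom R (src f) (tgt f)\<^esub> expr_to_par R t f"

text \<open>The functor \<open>F\<close> on morphisms: the common value of \<open>expr_to_par\<close> on a congruence class.\<close>

definition to_par :: "('a, 'b) ring_scheme \<Rightarrow> 'a \<Rightarrow> 'a expr set \<Rightarrow> diagram \<Rightarrow> 'a" where
  "to_par R t x = the_elem (expr_to_par R t ` x)"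

primrec is_monomial :: "'a expr \<Rightarrow> bool" where
  "is_monomial Eta \<longleftrightarrow> True"
| "is_monomial Eps \<longleftrightarrow> True"
| "is_monomial (Ident k) \<longleftrightarrow> True"
| "is_monomial (Comp f g) \<longleftrightarrow> is_monomial f \<and> is_monomial g"
| "is_monomial (Tensor f g) \<longleftrightarrow> is_monomial f \<and> is_monomial g"
| "is_monomial (Zero k l) \<longleftrightarrow> False"
| "is_monomial (Add f g) \<longleftrightarrow> False"
| "is_monomial (Scale a f) \<longleftrightarrow> False"

definition represents ::
  "('a, 'b) ring_scheme \<Rightarrow> 'a \<Rightarrow> nat \<Rightarrow> nat \<Rightarrow> 'a expr set \<Rightarrow> diagram \<Rightarrow> bool" where
  "represents R t k l x D \<longleftrightarrow>
     x \<in> carrier (pr_hom R t k l) \<and>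
     (\<exists>f\<in>x. is_monomial f) \<and>
     to_par R t x = par_diagram R k l D"


section \<open>Bases of modules\<close>

locale module_basis = module R M
  for R (structure) and M (structure) +
  fixes I :: "'i set" and b :: "'i \<Rightarrow> 'c"
  assumes basis_closed: "b \<in> I \<rightarrow> carrier M"
    and independent: "\<lbrakk>finite J; J \<subseteq> I; a \<in> J \<rightarrow> carrier R;
        (\<Oplus>\<^bsub>M\<^esub>i\<in>J. a i \<odot>\<^bsub>M\<^esub> b i) = \<zero>\<^bsub>M\<^esub>; j \<in> J\<rbrakk> \<Longrightarrow> a j = \<zero>\<^bsub>R\<^esub>"
    and spanning: "x \<in> carrier M \<Longrightarrow>
        \<exists>J a. finite J \<and> J \<subseteq> I \<and> a \<in> J \<rightarrow> carrier R \<and> x = (\<Oplus>\<^bsub>M\<^esub>i\<in>J. a i \<odot>\<^bsub>M\<^esub> b i)"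

end

theory Submission
  imports Defs
begin

text \<open>A rook diagram is a relation between \<open>{1..k}\<close> and \<open>{1..l}\<close> that is single-valued in both
  directions; stacking such diagrams is relational composition, and they are planar iff the relation
  is strictly increasing (Fashoda's theorem). Independence: a formal expression is evaluated to a
  linear functional on functions of rook relations. This evaluation respects the defining congruence
  and determines the image in the partition category, and it sends a tile word, that is, a tensor
  product of strands, \<open>\<eta>\<close>'s and \<open>\<epsilon>\<close>'s, to point evaluation at the relation of the word.
  Spanning: tile words are closed under composition up to powers of \<open>t\<close>, every monotone relation
  comes from a word, and words with the same relation are equal because \<open>\<eta>\<close> and \<open>\<epsilon>\<close> commute past
  each other under the tensor product.\<close>

section \<open>Rook relations\<close>

text \<open>Well-definedness of the functor into the partition category would ordinarily rest on the
  monoidal category laws for stacking arbitrary partitions. These laws are bypassed. The generators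
  and identities go to rook diagrams, which are closed under stacking and juxtaposition, and a
  component of a stack of two rook diagrams contains at most one middle vertex. The laws thus reduce
  to identities for relations and for the count \<open>loops\<close>. Each coefficient of
  \<open>expr_to_par\<close> is a value of \<open>ev\<close> at an indicator function, so invariance
  of \<open>ev\<close> under the congruence makes \<open>to_par\<close> well defined as well. A
  representing monomial is a priori only a power of \<open>t\<close> times a word, since each closed
  point costs a factor \<open>t\<close>. Comparing coefficients in the partition category forces
  that power to be \<open>\<one>\<close> and the relation of the word to be the right one, except
  over the zero ring, where coefficients carry no information. The planarity of the index set is
  topological, so matching it with monotonicity takes a theorem on crossing paths in one direction
  and an explicit drawing in the other.\<close>

text \<open>A pair \<open>(i, j)\<close> joins \<open>Bottom i\<close> to \<open>Top j\<close>, so the composite of \<open>p\<close> after \<open>q\<close> is \<open>q O p\<close>.\<close>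

definition rook_rels :: "nat \<Rightarrow> nat \<Rightarrow> (nat \<times> nat) set set" where
  "rook_rels k l = {p. p \<subseteq> {1..k} \<times> {1..l} \<and> single_valued p \<and> single_valued (p\<inverse>)}"

definition shift_rel :: "nat \<Rightarrow> nat \<Rightarrow> (nat \<times> nat) set \<Rightarrow> (nat \<times> nat) set" where
  "shift_rel k l p = (\<lambda>(i, j). (k + i, l + j)) ` p"

text \<open>For rook diagrams, the components of the stack that lie in the middle row are single vertices;
  this counts them, hence is the exponent \<open>\<alpha>\<close>.\<close>

definition loops :: "nat \<Rightarrow> (nat \<times> nat) set \<Rightarrow> (nat \<times> nat) set \<Rightarrow> nat" where
  "loops k p q = card ({1..k} - Domain p - Range q)"

lemma rook_relsD:
  assumes "p \<in> rook_rels k l"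
  shows "(i, j) \<in> p \<Longrightarrow> 1 \<le> i \<and> i \<le> k \<and> 1 \<le> j \<and> j \<le> l"
    and "(i, j) \<in> p \<Longrightarrow> (i, j') \<in> p \<Longrightarrow> j' = j"
    and "(i, j) \<in> p \<Longrightarrow> (i', j) \<in> p \<Longrightarrow> i' = i"
    and "finite p"
proof -
  show "finite p"
    using assms by (intro finite_subset[of p "{1..k} \<times> {1..l}"]) (auto simp: rook_rels_def)
qed (use assms in \<open>auto simp: rook_rels_def single_valued_def\<close>)

lemma rook_relsI:
  assumes "\<And>i j. (i, j) \<in> p \<Longrightarrow> 1 \<le> i \<and> i \<le> k \<and> 1 \<le> j \<and> j \<le> l"
    and "\<And>i j j'. (i, j) \<in> p \<Longrightarrow> (i, j') \<in> p \<Longrightarrow> j' = j"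
    and "\<And>i i' j. (i, j) \<in> p \<Longrightarrow> (i', j) \<in> p \<Longrightarrow> i' = i"
  shows "p \<in> rook_rels k l"
  using assms by (auto simp: rook_rels_def single_valued_def)

lemma mem_shift_rel:
  "(i, j) \<in> shift_rel k l p \<longleftrightarrow> k \<le> i \<and> l \<le> j \<and> (i - k, j - l) \<in> p"
  by (force simp: shift_rel_def image_iff)

lemma empty_rook_rel [simp]: "{} \<in> rook_rels k l"
  by (auto intro: rook_relsI)

lemma Id_on_rook_rel [simp]: "Id_on {1..k} \<in> rook_rels k k" "Id_on {Suc 0..k} \<in> rook_rels k k"
  by (auto intro: rook_relsI)

lemma relcomp_rook_rel:
  assumes "p \<in> rook_rels l m" "q \<in> rook_rels k l"
  shows "q O p \<in> rook_rels k m"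
  using assms unfolding rook_rels_def
  by (auto simp: converse_relcomp intro: single_valued_relcomp)

lemma juxtapose_rook_rel:
  assumes p: "p \<in> rook_rels k l" and q: "q \<in> rook_rels k' l'"
  shows "p \<union> shift_rel k l q \<in> rook_rels (k + k') (l + l')"
proof (rule rook_relsI)
  have P: "1 \<le> i \<and> i \<le> k \<and> 1 \<le> j \<and> j \<le> l" if "(i, j) \<in> p" for i j
    using rook_relsD(1)[OF p that] .
  have Q: "k < i \<and> i \<le> k + k' \<and> l < j \<and> j \<le> l + l'" if "(i, j) \<in> shift_rel k l q" for i j
    using that rook_relsD(1)[OF q, of "i - k" "j - l"] by (auto simp: mem_shift_rel)
  show "1 \<le> i \<and> i \<le> k + k' \<and> 1 \<le> j \<and> j \<le> l + l'" if "(i, j) \<in> p \<union> shift_rel k l q" for i j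
    using that by (auto dest: P Q)
  show "j' = j" if "(i, j) \<in> p \<union> shift_rel k l q" "(i, j') \<in> p \<union> shift_rel k l q" for i j j'
  proof -
    have "j' = j" if "(i, j) \<in> shift_rel k l q" "(i, j') \<in> shift_rel k l q"
      using that rook_relsD(2)[OF q, of "i - k" "j - l" "j' - l"] by (auto simp: mem_shift_rel)
    with that show ?thesis
      using rook_relsD(2)[OF p, of i j j'] P[of i] Q[of i] by (metis Un_iff not_le)
  qed
  show "i' = i" if "(i, j) \<in> p \<union> shift_rel k l q" "(i', j) \<in> p \<union> shift_rel k l q" for i i' j
  proof -
    have "i' = i" if "(i, j) \<in> shift_rel k l q" "(i', j) \<in> shift_rel k l q"
      using that rook_relsD(3)[OF q, of "i - k" "j - l" "i' - k"] by (auto simp: mem_shift_rel)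
    with that show ?thesis
      using rook_relsD(3)[OF p, of i j i'] P[of _ j] Q[of _ j] by (metis Un_iff not_le)
  qed
qed

lemma shift_rel_relcomp:
  "shift_rel k l q O shift_rel l m p = shift_rel k m (q O p)"
  unfolding shift_rel_def by (fastforce simp: relcomp_unfold image_iff)

lemma shift_rel_0 [simp]: "shift_rel 0 0 p = p"
  by (auto simp: mem_shift_rel)

lemma shift_rel_empty [simp]: "shift_rel k l {} = {}"
  by (simp add: shift_rel_def)

lemma shift_rel_Un: "shift_rel k l (p \<union> q) = shift_rel k l p \<union> shift_rel k l q"
  by (auto simp: shift_rel_def)

lemma shift_rel_shift_rel: "shift_rel k l (shift_rel k' l' p) = shift_rel (k + k') (l + l') p"
  by (force simp: shift_rel_def)

lemma shift_rel_Id_on: "Id_on {1..k} \<union> shift_rel k k (Id_on {1..l}) = Id_on {1..k + l}"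
proof (rule Set.set_eqI)
  fix x show "x \<in> Id_on {1..k} \<union> shift_rel k k (Id_on {1..l}) \<longleftrightarrow> x \<in> Id_on {1..k + l}"
    by (cases x) (auto simp: mem_shift_rel Id_on_iff)
qed

text \<open>Relational form of the interchange law. The cross terms vanish because the left factors
  meet middle points up to \<open>l\<close> and the shifted right factors only points beyond
  \<open>l\<close>.\<close>

lemma relcomp_juxtapose:
  assumes p: "p \<in> rook_rels l m" and q: "q \<in> rook_rels k l"
    and p': "p' \<in> rook_rels l' m'" and q': "q' \<in> rook_rels k' l'"
  shows "(q \<union> shift_rel k l q') O (p \<union> shift_rel l m p') = (q O p) \<union> shift_rel k m (q' O p')"
proof -
  have A: "False" if "(i, j) \<in> q" "(j, n) \<in> shift_rel l m p'" for i j n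
    using rook_relsD(1)[OF q that(1)] rook_relsD(1)[OF p', of "j - l" "n - m"] that(2)
    by (simp add: mem_shift_rel)
  have B: "False" if "(i, j) \<in> shift_rel k l q'" "(j, n) \<in> p" for i j n
    using rook_relsD(1)[OF p that(2)] rook_relsD(1)[OF q', of "i - k" "j - l"] that(1)
    by (simp add: mem_shift_rel)
  have "q O shift_rel l m p' = {}" "shift_rel k l q' O p = {}"
    using A B by blast+
  then show ?thesis
    by (simp add: shift_rel_relcomp)
qed

section \<open>Additivity and associativity of the loop count\<close>

lemma Domain_shift_rel: "Domain (shift_rel k l p) = (+) k ` Domain p"
  by (simp add: shift_rel_def Domain_fst image_image split_beta)

lemma Range_shift_rel: "Range (shift_rel k l p) = (+) l ` Range p"
  by (simp add: shift_rel_def Range_snd image_image split_beta)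

text \<open>Isolated vertices of a juxtaposition are those of the left factor and the shifted ones
  of the right factor. This serves the loop count here and the singleton blocks of juxtaposed
  diagrams later.\<close>

lemma complement_Un_shift:
  fixes A B :: "nat set"
  assumes "A \<subseteq> {1..k}" "B \<subseteq> {1..k'}"
  shows "{1..k + k'} - (A \<union> (+) k ` B) = ({1..k} - A) \<union> (+) k ` ({1..k'} - B)"
proof -
  have shifted: "i \<in> (+) k ` S \<longleftrightarrow> k < i \<and> i - k \<in> S" if "S \<subseteq> {1..k'}" for i S
    using that by (auto simp: image_iff intro!: bexI[of _ "i - k"])
  have "{1..k'} - B \<subseteq> {1..k'}" by blast
  then have "i \<in> {1..k + k'} - (A \<union> (+) k ` B) \<longleftrightarrow> i \<in> ({1..k} - A) \<union> (+) k ` ({1..k'} - B)" for i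
    using assms by (cases "i \<le> k") (auto simp: shifted[OF assms(2)] shifted)
  then show ?thesis by blast
qed

lemma loops_juxtapose:
  assumes "p \<in> rook_rels l m" "q \<in> rook_rels k l" "p' \<in> rook_rels l' m'" "q' \<in> rook_rels k' l'"
  shows "loops (l + l') (p \<union> shift_rel l m p') (q \<union> shift_rel k l q') = loops l p q + loops l' p' q'"
proof -
  have "Domain p \<union> Range q \<subseteq> {1..l}" "Domain p' \<union> Range q' \<subseteq> {1..l'}"
    using assms by (auto simp: rook_rels_def)
  from complement_Un_shift[OF this]
  have "{1..l + l'} - Domain (p \<union> shift_rel l m p') - Range (q \<union> shift_rel k l q') =
      ({1..l} - Domain p - Range q) \<union> (+) l ` ({1..l'} - Domain p' - Range q')"
    by (simp add: Domain_Un_eq Range_Un_eq Domain_shift_rel Range_shift_rel Diff_Diff_Int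
        Diff_eq image_Un Un_ac Int_ac)
  then show ?thesis
    unfolding loops_def by (simp add: card_Un_disjoint card_image disjoint_iff image_iff)
qed

text \<open>This cocycle identity makes composition with the factors \<open>t [^] loops\<close>
  associative. In a stack of three layers, both sides count the closed points of the two middle rows
  together with the edges of \<open>q\<close> that neither \<open>r\<close> nor \<open>p\<close>
  continues. These edges form the set \<open>s\<close>; the left side counts them at their lower
  ends, the right side at their upper ends, and both projections of \<open>s\<close> are
  injective.\<close>

lemma loops_assoc:
  assumes p: "p \<in> rook_rels l m" and q: "q \<in> rook_rels k l" and r: "r \<in> rook_rels j k"
  shows "loops l p q + loops k (q O p) r = loops k q r + loops l p (r O q)"
proof -
  define s where "s = {x \<in> q. fst x \<notin> Range r \<and> snd x \<notin> Domain p}"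
  have fst_s: "i \<in> {1..k} - Domain (q O p) - Range r \<longleftrightarrow>
      i \<in> ({1..k} - Domain q - Range r) \<union> fst ` s" for i
  proof (cases "i \<in> Domain q")
    case True
    then obtain j where j: "(i, j) \<in> q" by blast
    have "i \<in> Domain (q O p) \<longleftrightarrow> j \<in> Domain p"
      using j rook_relsD(2)[OF q j] by blast
    moreover have "i \<in> fst ` s \<longleftrightarrow> i \<notin> Range r \<and> j \<notin> Domain p"
      using j unfolding s_def by (auto simp: image_iff dest: rook_relsD(2)[OF q j])
    ultimately show ?thesis
      using rook_relsD(1)[OF q j] True by auto
  next
    case False
    then have "i \<notin> Domain (q O p)" "i \<notin> fst ` s" by (auto simp: s_def)
    with False show ?thesis by simp
  qed
  have snd_s: "i \<in> {1..l} - Domain p - Range (r O q) \<longleftrightarrow>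
      i \<in> ({1..l} - Domain p - Range q) \<union> snd ` s" for i
  proof (cases "i \<in> Range q")
    case True
    then obtain j where j: "(j, i) \<in> q" by blast
    have "i \<in> Range (r O q) \<longleftrightarrow> j \<in> Range r"
      using j rook_relsD(3)[OF q j] by blast
    moreover have "i \<in> snd ` s \<longleftrightarrow> i \<notin> Domain p \<and> j \<notin> Range r"
      using j unfolding s_def by (auto simp: image_iff dest: rook_relsD(3)[OF q j])
    ultimately show ?thesis
      using rook_relsD(1)[OF q j] True by auto
  next
    case False
    then have "i \<notin> Range (r O q)" "i \<notin> snd ` s" by (auto simp: s_def)
    with False show ?thesis by simp
  qed
  have "{1..k} - Domain (q O p) - Range r = ({1..k} - Domain q - Range r) \<union> fst ` s"
    and "{1..l} - Domain p - Range (r O q) = ({1..l} - Domain p - Range q) \<union> snd ` s"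
    using fst_s snd_s by (simp_all only: set_eq_iff simp_thms)
  moreover have "({1..k} - Domain q - Range r) \<inter> fst ` s = {}"
      "({1..l} - Domain p - Range q) \<inter> snd ` s = {}"
    by (auto simp: s_def)
  moreover have "card (fst ` s) = card s" "card (snd ` s) = card s"
    using rook_relsD(2,3)[OF q] by (auto simp: s_def intro!: card_image inj_onI)
  moreover have "finite s"
    using rook_relsD(4)[OF q] by (simp add: s_def)
  ultimately show ?thesis
    by (simp add: loops_def card_Un_disjoint)
qed

lemma loops_Id_on [simp]:
  "loops k (Id_on {Suc 0..k}) q = 0" "loops k p (Id_on {Suc 0..k}) = 0"
  by (auto simp: loops_def)

lemma relcomp_Id_on:
  assumes "p \<in> rook_rels k l"
  shows "Id_on {Suc 0..k} O p = p" "p O Id_on {Suc 0..l} = p"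
  using assms by (auto simp: rook_rels_def)

section \<open>Evaluating expressions on linear functionals\<close>

locale planar_rook_category = R?: cring R for R (structure) +
  fixes t :: 'a
  assumes t_closed [simp]: "t \<in> carrier R"
begin

text \<open>If \<open>f\<close> denotes the formal combination of the relations \<open>p\<close> with coefficients \<open>c p\<close>, then
  \<open>ev f \<phi>\<close> is the sum of \<open>c p \<otimes> \<phi> p\<close>. Working with the functional instead of its coefficients
  makes associativity of composition immediate and leaves only a Fubini rule for the interchange
  law.\<close>

primrec ev :: "'a expr \<Rightarrow> ((nat \<times> nat) set \<Rightarrow> 'a) \<Rightarrow> 'a" where
  "ev Eta \<phi> = \<phi> {}"
| "ev Eps \<phi> = \<phi> {}"
| "ev (Ident k) \<phi> = \<phi> (Id_on {1..k})"
| "ev (Comp f g) \<phi> = ev f (\<lambda>p. ev g (\<lambda>q. t [^] loops (src f) p q \<otimes> \<phi> (q O p)))"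
| "ev (Tensor f g) \<phi> = ev f (\<lambda>p. ev g (\<lambda>q. \<phi> (p \<union> shift_rel (src f) (tgt f) q)))"
| "ev (Zero k l) \<phi> = \<zero>"
| "ev (Add f g) \<phi> = ev f \<phi> \<oplus> ev g \<phi>"
| "ev (Scale a f) \<phi> = a \<otimes> ev f \<phi>"

section \<open>Locality, linearity and a Fubini rule for evaluation\<close>

lemma ev_cong:
  assumes "well_typed R f" "\<And>p. p \<in> rook_rels (src f) (tgt f) \<Longrightarrow> \<phi> p = \<psi> p"
  shows "ev f \<phi> = ev f \<psi>"
  using assms
proof (induction f arbitrary: \<phi> \<psi>)
  case (Comp f g)
  have "\<phi> (q O p) = \<psi> (q O p)"
    if "p \<in> rook_rels (src f) (tgt f)" "q \<in> rook_rels (src g) (tgt g)" for p q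
    using that Comp.prems by (auto intro: relcomp_rook_rel)
  then show ?case
    unfolding ev.simps using Comp.prems by (intro Comp.IH) auto
next
  case (Tensor f g)
  show ?case
    by simp (intro Tensor.IH; use Tensor.prems in \<open>auto intro: juxtapose_rook_rel\<close>)
next
  case (Add f g)
  show ?case
    using Add.IH[of \<phi> \<psi>] Add.prems by simp
next
  case (Scale a f)
  show ?case
    using Scale.IH[of \<phi> \<psi>] Scale.prems by simp
qed auto

lemma ev_closed:
  assumes "well_typed R f" "\<And>p. p \<in> rook_rels (src f) (tgt f) \<Longrightarrow> \<phi> p \<in> carrier R"
  shows "ev f \<phi> \<in> carrier R"
  using assms
proof (induction f arbitrary: \<phi>)
  case (Comp f g)
  show ?case
    by simp (intro Comp.IH m_closed nat_pow_closed t_closed; use Comp.prems in \<open>auto intro: relcomp_rook_rel\<close>)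
next
  case (Tensor f g)
  show ?case
    by simp (intro Tensor.IH; use Tensor.prems in \<open>auto intro: juxtapose_rook_rel\<close>)
qed auto

lemma ev_add:
  assumes "well_typed R f" "\<And>p. p \<in> rook_rels (src f) (tgt f) \<Longrightarrow> \<phi> p \<in> carrier R"
    "\<And>p. p \<in> rook_rels (src f) (tgt f) \<Longrightarrow> \<psi> p \<in> carrier R"
  shows "ev f (\<lambda>p. \<phi> p \<oplus> \<psi> p) = ev f \<phi> \<oplus> ev f \<psi>"
  using assms
proof (induction f arbitrary: \<phi> \<psi>)
  case (Comp f g)
  have c: "\<phi> (q O p) \<in> carrier R" "\<psi> (q O p) \<in> carrier R"
    if "p \<in> rook_rels (src f) (tgt f)" "q \<in> rook_rels (src g) (tgt g)" for p q
    using that Comp.prems by (auto intro: relcomp_rook_rel)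
  have "ev f (\<lambda>p. ev g (\<lambda>q. t [^] loops (src f) p q \<otimes> (\<phi> (q O p) \<oplus> \<psi> (q O p)))) =
      ev f (\<lambda>p. ev g (\<lambda>q. t [^] loops (src f) p q \<otimes> \<phi> (q O p)) \<oplus>
        ev g (\<lambda>q. t [^] loops (src f) p q \<otimes> \<psi> (q O p)))"
  proof (intro ev_cong)
    show "well_typed R f" using Comp.prems by simp
    fix p assume p: "p \<in> rook_rels (src f) (tgt f)"
    have "ev g (\<lambda>q. t [^] loops (src f) p q \<otimes> (\<phi> (q O p) \<oplus> \<psi> (q O p))) =
        ev g (\<lambda>q. t [^] loops (src f) p q \<otimes> \<phi> (q O p) \<oplus> t [^] loops (src f) p q \<otimes> \<psi> (q O p))"
      using Comp.prems c[OF p] by (intro ev_cong) (auto simp: r_distr)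
    also have "\<dots> = ev g (\<lambda>q. t [^] loops (src f) p q \<otimes> \<phi> (q O p)) \<oplus>
        ev g (\<lambda>q. t [^] loops (src f) p q \<otimes> \<psi> (q O p))"
      using Comp.prems c[OF p] by (intro Comp.IH) auto
    finally show "ev g (\<lambda>q. t [^] loops (src f) p q \<otimes> (\<phi> (q O p) \<oplus> \<psi> (q O p))) = \<dots>" .
  qed
  also have "\<dots> = ev (Comp f g) \<phi> \<oplus> ev (Comp f g) \<psi>"
    using Comp.prems c by (simp, intro Comp.IH ev_closed) auto
  finally show ?case by simp
next
  case (Tensor f g)
  have c: "\<phi> (p \<union> shift_rel (src f) (tgt f) q) \<in> carrier R"
      "\<psi> (p \<union> shift_rel (src f) (tgt f) q) \<in> carrier R"
    if "p \<in> rook_rels (src f) (tgt f)" "q \<in> rook_rels (src g) (tgt g)" for p q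
    using that Tensor.prems by (auto intro: juxtapose_rook_rel)
  have "ev (Tensor f g) (\<lambda>p. \<phi> p \<oplus> \<psi> p) =
      ev f (\<lambda>p. ev g (\<lambda>q. \<phi> (p \<union> shift_rel (src f) (tgt f) q)) \<oplus>
        ev g (\<lambda>q. \<psi> (p \<union> shift_rel (src f) (tgt f) q)))"
    unfolding ev.simps using Tensor.prems c by (intro ev_cong Tensor.IH) auto
  also have "\<dots> = ev (Tensor f g) \<phi> \<oplus> ev (Tensor f g) \<psi>"
    unfolding ev.simps using Tensor.prems c by (intro Tensor.IH ev_closed) auto
  finally show ?case .
next
  case (Add f g)
  then have "ev f \<phi> \<in> carrier R" "ev g \<phi> \<in> carrier R" "ev f \<psi> \<in> carrier R" "ev g \<psi> \<in> carrier R"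
    by (auto intro!: ev_closed)
  with Add show ?case
    by (simp add: a_ac)
next
  case (Scale a f)
  then show ?case
    by (simp add: ev_closed r_distr)
qed auto

lemma ev_mult:
  assumes "well_typed R f" "a \<in> carrier R"
    "\<And>p. p \<in> rook_rels (src f) (tgt f) \<Longrightarrow> \<phi> p \<in> carrier R"
  shows "ev f (\<lambda>p. a \<otimes> \<phi> p) = a \<otimes> ev f \<phi>"
  using assms
proof (induction f arbitrary: \<phi>)
  case (Comp f g)
  have c: "\<phi> (q O p) \<in> carrier R"
    if "p \<in> rook_rels (src f) (tgt f)" "q \<in> rook_rels (src g) (tgt g)" for p q
    using that Comp.prems by (auto intro: relcomp_rook_rel)
  have "ev (Comp f g) (\<lambda>p. a \<otimes> \<phi> p) =
      ev f (\<lambda>p. ev g (\<lambda>q. a \<otimes> (t [^] loops (src f) p q \<otimes> \<phi> (q O p))))"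
    unfolding ev.simps using Comp.prems c by (intro ev_cong) (auto simp: m_ac)
  also have "\<dots> = ev f (\<lambda>p. a \<otimes> ev g (\<lambda>q. t [^] loops (src f) p q \<otimes> \<phi> (q O p)))"
    using Comp.prems c by (intro ev_cong Comp.IH) auto
  also have "\<dots> = a \<otimes> ev (Comp f g) \<phi>"
    unfolding ev.simps using Comp.prems c by (intro Comp.IH ev_closed) auto
  finally show ?case .
next
  case (Tensor f g)
  have c: "\<phi> (p \<union> shift_rel (src f) (tgt f) q) \<in> carrier R"
    if "p \<in> rook_rels (src f) (tgt f)" "q \<in> rook_rels (src g) (tgt g)" for p q
    using that Tensor.prems by (auto intro: juxtapose_rook_rel)
  have "ev (Tensor f g) (\<lambda>p. a \<otimes> \<phi> p) =
      ev f (\<lambda>p. a \<otimes> ev g (\<lambda>q. \<phi> (p \<union> shift_rel (src f) (tgt f) q)))"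
    unfolding ev.simps using Tensor.prems c by (intro ev_cong Tensor.IH) auto
  also have "\<dots> = a \<otimes> ev (Tensor f g) \<phi>"
    unfolding ev.simps using Tensor.prems c by (intro Tensor.IH ev_closed) auto
  finally show ?case .
next
  case (Add f g)
  then have "ev f \<phi> \<in> carrier R" "ev g \<phi> \<in> carrier R"
    by (auto intro!: ev_closed)
  with Add show ?case
    by (simp add: r_distr)
next
  case (Scale b f)
  then show ?case
    by (simp add: ev_closed m_lcomm)
qed auto

lemma ev_zero:
  assumes "well_typed R f"
  shows "ev f (\<lambda>p. \<zero>) = \<zero>"
  using ev_mult[of f \<zero> "\<lambda>p. \<zero>"] assms by (simp add: ev_closed)

lemma ev_finsum:
  assumes "well_typed R f" "finite A"
    "\<And>i p. i \<in> A \<Longrightarrow> p \<in> rook_rels (src f) (tgt f) \<Longrightarrow> \<phi> i p \<in> carrier R"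
  shows "ev f (\<lambda>p. \<Oplus>i\<in>A. \<phi> i p) = (\<Oplus>i\<in>A. ev f (\<phi> i))"
  using assms(2,3)
proof (induction A rule: finite_induct)
  case empty
  then show ?case using assms(1) by (simp add: ev_zero)
next
  case (insert i A)
  have "ev f (\<lambda>p. \<Oplus>i\<in>insert i A. \<phi> i p) = ev f (\<lambda>p. \<phi> i p \<oplus> (\<Oplus>i\<in>A. \<phi> i p))"
    using insert assms(1) by (intro ev_cong finsum_insert) auto
  also have "\<dots> = ev f (\<phi> i) \<oplus> ev f (\<lambda>p. \<Oplus>i\<in>A. \<phi> i p)"
    using insert assms(1) by (intro ev_add finsum_closed) auto
  also have "\<dots> = (\<Oplus>i\<in>insert i A. ev f (\<phi> i))"
    using insert assms(1) by (subst finsum_insert) (auto intro: ev_closed)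
  finally show ?case .
qed

text \<open>\<open>ev f\<close> is built from point evaluations by sums and multiples, and
  \<open>ev g\<close> is linear. The induction therefore runs over \<open>f\<close> alone; linearity
  of \<open>ev g\<close> moves the zero, sums, scalars and loop factors of \<open>f\<close> across
  it.\<close>

lemma ev_commute:
  assumes "well_typed R f" "well_typed R g"
    "\<And>p q. p \<in> rook_rels (src f) (tgt f) \<Longrightarrow> q \<in> rook_rels (src g) (tgt g) \<Longrightarrow> \<phi> p q \<in> carrier R"
  shows "ev f (\<lambda>p. ev g (\<lambda>q. \<phi> p q)) = ev g (\<lambda>q. ev f (\<lambda>p. \<phi> p q))"
  using assms
proof (induction f arbitrary: \<phi>)
  case (Comp f h)
  have c: "\<phi> (q O p) r \<in> carrier R"
    if "p \<in> rook_rels (src f) (tgt f)" "q \<in> rook_rels (src h) (tgt h)"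
      "r \<in> rook_rels (src g) (tgt g)" for p q r
    using that Comp.prems by (auto intro: relcomp_rook_rel)
  have "ev (Comp f h) (\<lambda>p. ev g (\<lambda>r. \<phi> p r)) =
      ev f (\<lambda>p. ev h (\<lambda>q. ev g (\<lambda>r. t [^] loops (src f) p q \<otimes> \<phi> (q O p) r)))"
    unfolding ev.simps using Comp.prems c by (intro ev_cong ev_mult[symmetric]) auto
  also have "\<dots> = ev f (\<lambda>p. ev g (\<lambda>r. ev h (\<lambda>q. t [^] loops (src f) p q \<otimes> \<phi> (q O p) r)))"
    using Comp.prems c by (intro ev_cong Comp.IH) auto
  also have "\<dots> = ev g (\<lambda>r. ev (Comp f h) (\<lambda>p. \<phi> p r))"
    unfolding ev.simps using Comp.prems c by (intro Comp.IH ev_closed) auto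
  finally show ?case .
next
  case (Tensor f h)
  have c: "\<phi> (p \<union> shift_rel (src f) (tgt f) q) r \<in> carrier R"
    if "p \<in> rook_rels (src f) (tgt f)" "q \<in> rook_rels (src h) (tgt h)"
      "r \<in> rook_rels (src g) (tgt g)" for p q r
    using that Tensor.prems by (auto intro: juxtapose_rook_rel)
  have "ev (Tensor f h) (\<lambda>p. ev g (\<lambda>r. \<phi> p r)) =
      ev f (\<lambda>p. ev g (\<lambda>r. ev h (\<lambda>q. \<phi> (p \<union> shift_rel (src f) (tgt f) q) r)))"
    unfolding ev.simps using Tensor.prems c by (intro ev_cong Tensor.IH) auto
  also have "\<dots> = ev g (\<lambda>r. ev (Tensor f h) (\<lambda>p. \<phi> p r))"
    unfolding ev.simps using Tensor.prems c by (intro Tensor.IH ev_closed) auto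
  finally show ?case .
next
  case (Zero k l)
  then show ?case by (simp add: ev_zero)
next
  case (Add f h)
  then show ?case
    unfolding ev.simps by (subst ev_add) (auto intro!: ev_closed)
next
  case (Scale a f)
  then show ?case
    by (simp add: ev_mult ev_closed)
qed auto

section \<open>Invariance of evaluation under the congruence\<close>

lemma pr_eq_typed:
  assumes "pr_eq R t f g"
  shows "well_typed R f" "well_typed R g" "src g = src f" "tgt g = tgt f"
proof -
  have "well_typed R f \<and> well_typed R g \<and> src g = src f \<and> tgt g = tgt f"
    using assms by induction (auto simp: exprs_def)
  then show "well_typed R f" "well_typed R g" "src g = src f" "tgt g = tgt f"
    by auto
qed

text \<open>Soundness: evaluation descends to morphisms. Beyond linearity, associativity of
  composition rests on \<open>loops_assoc\<close>, and the interchange law on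
  \<open>ev_commute\<close>, \<open>relcomp_juxtapose\<close> and \<open>loops_juxtapose\<close>.
  Linear independence and well-definedness of \<open>to_par\<close> both follow from this.\<close>

lemma ev_pr_eq:
  assumes "pr_eq R t f g" "\<And>p. p \<in> rook_rels (src f) (tgt f) \<Longrightarrow> \<phi> p \<in> carrier R"
  shows "ev f \<phi> = ev g \<phi>"
  using assms
proof (induction arbitrary: \<phi>)
  case (sym f g)
  then show ?case using pr_eq_typed[OF sym.hyps] by auto
next
  case (trans f g h)
  then show ?case using pr_eq_typed[OF trans.hyps(1)] by auto
next
  case (comp_cong f f' g g')
  note tf = pr_eq_typed[OF comp_cong.hyps(1)] and tg = pr_eq_typed[OF comp_cong.hyps(2)]
  have c: "\<phi> (q O p) \<in> carrier R"
    if "p \<in> rook_rels (src f) (tgt f)" "q \<in> rook_rels (src g) (tgt g)" for p q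
    using that comp_cong.prems comp_cong.hyps tf tg by (auto intro: relcomp_rook_rel)
  have "ev (Comp f g) \<phi> = ev f (\<lambda>p. ev g' (\<lambda>q. t [^] loops (src f) p q \<otimes> \<phi> (q O p)))"
    unfolding ev.simps using tf tg comp_cong.hyps c by (intro ev_cong comp_cong.IH) auto
  also have "\<dots> = ev f' (\<lambda>p. ev g' (\<lambda>q. t [^] loops (src f) p q \<otimes> \<phi> (q O p)))"
    using tf tg comp_cong.hyps c by (intro comp_cong.IH ev_closed) auto
  finally show ?case
    using tf by simp
next
  case (tensor_cong f f' g g')
  note tf = pr_eq_typed[OF tensor_cong.hyps(1)] and tg = pr_eq_typed[OF tensor_cong.hyps(2)]
  have c: "\<phi> (p \<union> shift_rel (src f) (tgt f) q) \<in> carrier R"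
    if "p \<in> rook_rels (src f) (tgt f)" "q \<in> rook_rels (src g) (tgt g)" for p q
    using that tensor_cong.prems tf tg by (auto intro: juxtapose_rook_rel)
  have "ev (Tensor f g) \<phi> = ev f (\<lambda>p. ev g' (\<lambda>q. \<phi> (p \<union> shift_rel (src f) (tgt f) q)))"
    unfolding ev.simps using tf tg c by (intro ev_cong tensor_cong.IH) auto
  also have "\<dots> = ev f' (\<lambda>p. ev g' (\<lambda>q. \<phi> (p \<union> shift_rel (src f) (tgt f) q)))"
    using tf tg c by (intro tensor_cong.IH ev_closed) auto
  finally show ?case
    using tf by simp
next
  case (add_cong f f' g g')
  then show ?case
    by simp
next
  case (comp_assoc f m n g l h k)
  then have f: "well_typed R f" "src f = m" "tgt f = n" and g: "well_typed R g" "src g = l" "tgt g = m"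
    and h: "well_typed R h" "src h = k" "tgt h = l"
    by (auto simp: exprs_def)
  have c: "\<phi> ((r O q) O p) \<in> carrier R"
    if "p \<in> rook_rels m n" "q \<in> rook_rels l m" "r \<in> rook_rels k l" for p q r
    using that comp_assoc.prems f h by (auto intro!: relcomp_rook_rel)
  have "ev (Comp (Comp f g) h) \<phi> = ev f (\<lambda>p. ev g (\<lambda>q. ev h (\<lambda>r.
      t [^] loops m p q \<otimes> (t [^] loops l (q O p) r \<otimes> \<phi> (r O q O p)))))"
    unfolding ev.simps src.simps f g h using f g h c by (intro ev_cong ev_mult[symmetric]) (auto simp: O_assoc)
  also have "\<dots> = ev f (\<lambda>p. ev g (\<lambda>q. ev h (\<lambda>r.
      t [^] loops l q r \<otimes> (t [^] loops m p (r O q) \<otimes> \<phi> ((r O q) O p)))))"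
  proof (intro ev_cong)
    fix p q r assume "p \<in> rook_rels (src f) (tgt f)" "q \<in> rook_rels (src g) (tgt g)"
      "r \<in> rook_rels (src h) (tgt h)"
    with f g h have pqr: "p \<in> rook_rels m n" "q \<in> rook_rels l m" "r \<in> rook_rels k l"
      by auto
    \<comment> \<open>Both sides carry the same relation, and \<open>loops_assoc\<close> equates the
      total exponents of \<open>t\<close>.\<close>
    show "t [^] loops m p q \<otimes> (t [^] loops l (q O p) r \<otimes> \<phi> (r O q O p)) =
      t [^] loops l q r \<otimes> (t [^] loops m p (r O q) \<otimes> \<phi> ((r O q) O p))"
      using c[OF pqr] loops_assoc[OF pqr]
      by (simp add: m_assoc[symmetric] nat_pow_mult O_assoc)
  qed (use f g h in auto)
  also have "\<dots> = ev (Comp f (Comp g h)) \<phi>"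
    unfolding ev.simps src.simps f g h using f g h c by (intro ev_cong ev_mult) (auto simp: O_assoc)
  finally show ?case .
next
  case (ident_left f k l)
  then show ?case
    by (auto simp: exprs_def relcomp_Id_on intro!: ev_cong)
next
  case (ident_right f k l)
  then show ?case
    by (auto simp: exprs_def relcomp_Id_on intro!: ev_cong)
next
  case (tensor_assoc f g h)
  then show ?case
    by (simp add: shift_rel_Un shift_rel_shift_rel Un_assoc)
next
  case (unit_left f)
  then show ?case by simp
next
  case (unit_right f)
  then show ?case by simp
next
  case (tensor_ident k l)
  then show ?case using shift_rel_Id_on[of k l] by simp
next
  case (interchange f l m g k f' l' m' g' k')
  then have f: "well_typed R f" "src f = l" "tgt f = m" and g: "well_typed R g" "src g = k" "tgt g = l"
    and f': "well_typed R f'" "src f' = l'" "tgt f' = m'"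
    and g': "well_typed R g'" "src g' = k'" "tgt g' = l'"
    by (auto simp: exprs_def)
  note types = f g f' g'
  have c: "\<phi> ((q O p) \<union> shift_rel k m (q' O p')) \<in> carrier R"
    if "p \<in> rook_rels l m" "q \<in> rook_rels k l" "p' \<in> rook_rels l' m'" "q' \<in> rook_rels k' l'"
    for p q p' q'
    using that interchange.prems types by (auto intro!: relcomp_rook_rel juxtapose_rook_rel)
  define \<psi> where "\<psi> p p' q q' = t [^] loops l p q \<otimes> (t [^] loops l' p' q' \<otimes>
      \<phi> ((q O p) \<union> shift_rel k m (q' O p')))" for p p' q q'
  have \<psi>: "\<psi> p p' q q' \<in> carrier R"
    if "p \<in> rook_rels l m" "q \<in> rook_rels k l" "p' \<in> rook_rels l' m'" "q' \<in> rook_rels k' l'"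
    for p q p' q'
    using that c by (auto simp: \<psi>_def)
  have "ev (Tensor (Comp f g) (Comp f' g')) \<phi> =
      ev f (\<lambda>p. ev g (\<lambda>q. t [^] loops l p q \<otimes> ev f' (\<lambda>p'. ev g' (\<lambda>q'.
        t [^] loops l' p' q' \<otimes> \<phi> ((q O p) \<union> shift_rel k m (q' O p'))))))"
    using types by simp
  also have "\<dots> = ev f (\<lambda>p. ev g (\<lambda>q. ev f' (\<lambda>p'. t [^] loops l p q \<otimes> ev g' (\<lambda>q'.
        t [^] loops l' p' q' \<otimes> \<phi> ((q O p) \<union> shift_rel k m (q' O p'))))))"
    using types c by (intro ev_cong ev_mult[symmetric] ev_closed) auto
  also have "\<dots> = ev f (\<lambda>p. ev g (\<lambda>q. ev f' (\<lambda>p'. ev g' (\<lambda>q'. \<psi> p p' q q'))))"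
    unfolding \<psi>_def using types c by (intro ev_cong ev_mult[symmetric] ev_closed) auto
  \<comment> \<open>The tensor of composites evaluates in the order \<open>f\<close>,
    \<open>g\<close>, \<open>f'\<close>, \<open>g'\<close>, the composite of tensors in the order
    \<open>f\<close>, \<open>f'\<close>, \<open>g\<close>, \<open>g'\<close>; swapping the middle
    two is the Fubini rule.\<close>
  also have "\<dots> = ev f (\<lambda>p. ev f' (\<lambda>p'. ev g (\<lambda>q. ev g' (\<lambda>q'. \<psi> p p' q q'))))"
    using types \<psi> by (intro ev_cong ev_commute ev_closed) auto
  also have "\<dots> = ev f (\<lambda>p. ev f' (\<lambda>p'. ev g (\<lambda>q. ev g' (\<lambda>q'.
      t [^] loops (l + l') (p \<union> shift_rel l m p') (q \<union> shift_rel k l q') \<otimes>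
      \<phi> ((q \<union> shift_rel k l q') O (p \<union> shift_rel l m p'))))))"
  proof (intro ev_cong)
    fix p p' q q'
    assume "p \<in> rook_rels (src f) (tgt f)" "q \<in> rook_rels (src g) (tgt g)"
      "p' \<in> rook_rels (src f') (tgt f')" "q' \<in> rook_rels (src g') (tgt g')"
    with types have pq: "p \<in> rook_rels l m" "q \<in> rook_rels k l" "p' \<in> rook_rels l' m'" "q' \<in> rook_rels k' l'"
      by auto
    show "\<psi> p p' q q' =
      t [^] loops (l + l') (p \<union> shift_rel l m p') (q \<union> shift_rel k l q') \<otimes>
      \<phi> ((q \<union> shift_rel k l q') O (p \<union> shift_rel l m p'))"
      unfolding \<psi>_def relcomp_juxtapose[OF pq] loops_juxtapose[OF pq]
      using c[OF pq] by (simp add: m_assoc[symmetric] nat_pow_mult)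
  qed (use types in auto)
  also have "\<dots> = ev (Comp (Tensor f f') (Tensor g g')) \<phi>"
    by (simp only: ev.simps src.simps tgt.simps types)
  finally show ?case .
next
  case (add_assoc f k l g h)
  then have "ev f \<phi> \<in> carrier R" "ev g \<phi> \<in> carrier R" "ev h \<phi> \<in> carrier R"
    by (auto simp: exprs_def intro!: ev_closed)
  with add_assoc.hyps show ?case
    by (simp add: a_assoc)
next
  case (add_comm f k l g)
  then have "ev f \<phi> \<in> carrier R" "ev g \<phi> \<in> carrier R"
    by (auto simp: exprs_def intro!: ev_closed)
  with add_comm.hyps show ?case
    by (simp add: a_comm)
next
  case (add_zero f k l)
  then have "ev f \<phi> \<in> carrier R"
    by (auto simp: exprs_def intro!: ev_closed)
  with add_zero.hyps show ?case
    by (simp add: exprs_def)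
next
  case (add_neg f k l)
  then have "ev f \<phi> \<in> carrier R"
    by (auto simp: exprs_def intro!: ev_closed)
  with add_neg.hyps show ?case
    by (simp add: l_minus l_neg)
next
  case (scale_add_left a b f)
  then show ?case
    by (simp add: l_distr ev_closed)
next
  case (scale_add_right a f k l g)
  then have "ev f \<phi> \<in> carrier R" "ev g \<phi> \<in> carrier R"
    by (auto simp: exprs_def intro!: ev_closed)
  with scale_add_right.hyps show ?case
    by (simp add: r_distr)
next
  case (scale_scale a b f)
  then show ?case
    by (simp add: m_assoc ev_closed)
next
  case (scale_one f)
  then show ?case
    by (simp add: ev_closed)
next
  case (comp_add_left f l m g h k)
  then show ?case
    by (simp add: exprs_def)
next
  case (comp_add_right f l m g k h)
  then have "\<phi> (q O p) \<in> carrier R"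
    if "p \<in> rook_rels l m" "q \<in> rook_rels k l" for p q
    using that by (auto simp: exprs_def intro: relcomp_rook_rel)
  with comp_add_right.hyps show ?case
    by (simp, subst ev_add) (auto simp: exprs_def intro!: ev_closed)
next
  case (comp_scale_left a f l m g k)
  then show ?case
    by (simp add: exprs_def)
next
  case (comp_scale_right a f l m g k)
  then have "\<phi> (q O p) \<in> carrier R"
    if "p \<in> rook_rels l m" "q \<in> rook_rels k l" for p q
    using that by (auto simp: exprs_def intro: relcomp_rook_rel)
  with comp_scale_right.hyps show ?case
    by (simp, subst ev_mult) (auto simp: exprs_def intro!: ev_closed)
next
  case (tensor_add_left f k l g h)
  then show ?case
    by (simp add: exprs_def)
next
  case (tensor_add_right f g k l h)
  then have "\<phi> (p \<union> shift_rel (src f) (tgt f) q) \<in> carrier R"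
    if "p \<in> rook_rels (src f) (tgt f)" "q \<in> rook_rels k l" for p q
    using that by (auto simp: exprs_def intro: juxtapose_rook_rel)
  with tensor_add_right.hyps show ?case
    by (simp, subst ev_add) (auto simp: exprs_def intro!: ev_closed)
next
  case (tensor_scale_left a f g)
  then show ?case by simp
next
  case (tensor_scale_right a f g)
  then have "\<phi> (p \<union> shift_rel (src f) (tgt f) q) \<in> carrier R"
    if "p \<in> rook_rels (src f) (tgt f)" "q \<in> rook_rels (src g) (tgt g)" for p q
    using that by (auto intro: juxtapose_rook_rel)
  with tensor_scale_right.hyps show ?case
    by (simp, subst ev_mult) (auto intro!: ev_closed)
next
  \<comment> \<open>The single middle vertex is isolated on both sides, so
    \<open>loops 1 {} {} = 1\<close> supplies the scalar \<open>t\<close>; \<open>Ident 0\<close>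
    evaluates at the empty relation.\<close>
  case eps_eta
  then show ?case
    by (simp add: loops_def)
qed auto

end

section \<open>Words of tiles\<close>

datatype tile = Strand | Cup | Cap

primrec tile_expr :: "tile \<Rightarrow> 'a expr" where
  "tile_expr Strand = Ident 1"
| "tile_expr Cup = Eta"
| "tile_expr Cap = Eps"

primrec word_expr :: "tile list \<Rightarrow> 'a expr" where
  "word_expr [] = Ident 0"
| "word_expr (x # w) = Tensor (tile_expr x) (word_expr w)"

fun word_rel :: "tile list \<Rightarrow> (nat \<times> nat) set" where
  "word_rel [] = {}"
| "word_rel (Strand # w) = insert (1, 1) (shift_rel 1 1 (word_rel w))"
| "word_rel (Cup # w) = shift_rel 0 1 (word_rel w)"
| "word_rel (Cap # w) = shift_rel 1 0 (word_rel w)"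

text \<open>An entry is \<open>True\<close> iff a strand ends at that vertex. Together with
  \<open>top_row\<close> this forgets only how cups and caps interleave between strands; the lengths
  double as source and target.\<close>

fun bottom_row :: "tile list \<Rightarrow> bool list" where
  "bottom_row [] = []"
| "bottom_row (Strand # w) = True # bottom_row w"
| "bottom_row (Cup # w) = bottom_row w"
| "bottom_row (Cap # w) = False # bottom_row w"

fun top_row :: "tile list \<Rightarrow> bool list" where
  "top_row [] = []"
| "top_row (Strand # w) = True # top_row w"
| "top_row (Cup # w) = False # top_row w"
| "top_row (Cap # w) = top_row w"

text \<open>A normal form for words: all cups precede all caps between two consecutive strands.\<close>

fun merge_rows :: "bool list \<Rightarrow> bool list \<Rightarrow> tile list" where
  "merge_rows (False # u) v = Cup # merge_rows u v"
| "merge_rows u (False # v) = Cap # merge_rows u v"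
| "merge_rows (True # u) (True # v) = Strand # merge_rows u v"
| "merge_rows _ _ = []"

section \<open>Types, relations and rows of words\<close>

lemma src_word_expr [simp]: "src (word_expr w) = length (bottom_row w)"
  by (induction w rule: bottom_row.induct) auto

lemma tgt_word_expr [simp]: "tgt (word_expr w) = length (top_row w)"
  by (induction w rule: top_row.induct) auto

lemma well_typed_word_expr [simp]: "well_typed R (word_expr w)"
proof (induction w)
  case (Cons x w)
  then show ?case by (cases x) auto
qed simp

lemma is_monomial_word_expr: "is_monomial (word_expr w)"
proof (induction w)
  case (Cons x w)
  then show ?case by (cases x) auto
qed simp

lemma word_rel_rook_rel: "word_rel w \<in> rook_rels (length (bottom_row w)) (length (top_row w))"
proof (induction w rule: word_rel.induct)
  case (2 w)
  have "{(1, 1)} \<in> rook_rels 1 1"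
    by (auto intro: rook_relsI)
  from juxtapose_rook_rel[OF this 2] show ?case by simp
next
  case (3 w)
  from juxtapose_rook_rel[OF empty_rook_rel[of 0 1] this] show ?case by simp
next
  case (4 w)
  from juxtapose_rook_rel[OF empty_rook_rel[of 1 0] this] show ?case by simp
qed simp

lemma word_rel_mono:
  "(i, j) \<in> word_rel w \<Longrightarrow> (i', j') \<in> word_rel w \<Longrightarrow> i < i' \<Longrightarrow> j < j'"
proof (induction w arbitrary: i j i' j' rule: word_rel.induct)
  case (2 w)
  have "1 < j" if "(i, j) \<in> shift_rel 1 1 (word_rel w)" for i j
    using that rook_relsD(1)[OF word_rel_rook_rel[of w], of "i - 1" "j - 1"] 
    by (auto simp: mem_shift_rel)
  with 2 show ?case
    by (fastforce simp: mem_shift_rel)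
next
  case (3 w)
  show ?case
    using "3.IH"[of i "j - 1" i' "j' - 1"] "3.prems" by (auto simp: mem_shift_rel)
next
  case (4 w)
  show ?case
    using "4.IH"[of "i - 1" j "i' - 1" j'] "4.prems" by (auto simp: mem_shift_rel)
qed simp

text \<open>With its dual for \<open>top_row\<close>, this recovers both rows, and hence the normal
  form, from the relation and the type. The \<open>Suc\<close> reconciles list positions from 0 with
  vertices numbered from 1.\<close>

lemma bottom_row_word_rel:
  "bottom_row w = map (\<lambda>i. Suc i \<in> Domain (word_rel w)) [0..<length (bottom_row w)]"
proof (induction w rule: word_rel.induct)
  case (2 w)
  have "Suc (Suc i) \<in> Domain (word_rel (Strand # w)) \<longleftrightarrow> Suc i \<in> Domain (word_rel w)" for i
    by (auto simp: Domain_iff mem_shift_rel)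
  with 2 show ?case
    by (simp add: upt_conv_Cons map_Suc_upt[symmetric] comp_def Domain_iff del: upt_Suc)
next
  case (3 w)
  have "Domain (word_rel (Cup # w)) = Domain (word_rel w)"
    by (simp add: shift_rel_def Domain_fst image_image split_beta)
  with 3 show ?case
    by simp
next
  case (4 w)
  have "Suc 0 \<notin> Domain (word_rel (Cap # w))"
    using rook_relsD(1)[OF word_rel_rook_rel[of w], of 0] by (auto simp: Domain_iff mem_shift_rel)
  moreover have "Suc (Suc i) \<in> Domain (word_rel (Cap # w)) \<longleftrightarrow> Suc i \<in> Domain (word_rel w)" for i
    by (auto simp: Domain_iff mem_shift_rel)
  ultimately show ?case
    using 4 by (simp add: upt_conv_Cons map_Suc_upt[symmetric] comp_def del: upt_Suc)
qed simp

lemma top_row_word_rel: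
  "top_row w = map (\<lambda>j. Suc j \<in> Range (word_rel w)) [0..<length (top_row w)]"
proof (induction w rule: word_rel.induct)
  case (2 w)
  have "Suc (Suc i) \<in> Range (word_rel (Strand # w)) \<longleftrightarrow> Suc i \<in> Range (word_rel w)" for i
    by (auto simp: Range_iff mem_shift_rel)
  with 2 show ?case
    by (simp add: upt_conv_Cons map_Suc_upt[symmetric] comp_def Range_iff del: upt_Suc)
next
  case (4 w)
  have "Range (word_rel (Cap # w)) = Range (word_rel w)"
    by (simp add: shift_rel_def Range_snd image_image split_beta)
  with 4 show ?case
    by simp
next
  case (3 w)
  have "Suc 0 \<notin> Range (word_rel (Cup # w))"
    using rook_relsD(1)[OF word_rel_rook_rel[of w], of _ 0] by (auto simp: Range_iff mem_shift_rel)
  moreover have "Suc (Suc i) \<in> Range (word_rel (Cup # w)) \<longleftrightarrow> Suc i \<in> Range (word_rel w)" for i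
    by (auto simp: Range_iff mem_shift_rel)
  ultimately show ?case
    using 3 by (simp add: upt_conv_Cons map_Suc_upt[symmetric] comp_def del: upt_Suc)
qed simp

lemma rows_eq_if_word_rel_eq:
  assumes "word_rel w = word_rel w'" "length (bottom_row w) = length (bottom_row w')"
    "length (top_row w) = length (top_row w')"
  shows "bottom_row w = bottom_row w'" "top_row w = top_row w'"
  using assms bottom_row_word_rel[of w] bottom_row_word_rel[of w']
    top_row_word_rel[of w] top_row_word_rel[of w'] by simp_all

section \<open>Monotone relations as relations of words\<close>

definition monotone_rels :: "nat \<Rightarrow> nat \<Rightarrow> (nat \<times> nat) set set" where
  "monotone_rels k l = {p \<in> rook_rels k l. \<forall>(i, j)\<in>p. \<forall>(i', j')\<in>p. i < i' \<longrightarrow> j < j'}"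

lemma unshift_monotone_rel:
  assumes p: "p \<in> monotone_rels (a + k) (b + l)" and ab: "\<And>i j. (i, j) \<in> p \<Longrightarrow> a < i \<and> b < j"
  obtains q where "q \<in> monotone_rels k l" "p = shift_rel a b q"
proof
  define q where "q = {(i, j). (a + i, b + j) \<in> p}"
  have rook: "p \<in> rook_rels (a + k) (b + l)"
    and mono: "(i, j) \<in> p \<Longrightarrow> (i', j') \<in> p \<Longrightarrow> i < i' \<Longrightarrow> j < j'" for i j i' j'
    using p by (auto simp: monotone_rels_def)
  have "q \<in> rook_rels k l"
  proof (rule rook_relsI)
    show "1 \<le> i \<and> i \<le> k \<and> 1 \<le> j \<and> j \<le> l" if "(i, j) \<in> q" for i j
      using that ab[of "a + i" "b + j"] rook_relsD(1)[OF rook, of "a + i" "b + j"] by (auto simp: q_def)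
  qed (auto simp: q_def dest: rook_relsD(2,3)[OF rook])
  then show "q \<in> monotone_rels k l"
    using mono by (fastforce simp: monotone_rels_def q_def)
  show "p = shift_rel a b q"
    using ab by (auto simp: mem_shift_rel q_def less_imp_le)
qed

text \<open>The leading tile is peeled off: a cup if the first top vertex is isolated, a cap if the
  first bottom vertex is isolated. If neither is, monotonicity joins these two vertices to each
  other, which gives a strand.\<close>

lemma monotone_rel_word:
  assumes "p \<in> monotone_rels k l"
  shows "\<exists>w. word_rel w = p \<and> length (bottom_row w) = k \<and> length (top_row w) = l"
  using assms
proof (induction "k + l" arbitrary: k l p rule: less_induct)
  case less
  have rook: "p \<in> rook_rels k l"
    and mono: "(i, j) \<in> p \<Longrightarrow> (i', j') \<in> p \<Longrightarrow> i < i' \<Longrightarrow> j < j'" for i j i' j'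
    using less.prems by (auto simp: monotone_rels_def)
  note bounds = rook_relsD(1)[OF rook]
  consider "l > 0" "1 \<notin> Range p" | "k > 0" "1 \<notin> Domain p" | "1 \<in> Range p" "1 \<in> Domain p" | "k = 0" "l = 0"
  proof -
    have "1 \<in> Range p \<Longrightarrow> k > 0" "1 \<in> Domain p \<Longrightarrow> l > 0"
      using bounds by fastforce+
    then show ?thesis using that by blast
  qed
  then show ?case
  proof cases
    case 1
    then have "p \<in> monotone_rels (0 + k) (1 + (l - 1))"
      using less.prems by simp
    moreover have "0 < i \<and> 1 < j" if "(i, j) \<in> p" for i j
      using that 1 bounds[OF that] by (cases "j = 1") auto
    ultimately obtain q where q: "q \<in> monotone_rels k (l - 1)" "p = shift_rel 0 1 q"
      by (rule unshift_monotone_rel)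
    from less.hyps[OF _ q(1)] 1 obtain w where
      "word_rel w = q" "length (bottom_row w) = k" "length (top_row w) = l - 1" by auto
    with q 1 show ?thesis by (intro exI[of _ "Cup # w"]) auto
  next
    case 2
    then have "p \<in> monotone_rels (1 + (k - 1)) (0 + l)"
      using less.prems by simp
    moreover have "1 < i \<and> 0 < j" if "(i, j) \<in> p" for i j
      using that 2 bounds[OF that] by (cases "i = 1") auto
    ultimately obtain q where q: "q \<in> monotone_rels (k - 1) l" "p = shift_rel 1 0 q"
      by (rule unshift_monotone_rel)
    from less.hyps[OF _ q(1)] 2 obtain w where
      "word_rel w = q" "length (bottom_row w) = k - 1" "length (top_row w) = l" by auto
    with q 2 show ?thesis by (intro exI[of _ "Cap # w"]) auto
  next
    case 3
    then obtain i j where ij: "(i, 1) \<in> p" "(1, j) \<in> p" by blast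
    \<comment> \<open>If \<open>1 < i\<close>, monotonicity applied to \<open>(1, j)\<close> and
      \<open>(i, 1)\<close> would give \<open>j < 1\<close>.\<close>
    then have "i = 1"
      using mono[OF ij(2,1)] bounds[OF ij(1)] bounds[OF ij(2)] by (cases "i = 1") auto
    with ij have 11: "(1, 1) \<in> p" by simp
    from bounds[OF this] have kl: "k > 0" "l > 0" by auto
    have "p - {(1, 1)} \<in> monotone_rels (1 + (k - 1)) (1 + (l - 1))"
      using less.prems kl by (auto simp: monotone_rels_def rook_rels_def single_valued_def)
    moreover have "1 < i \<and> 1 < j" if "(i, j) \<in> p - {(1, 1)}" for i j
      using that bounds[of i j] rook_relsD(2)[OF rook 11, of j] rook_relsD(3)[OF rook 11, of i]
      by (cases "i = 1"; cases "j = 1") auto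
    ultimately obtain q where q: "q \<in> monotone_rels (k - 1) (l - 1)" "p - {(1, 1)} = shift_rel 1 1 q"
      by (rule unshift_monotone_rel)
    from less.hyps[OF _ q(1)] kl obtain w where
      w: "word_rel w = q" "length (bottom_row w) = k - 1" "length (top_row w) = l - 1" by auto
    have "word_rel (Strand # w) = insert (1, 1) (p - {(1, 1)})"
      using w q(2) by simp
    also have "\<dots> = p"
      using 11 by blast
    finally show ?thesis
      using w kl by (intro exI[of _ "Strand # w"]) auto
  next
    case 4
    then have "p = {}"
      using bounds by fastforce
    with 4 show ?thesis by (intro exI[of _ "[]"]) auto
  qed
qed

lemma word_rel_monotone_rel:
  "word_rel w \<in> monotone_rels (length (bottom_row w)) (length (top_row w))"
  using word_rel_rook_rel[of w] word_rel_mono[of _ _ w] by (auto simp: monotone_rels_def)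

section \<open>Tile words in the planar rook category\<close>

context planar_rook_category
begin

abbreviation pr_equiv :: "'a expr \<Rightarrow> 'a expr \<Rightarrow> bool" (infix "\<doteq>" 50) where
  "f \<doteq> g \<equiv> pr_eq R t f g"

declare pr_eq.trans [trans]

section \<open>Sliding generators by the interchange law\<close>

lemma ident_comp:
  assumes "well_typed R f"
  shows "tgt f = k \<Longrightarrow> Comp (Ident k) f \<doteq> f" "src f = k \<Longrightarrow> Comp f (Ident k) \<doteq> f"
  using assms by (auto intro!: pr_eq.ident_left pr_eq.ident_right simp: exprs_def)

lemma tensor_comp:
  assumes "well_typed R f" "well_typed R g" "well_typed R f'" "well_typed R g'"
    and "src f = tgt g" "src f' = tgt g'"
  shows "Comp (Tensor f f') (Tensor g g') \<doteq> Tensor (Comp f g) (Comp f' g')"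
  using assms by (intro pr_eq.sym[OF pr_eq.interchange]) (auto simp: exprs_def)

lemma tensor_congs:
  assumes "well_typed R h" "f \<doteq> g"
  shows "Tensor h f \<doteq> Tensor h g" "Tensor f h \<doteq> Tensor g h"
  using assms by (auto intro: pr_eq.tensor_cong pr_eq.refl)

lemma comp_congs:
  assumes "well_typed R h" "f \<doteq> g"
  shows "src h = tgt f \<Longrightarrow> Comp h f \<doteq> Comp h g" "src f = tgt h \<Longrightarrow> Comp f h \<doteq> Comp g h"
  using assms by (auto intro: pr_eq.comp_cong pr_eq.refl)

text \<open>\<open>Eta\<close> has source 0, so \<open>g\<close> may be padded to
  \<open>Tensor (Ident 0) g\<close> and the interchange law applies. \<open>comp_tensor_Eps\<close>
  is the dual statement, using that \<open>Eps\<close> has target 0.\<close>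

lemma comp_tensor_Eta:
  assumes "well_typed R f" "well_typed R g" "src f = tgt g"
  shows "Comp (Tensor Eta f) g \<doteq> Tensor Eta (Comp f g)"
proof -
  have "Comp (Tensor Eta f) g \<doteq> Comp (Tensor Eta f) (Tensor (Ident 0) g)"
    using assms by (intro comp_congs pr_eq.sym[OF pr_eq.unit_left]) auto
  also have "\<dots> \<doteq> Tensor (Comp Eta (Ident 0)) (Comp f g)"
    using assms by (intro tensor_comp) auto
  also have "\<dots> \<doteq> Tensor Eta (Comp f g)"
    using assms by (intro tensor_congs ident_comp) auto
  finally show ?thesis .
qed

lemma comp_tensor_Eps:
  assumes "well_typed R f" "well_typed R g" "src f = tgt g"
  shows "Comp f (Tensor Eps g) \<doteq> Tensor Eps (Comp f g)"
proof -
  have "Comp f (Tensor Eps g) \<doteq> Comp (Tensor (Ident 0) f) (Tensor Eps g)"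
    using assms by (intro comp_congs pr_eq.sym[OF pr_eq.unit_left]) auto
  also have "\<dots> \<doteq> Tensor (Comp (Ident 0) Eps) (Comp f g)"
    using assms by (intro tensor_comp) auto
  also have "\<dots> \<doteq> Tensor Eps (Comp f g)"
    using assms by (intro tensor_congs ident_comp) auto
  finally show ?thesis .
qed

text \<open>Both products equal \<open>Comp Eta Eps\<close>, an argument of Eckmann-Hilton type.
  This commutation is not among the defining relations; it comes from interchange and the unit
  laws.\<close>

lemma tensor_Eps_Eta: "Tensor Eps Eta \<doteq> Tensor Eta Eps"
proof -
  have "Tensor Eps Eta \<doteq> Tensor Eps (Comp Eta (Ident 0))"
    by (intro tensor_congs pr_eq.sym[OF ident_comp(2)]) auto
  also have "\<dots> \<doteq> Comp Eta (Tensor Eps (Ident 0))"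
    by (intro pr_eq.sym[OF comp_tensor_Eps]) auto
  also have "\<dots> \<doteq> Comp Eta Eps"
    by (intro comp_congs pr_eq.unit_right) auto
  also have "\<dots> \<doteq> Comp (Tensor Eta (Ident 0)) Eps"
    by (intro comp_congs pr_eq.sym[OF pr_eq.unit_right]) auto
  also have "\<dots> \<doteq> Tensor Eta (Comp (Ident 0) Eps)"
    by (intro comp_tensor_Eta) auto
  also have "\<dots> \<doteq> Tensor Eta Eps"
    by (intro tensor_congs ident_comp) auto
  finally show ?thesis .
qed

lemma tensor_Eps_Eta_left_commute:
  assumes "well_typed R f"
  shows "Tensor Eps (Tensor Eta f) \<doteq> Tensor Eta (Tensor Eps f)"
proof -
  have "Tensor Eps (Tensor Eta f) \<doteq> Tensor (Tensor Eps Eta) f"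
    using assms by (intro pr_eq.sym[OF pr_eq.tensor_assoc]) auto
  also have "\<dots> \<doteq> Tensor (Tensor Eta Eps) f"
    using assms by (intro tensor_congs tensor_Eps_Eta) auto
  also have "\<dots> \<doteq> Tensor Eta (Tensor Eps f)"
    using assms by (intro pr_eq.tensor_assoc) auto
  finally show ?thesis .
qed

text \<open>A cap put in front of a normal form travels to the right past the leading cups, one for
  each leading \<open>False\<close> of the top row \<open>u\<close>, and stops at the first strand
  or cap, or at the end of the word.\<close>

lemma tensor_Eps_merge_rows:
  "Tensor Eps (word_expr (merge_rows u v)) \<doteq> word_expr (merge_rows u (False # v))"
proof (induction u)
  case Nil
  then show ?case by (auto intro: pr_eq.refl)
next
  case (Cons b u)
  show ?case
  proof (cases b)
    case True
    then show ?thesis by (auto intro: pr_eq.refl)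
  next
    case False
    have "Tensor Eps (Tensor Eta (word_expr (merge_rows u v))) \<doteq>
        Tensor Eta (Tensor Eps (word_expr (merge_rows u v)))"
      by (intro tensor_Eps_Eta_left_commute) auto
    also have "\<dots> \<doteq> Tensor Eta (word_expr (merge_rows u (False # v)))"
      by (intro tensor_congs Cons) auto
    finally show ?thesis using False by simp
  qed
qed

lemma word_expr_merge_rows:
  "word_expr w \<doteq> word_expr (merge_rows (top_row w) (bottom_row w))"
proof (induction w rule: word_rel.induct)
  \<comment> \<open>Only a leading cap can break the normal form, since \<open>merge_rows\<close>
    puts cups first.\<close>
  case (4 w)
  have "word_expr (Cap # w) \<doteq> Tensor Eps (word_expr (merge_rows (top_row w) (bottom_row w)))"
    using 4 by (simp, intro tensor_congs) auto
  also have "\<dots> \<doteq> word_expr (merge_rows (top_row w) (False # bottom_row w))"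
    by (rule tensor_Eps_merge_rows)
  finally show ?case by simp
qed (auto intro: pr_eq.refl tensor_congs)

text \<open>Both words are congruent to the same normal form, which is computed from the rows, and
  these are determined by the relation and the type. This is the completeness half of the comparison
  between words and relations.\<close>

lemma word_expr_cong:
  assumes "word_rel w = word_rel w'" "length (bottom_row w) = length (bottom_row w')"
    "length (top_row w) = length (top_row w')"
  shows "word_expr w \<doteq> word_expr w'"
  using word_expr_merge_rows[of w] pr_eq.sym[OF word_expr_merge_rows[of w']]
  unfolding rows_eq_if_word_rel_eq[OF assms] by (rule pr_eq.trans)

section \<open>Closure of words under tensor product and composition\<close>

lemma ev_word_expr:
  assumes "\<And>p. \<phi> p \<in> carrier R"
  shows "ev (word_expr w) \<phi> = \<phi> (word_rel w)"
  using assms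
  by (induction w arbitrary: \<phi> rule: word_rel.induct) (auto simp: insert_is_Un[of "(1, 1)"] Id_on_def)

lemma tensor_word_expr: "Tensor (word_expr w) (word_expr v) \<doteq> word_expr (w @ v)"
proof (induction w)
  case Nil
  then show ?case by (auto intro: pr_eq.unit_left)
next
  case (Cons x w)
  have wt: "well_typed R (tile_expr x)" by (cases x) auto
  have "Tensor (word_expr (x # w)) (word_expr v) \<doteq> Tensor (tile_expr x) (Tensor (word_expr w) (word_expr v))"
    using wt by (simp, intro pr_eq.tensor_assoc) auto
  also have "\<dots> \<doteq> word_expr ((x # w) @ v)"
    using wt Cons by (simp, intro tensor_congs) auto
  finally show ?case .
qed

lemma Ident_word_expr: "Ident k \<doteq> word_expr (replicate k Strand)"
proof (induction k)
  case 0
  then show ?case by (auto intro: pr_eq.refl)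
next
  case (Suc k)
  have "Ident (Suc k) \<doteq> Tensor (Ident 1) (Ident k)"
    using pr_eq.sym[OF pr_eq.tensor_ident[of R t 1 k]] by simp
  also have "\<dots> \<doteq> word_expr (replicate (Suc k) Strand)"
    using Suc by (simp, intro tensor_congs) auto
  finally show ?case .
qed

lemma tensor_Scale_word:
  assumes "well_typed R h" "a \<in> carrier R" "f \<doteq> Scale a g"
  shows "Tensor h f \<doteq> Scale a (Tensor h g)"
  using assms pr_eq_typed[OF assms(3)]
  by (intro pr_eq.trans[OF tensor_congs(1)[OF assms(1,3)]] pr_eq.tensor_scale_right) auto

text \<open>The two words are matched from the left. A leading cup of the upper word or a leading
  cap of the lower one does not touch the middle row and slides out; otherwise the two leading tiles
  meet at the first middle vertex and combine. The exponent counts how often a cap lands on a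
  cup.\<close>

lemma comp_word_expr:
  assumes "length (bottom_row w) = length (top_row v)"
  shows "\<exists>n u. Comp (word_expr w) (word_expr v) \<doteq> Scale (t [^] (n :: nat)) (word_expr u)"
  using assms
proof (induction "length w + length v" arbitrary: w v rule: less_induct)
  case less
  have step: "\<exists>n u. Comp (word_expr w) (word_expr v) \<doteq> Scale (t [^] (n :: nat)) (word_expr u)"
    if "Comp (word_expr w) (word_expr v) \<doteq> Tensor (tile_expr x) (Comp (word_expr w') (word_expr v'))"
      "length w' + length v' < length w + length v" "length (bottom_row w') = length (top_row v')"
    for x w' v'
  proof -
    have wt: "well_typed R (tile_expr x)" by (cases x) auto
    from less.hyps[OF that(2,3)] obtain n u where
      "Comp (word_expr w') (word_expr v') \<doteq> Scale (t [^] (n :: nat)) (word_expr u)" by blast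
    from that(1) tensor_Scale_word[OF wt _ this]
    have "Comp (word_expr w) (word_expr v) \<doteq> Scale (t [^] n) (Tensor (tile_expr x) (word_expr u))"
      by (auto intro: pr_eq.trans)
    then show ?thesis by (intro exI[of _ n] exI[of _ "x # u"]) simp
  qed
  have tiles: "Comp (word_expr (x # w')) (word_expr (y # v')) \<doteq>
      Tensor h (Comp (word_expr w') (word_expr v'))"
    if "Comp (tile_expr x) (tile_expr y) \<doteq> h" "length (bottom_row w') = length (top_row v')" for x y h w' v'
  proof -
    have xy: "well_typed R (tile_expr x)" "well_typed R (tile_expr y)" "src (tile_expr x :: 'a expr) = tgt (tile_expr y :: 'a expr)"
      using pr_eq_typed(1)[OF that(1)] by auto
    have "Comp (word_expr (x # w')) (word_expr (y # v')) \<doteq>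
        Tensor (Comp (tile_expr x) (tile_expr y)) (Comp (word_expr w') (word_expr v'))"
      using xy that(2) by (simp, intro tensor_comp) auto
    also have "\<dots> \<doteq> Tensor h (Comp (word_expr w') (word_expr v'))"
      using that by (intro tensor_congs) auto
    finally show ?thesis .
  qed
  \<comment> \<open>If one word is empty, the other, when nonempty, must begin with the tile that
    avoids the middle row, because the middle rows have equal length.\<close>
  consider w' where "w = Cup # w'" | v' where "v = Cap # v'"
    | x w' y v' where "w = x # w'" "v = y # v'" "x \<noteq> Cup" "y \<noteq> Cap" | "w = []" "v = []"
  proof (cases w; cases v)
    show thesis if "w = x # w'" "v = []" for x w'
      using that(1) less.prems \<open>v = []\<close> 
      by (cases x) (auto intro: \<open>\<And>w'. w = Cup # w' \<Longrightarrow> thesis\<close>)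
    show thesis if "w = []" "v = y # v'" for y v'
      using that less.prems
      by (cases y) (auto intro: \<open>\<And>v'. v = Cap # v' \<Longrightarrow> thesis\<close>)
  qed (metis | blast)+
  then show ?case
  proof cases
    case 1
    have "Comp (word_expr w) (word_expr v) \<doteq> Tensor (tile_expr Cup) (Comp (word_expr w') (word_expr v))"
      using 1 less.prems by (simp, intro comp_tensor_Eta) auto
    then show ?thesis
      by (rule step) (use 1 less.prems in auto)
  next
    case 2
    have "Comp (word_expr w) (word_expr v) \<doteq> Tensor (tile_expr Cap) (Comp (word_expr w) (word_expr v'))"
      using 2 less.prems by (simp, intro comp_tensor_Eps) auto
    then show ?thesis
      by (rule step) (use 2 less.prems in auto)
  next
    case 3
    have len: "length (bottom_row w') = length (top_row v')"
      using 3 less.prems by (cases x; cases y) auto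
    show ?thesis
    \<comment> \<open>Apart from a cap on a cup, one of the two tiles is a strand, so the other one
      survives as the tile \<open>z\<close>.\<close>
    proof (cases "x = Cap \<and> y = Cup")
      case False
      then obtain z where "Comp (tile_expr x) (tile_expr y) \<doteq> tile_expr z"
        using 3 ident_comp[of Eta] ident_comp[of Eps] ident_comp[of "Ident (Suc 0)"]
        by (cases x; cases y) (fastforce intro: that[of Strand] that[of Cup] that[of Cap])+
      from tiles[OF this len] 3(1,2) len show ?thesis
        by (intro step[of z w' v']) auto
    next
      case True
      have typed: "well_typed R (Comp (word_expr w') (word_expr v'))"
        using len by simp
      from less.hyps[of w' v'] len 3 obtain n u where
        u: "Comp (word_expr w') (word_expr v') \<doteq> Scale (t [^] (n :: nat)) (word_expr u)" by auto
      have "Comp (word_expr w) (word_expr v) \<doteq>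
          Tensor (Scale t (Ident 0)) (Comp (word_expr w') (word_expr v'))"
        using tiles[of Cap Cup "Scale t (Ident 0)" w' v'] pr_eq.eps_eta[of R t] len 3 True by simp
      also have "\<dots> \<doteq> Scale t (Tensor (Ident 0) (Comp (word_expr w') (word_expr v')))"
        using typed by (intro pr_eq.tensor_scale_left) auto
      also have "\<dots> \<doteq> Scale t (Scale (t [^] n) (word_expr u))"
        using typed by (intro pr_eq.scale_cong pr_eq.trans[OF pr_eq.unit_left u]) auto
      also have "\<dots> \<doteq> Scale (t \<otimes> t [^] n) (word_expr u)"
        by (intro pr_eq.sym[OF pr_eq.scale_scale]) auto
      finally have "Comp (word_expr w) (word_expr v) \<doteq> Scale (t [^] Suc n) (word_expr u)"
        by (simp add: m_comm)
      then show ?thesis by blast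
    qed
  next
    case 4
    have "Comp (word_expr []) (word_expr []) \<doteq> word_expr []"
      using ident_comp[of "Ident 0"] by simp
    also have "\<dots> \<doteq> Scale (t [^] (0 :: nat)) (word_expr [])"
      by (simp, intro pr_eq.sym[OF pr_eq.scale_one]) auto
    finally show ?thesis using 4 by blast
  qed
qed

end

section \<open>Diagrams of rook relations\<close>

definition rook_diagram :: "nat \<Rightarrow> nat \<Rightarrow> (nat \<times> nat) set \<Rightarrow> diagram" where
  "rook_diagram k l p = (\<lambda>(i, j). {Bottom i, Top j}) ` p \<union>
     (\<lambda>i. {Bottom i}) ` ({1..k} - Domain p) \<union> (\<lambda>j. {Top j}) ` ({1..l} - Range p)"

lemma rook_diagram_cases:
  assumes "B \<in> rook_diagram k l p"
  obtains i j where "(i, j) \<in> p" "B = {Bottom i, Top j}"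
    | i where "i \<in> {1..k}" "i \<notin> Domain p" "B = {Bottom i}"
    | j where "j \<in> {1..l}" "j \<notin> Range p" "B = {Top j}"
  using assms unfolding rook_diagram_def by (elim UnE imageE DiffE) auto

lemma edge_in_rook_diagram: "{Bottom i, Top j} \<in> rook_diagram k l p \<longleftrightarrow> (i, j) \<in> p"
  by (auto simp: rook_diagram_def doubleton_eq_iff)

lemma rook_diagram_eq_iff: "rook_diagram k l p = rook_diagram k l q \<longleftrightarrow> p = q"
  by (metis edge_in_rook_diagram subrelI subset_antisym)

lemma rook_diagram_partition:
  assumes p: "p \<in> rook_rels k l"
  shows "rook_diagram k l p \<in> partitions k l"
  unfolding partitions_def mem_Collect_eq
proof (rule partition_onI)
  have "Bottom i \<in> \<Union> (rook_diagram k l p) \<longleftrightarrow> i \<in> {1..k}" for i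
    using rook_relsD(1)[OF p, of i] unfolding rook_diagram_def by (auto simp: Domain_iff)
  moreover have "Top j \<in> \<Union> (rook_diagram k l p) \<longleftrightarrow> j \<in> {1..l}" for j
    using rook_relsD(1)[OF p, of _ j] unfolding rook_diagram_def by (auto simp: Range_iff)
  ultimately have "v \<in> \<Union> (rook_diagram k l p) \<longleftrightarrow> v \<in> vertices k l" for v
    by (cases v) (auto simp: vertices_def)
  then show "\<Union> (rook_diagram k l p) = vertices k l" by blast
  show "disjnt B B'" if "B \<in> rook_diagram k l p" "B' \<in> rook_diagram k l p" "B \<noteq> B'" for B B'
    using that rook_relsD(2,3)[OF p]
    by (elim rook_diagram_cases) (auto simp: disjnt_iff)
  show "{} \<notin> rook_diagram k l p"
    by (auto simp: rook_diagram_def)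
qed

lemma finite_partitions: "finite (partitions k l)"
proof (rule finite_subset)
  show "partitions k l \<subseteq> Pow (Pow (vertices k l))"
    by (auto simp: partitions_def partition_on_def)
qed (simp add: vertices_def)

lemma juxtapose_rook_diagram:
  assumes p: "p \<in> rook_rels k l" and q: "q \<in> rook_rels k' l'"
  shows "juxtapose k l (rook_diagram k l p) (rook_diagram k' l' q) =
    rook_diagram (k + k') (l + l') (p \<union> shift_rel k l q)"
proof -
  have "Domain p \<subseteq> {1..k}" "Domain q \<subseteq> {1..k'}" "Range p \<subseteq> {1..l}" "Range q \<subseteq> {1..l'}"
    using p q by (auto simp: rook_rels_def)
  note complement_Un_shift[OF this(1,2)] complement_Un_shift[OF this(3,4)]
  moreover have "(\<lambda>x. {Bottom (fst x), Top (snd x)}) ` shift_rel k l q =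
      (\<lambda>x. {Bottom (k + fst x), Top (l + snd x)}) ` q"
    by (simp add: shift_rel_def image_image split_beta)
  ultimately show ?thesis
    by (simp add: juxtapose_def rook_diagram_def Domain_Un_eq Range_Un_eq Domain_shift_rel
        Range_shift_rel image_Un image_image split_beta Un_ac)
qed

text \<open>Closedness confines the set reachable from a point to its block, connectedness fills the
  block. Used for the components of a stack and for the edge components of a drawing.\<close>

lemma quotient_rtrancl_eq_partition:
  assumes C: "partition_on S C"
    and closed: "\<And>c x y. c \<in> C \<Longrightarrow> x \<in> c \<Longrightarrow> (x, y) \<in> r \<Longrightarrow> y \<in> c"
    and connected: "\<And>c x y. c \<in> C \<Longrightarrow> x \<in> c \<Longrightarrow> y \<in> c \<Longrightarrow> (x, y) \<in> r\<^sup>*"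
  shows "S // r\<^sup>* = C"
proof -
  have cls: "r\<^sup>* `` {x} = c" if "c \<in> C" "x \<in> c" for c x
  proof -
    have "y \<in> c" if "(x, y) \<in> r\<^sup>*" for y
      using that by induction (use \<open>x \<in> c\<close> closed[OF \<open>c \<in> C\<close>] in auto)
    then show ?thesis using connected[OF that] by blast
  qed
  show ?thesis
  proof (intro subset_antisym subsetI)
    fix c assume "c \<in> S // r\<^sup>*"
    then obtain x where "x \<in> S" "c = r\<^sup>* `` {x}" by (rule quotientE)
    then show "c \<in> C"
      using cls partition_onD1[OF C] by blast
  next
    fix c assume c: "c \<in> C"
    then obtain x where x: "x \<in> c"
      using partition_onD3[OF C] by fastforce
    then have "x \<in> S" using c partition_onD1[OF C] by blast
    then show "c \<in> S // r\<^sup>*"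
      using cls[OF c x] quotientI by metis
  qed
qed

text \<open>The images under \<open>p\<close> and \<open>q\<inverse>\<close> have at most one
  element for rook relations, so a component is a path of at most three vertices through
  \<open>Middle b\<close>.\<close>

definition middle_component :: "(nat \<times> nat) set \<Rightarrow> (nat \<times> nat) set \<Rightarrow> nat \<Rightarrow> stack_vertex set" where
  "middle_component p q b = {Middle b} \<union> Upper ` p `` {b} \<union> Lower ` q\<inverse> `` {b}"

text \<open>No block of either layer contains two middle vertices, so a component cannot pass
  through more than one of them; components that avoid the middle row are isolated outer
  vertices.\<close>

lemma stack_components_rook_diagram:
  assumes p: "p \<in> rook_rels k l" and q: "q \<in> rook_rels m k"
  shows "stack_components (rook_diagram k l p) (rook_diagram m k q) =
    middle_component p q ` {1..k} \<union> (\<lambda>i. {Lower i}) ` ({1..m} - Domain q) \<union>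
    (\<lambda>j. {Upper j}) ` ({1..l} - Range p)" (is "_ = ?C")
proof -
  define Bs where "Bs = stack_blocks (rook_diagram k l p) (rook_diagram m k q)"
  have Bs: "Bs = (\<lambda>(i, j). {Middle i, Upper j}) ` p \<union> (\<lambda>i. {Middle i}) ` ({1..k} - Domain p) \<union>
      (\<lambda>j. {Upper j}) ` ({1..l} - Range p) \<union> (\<lambda>(i, j). {Lower i, Middle j}) ` q \<union>
      (\<lambda>i. {Lower i}) ` ({1..m} - Domain q) \<union> (\<lambda>j. {Middle j}) ` ({1..k} - Range q)"
    by (simp add: Bs_def stack_blocks_def rook_diagram_def image_Un image_image split_beta Un_ac)
  define r where "r = (\<Union>B\<in>Bs. B \<times> B)"
  have C_cases: "(\<exists>b\<in>{1..k}. c = middle_component p q b) \<or>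
      (\<exists>i. i \<in> {1..m} \<and> i \<notin> Domain q \<and> c = {Lower i}) \<or>
      (\<exists>j. j \<in> {1..l} \<and> j \<notin> Range p \<and> c = {Upper j})" if "c \<in> ?C" for c
    using that by blast
  have r_iff: "(x, y) \<in> r \<longleftrightarrow> (\<exists>B\<in>Bs. x \<in> B \<and> y \<in> B)" for x y
    by (auto simp: r_def)
  have Un: "\<Union> Bs = \<Union> ?C"
  proof -
    note bounds = rook_relsD(1)[OF p] rook_relsD(1)[OF q]
    have "Lower i \<in> \<Union> Bs \<longleftrightarrow> i \<in> {1..m}" "Lower i \<in> \<Union> ?C \<longleftrightarrow> i \<in> {1..m}" for i
      using bounds(2)[of i] unfolding Bs middle_component_def by (auto simp: Domain_iff)
    moreover have "Upper i \<in> \<Union> Bs \<longleftrightarrow> i \<in> {1..l}" "Upper i \<in> \<Union> ?C \<longleftrightarrow> i \<in> {1..l}" for i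
      using bounds(1)[of _ i] unfolding Bs middle_component_def by (auto simp: Range_iff)
    moreover have "Middle i \<in> \<Union> Bs \<longleftrightarrow> i \<in> {1..k}" "Middle i \<in> \<Union> ?C \<longleftrightarrow> i \<in> {1..k}" for i
      using bounds(1)[of i] bounds(2)[of _ i] unfolding Bs middle_component_def
      by (auto simp: Range_iff Domain_iff)
    ultimately have "x \<in> \<Union> Bs \<longleftrightarrow> x \<in> \<Union> ?C" for x
      by (cases x) (simp_all only:)
    then show ?thesis by (rule Set.set_eqI)
  qed
  have "\<Union> ?C // r\<^sup>* = ?C"
  proof (rule quotient_rtrancl_eq_partition)
    show "partition_on (\<Union> ?C) ?C"
    proof (rule partition_onI)
      show "disjnt c c'" if "c \<in> ?C" "c' \<in> ?C" "c \<noteq> c'" for c c'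
        using C_cases[OF that(1)] C_cases[OF that(2)] that(3)
        by (elim disjE bexE exE)
          (auto simp: disjnt_iff middle_component_def dest: rook_relsD(3)[OF p] rook_relsD(2)[OF q])
    qed (auto simp: middle_component_def)
    show "y \<in> c" if "c \<in> ?C" "x \<in> c" "(x, y) \<in> r" for c x y
    proof -
      from that(3) obtain B where "B \<in> Bs" "x \<in> B" "y \<in> B" by (auto simp: r_iff)
      then show ?thesis
        using C_cases[OF that(1)] that(2) unfolding Bs middle_component_def
        by (auto dest: rook_relsD(3)[OF p] rook_relsD(2)[OF q])
    qed
    show "(x, y) \<in> r\<^sup>*" if "c \<in> ?C" "x \<in> c" "y \<in> c" for c x y
      using C_cases[OF that(1)]
    proof (elim disjE)
      assume "\<exists>b\<in>{1..k}. c = middle_component p q b"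
      then obtain b where b: "b \<in> {1..k}" "c = middle_component p q b" by blast
      \<comment> \<open>Every vertex of the component shares a block with \<open>Middle b\<close>,
        so any two of its vertices are linked by two steps through \<open>Middle b\<close>.\<close>
      have "\<exists>B\<in>Bs. x \<in> B \<and> Middle b \<in> B" if "x \<in> c" for x
      proof (cases x)
        case (Lower i)
        then have "(i, b) \<in> q" using that b by (auto simp: middle_component_def)
        then have "{Lower i, Middle b} \<in> Bs" unfolding Bs by force
        with Lower show ?thesis by blast
      next
        case (Middle i)
        then have i: "i = b" using that b by (auto simp: middle_component_def)
        show ?thesis
        proof (cases "b \<in> Domain p")
          case True
          then obtain j where "(b, j) \<in> p" by blast
          then have "{Middle b, Upper j} \<in> Bs" unfolding Bs by force
          with Middle i show ?thesis by blast
        next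
          case False
          then have "{Middle b} \<in> Bs" unfolding Bs using b by blast
          with Middle i show ?thesis by blast
        qed
      next
        case (Upper j)
        then have "(b, j) \<in> p" using that b by (auto simp: middle_component_def)
        then have "{Middle b, Upper j} \<in> Bs" unfolding Bs by force
        with Upper show ?thesis by blast
      qed
      then have "(x, Middle b) \<in> r" "(Middle b, y) \<in> r"
        using that by (auto simp: r_iff)
      then show ?thesis by (meson r_into_rtrancl rtrancl_into_rtrancl)
    qed (use that in auto)
  qed
  with Un show ?thesis
    by (simp add: stack_components_def Bs_def r_def)
qed

lemma inj_middle_component: "inj (middle_component p q)"
  by (rule injI) (auto simp: middle_component_def)

text \<open>A component stays in the middle row exactly when its middle vertex is isolated in both
  layers; injectivity of \<open>middle_component\<close> turns the count of components into a count
  of points.\<close>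

lemma alpha_rook_diagram:
  assumes p: "p \<in> rook_rels k l" and q: "q \<in> rook_rels m k"
  shows "alpha (rook_diagram k l p) (rook_diagram m k q) = loops k p q"
proof -
  define P where "P C \<longleftrightarrow> C \<subseteq> range Middle" for C :: "stack_vertex set"
  have "P (middle_component p q b) \<longleftrightarrow> b \<notin> Domain p \<and> b \<notin> Range q"
    and "\<not> P {Lower i}" "\<not> P {Upper i}" for b i
    by (auto simp: P_def middle_component_def)
  then have "{C \<in> stack_components (rook_diagram k l p) (rook_diagram m k q). P C} =
      middle_component p q ` ({1..k} - Domain p - Range q)"
    unfolding stack_components_rook_diagram[OF p q] by auto
  then show ?thesis
    by (simp add: alpha_def P_def loops_def card_image inj_on_subset[OF inj_middle_component])
qed

text \<open>Restricting a component to the outer rows drops its middle vertex and leaves an edge of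
  \<open>q O p\<close>, a singleton, or, for a closed point, the empty set, which the definition of
  \<open>star\<close> discards.\<close>

lemma star_rook_diagram:
  assumes p: "p \<in> rook_rels k l" and q: "q \<in> rook_rels m k"
  shows "star (rook_diagram k l p) (rook_diagram m k q) = rook_diagram m l (q O p)"
proof -
  have pre: "in_outer -` middle_component p q b = Top ` p `` {b} \<union> Bottom ` q\<inverse> `` {b}" for b
  proof -
    have "v \<in> in_outer -` middle_component p q b \<longleftrightarrow> v \<in> Top ` p `` {b} \<union> Bottom ` q\<inverse> `` {b}" for v
      by (cases v) (auto simp: middle_component_def)
    then show ?thesis by blast
  qed
  have Lower: "in_outer -` {Lower i} = {Bottom i}" and Upper: "in_outer -` {Upper j} = {Top j}" for i j
  proof -
    have "v \<in> in_outer -` {Lower i} \<longleftrightarrow> v = Bottom i" "v \<in> in_outer -` {Upper j} \<longleftrightarrow> v = Top j" for v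
      by (cases v; simp)+
    then show "in_outer -` {Lower i} = {Bottom i}" "in_outer -` {Upper j} = {Top j}"
      by auto
  qed
  have star: "star (rook_diagram k l p) (rook_diagram m k q) =
      ((\<lambda>b. Top ` p `` {b} \<union> Bottom ` q\<inverse> `` {b}) ` {1..k} \<union>
       (\<lambda>i. {Bottom i}) ` ({1..m} - Domain q) \<union> (\<lambda>j. {Top j}) ` ({1..l} - Range p)) - {{}}"
    unfolding star_def stack_components_rook_diagram[OF p q]
    by (simp add: image_Un image_image pre Lower Upper)
  have p_img: "p `` {b} = {j}" if "(b, j) \<in> p" for b j
    using that by (auto dest: rook_relsD(2)[OF p that])
  have q_img: "q\<inverse> `` {b} = {i}" if "(i, b) \<in> q" for b i
    using that by (auto dest: rook_relsD(3)[OF q that])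
  show ?thesis
    unfolding star
  proof (intro subset_antisym subsetI)
    fix B assume B: "B \<in> ((\<lambda>b. Top ` p `` {b} \<union> Bottom ` q\<inverse> `` {b}) ` {1..k} \<union>
       (\<lambda>i. {Bottom i}) ` ({1..m} - Domain q) \<union> (\<lambda>j. {Top j}) ` ({1..l} - Range p)) - {{}}"
    then consider b where "b \<in> {1..k}" "B = Top ` p `` {b} \<union> Bottom ` q\<inverse> `` {b}" "B \<noteq> {}"
      | i where "i \<in> {1..m} - Domain q" "B = {Bottom i}" | j where "j \<in> {1..l} - Range p" "B = {Top j}"
      by blast
    then show "B \<in> rook_diagram m l (q O p)"
    proof cases
      case 1
      \<comment> \<open>\<open>B \<noteq> {}\<close> rules out the fourth combination, in which
        \<open>b\<close> is a closed point.\<close>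
      consider i j where "(i, b) \<in> q" "(b, j) \<in> p" | i where "(i, b) \<in> q" "b \<notin> Domain p"
        | j where "b \<notin> Range q" "(b, j) \<in> p"
        using 1(2,3) by blast
      then show ?thesis
      proof cases
        case (1 i j)
        then have "B = {Bottom i, Top j}" "(i, j) \<in> q O p"
          using \<open>B = _\<close> p_img q_img by auto
        then show ?thesis by (auto simp: edge_in_rook_diagram)
      next
        case (2 i)
        then have "p `` {b} = {}" by blast
        then have "B = {Bottom i}"
          using \<open>B = _\<close> q_img[OF 2(1)] by simp
        moreover have "i \<notin> Domain (q O p)"
          using 2 rook_relsD(2)[OF q 2(1)] by blast
        ultimately show ?thesis
          using rook_relsD(1)[OF q 2(1)] by (auto simp: rook_diagram_def)
      next
        case (3 j)
        then have "q\<inverse> `` {b} = {}" by blast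
        then have "B = {Top j}"
          using \<open>B = _\<close> p_img[OF 3(2)] by simp
        moreover have "j \<notin> Range (q O p)"
          using 3 rook_relsD(3)[OF p 3(2)] by blast
        ultimately show ?thesis
          using rook_relsD(1)[OF p 3(2)] by (auto simp: rook_diagram_def)
      qed
    qed (auto simp: rook_diagram_def)
  next
    fix B assume "B \<in> rook_diagram m l (q O p)"
    then have "B \<in> (\<lambda>b. Top ` p `` {b} \<union> Bottom ` q\<inverse> `` {b}) ` {1..k} \<union>
       (\<lambda>i. {Bottom i}) ` ({1..m} - Domain q) \<union> (\<lambda>j. {Top j}) ` ({1..l} - Range p)"
    proof (cases rule: rook_diagram_cases)
      case (1 i j)
      then obtain b where b: "(i, b) \<in> q" "(b, j) \<in> p" by blast
      then have "B = Top ` p `` {b} \<union> Bottom ` q\<inverse> `` {b}"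
        using 1 p_img q_img by auto
      moreover have "b \<in> {1..k}"
        using rook_relsD(1)[OF p b(2)] by simp
      ultimately show ?thesis by blast
    next
      case (2 i)
      show ?thesis
      proof (cases "i \<in> Domain q")
        case True
        then obtain b where b: "(i, b) \<in> q" by blast
        then have "p `` {b} = {}" using 2 by blast
        then have "B = Top ` p `` {b} \<union> Bottom ` q\<inverse> `` {b}"
          using 2 q_img[OF b] by simp
        moreover have "b \<in> {1..k}"
          using rook_relsD(1)[OF q b] by simp
        ultimately show ?thesis by blast
      qed (use 2 in blast)
    next
      case (3 j)
      show ?thesis
      proof (cases "j \<in> Range p")
        case True
        then obtain b where b: "(b, j) \<in> p" by blast
        then have "q\<inverse> `` {b} = {}" using 3 by blast
        then have "B = Top ` p `` {b} \<union> Bottom ` q\<inverse> `` {b}"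
          using 3 p_img[OF b] by simp
        moreover have "b \<in> {1..k}"
          using rook_relsD(1)[OF p b] by simp
        ultimately show ?thesis by blast
      qed (use 3 in blast)
    qed
    moreover have "B \<noteq> {}"
      using \<open>B \<in> rook_diagram m l (q O p)\<close> by (auto simp: rook_diagram_def)
    ultimately show "B \<in> ((\<lambda>b. Top ` p `` {b} \<union> Bottom ` q\<inverse> `` {b}) ` {1..k} \<union>
       (\<lambda>i. {Bottom i}) ` ({1..m} - Domain q) \<union> (\<lambda>j. {Top j}) ` ({1..l} - Range p)) - {{}}"
      by blast
  qed
qed

context planar_rook_category
begin

section \<open>Evaluation and the partition category\<close>

lemma finsum_mult_delta:
  assumes "finite P" "\<And>i. i \<in> P \<Longrightarrow> c i \<in> carrier R"
  shows "(\<Oplus>i\<in>P. c i \<otimes> (if x = i then \<one> else \<zero>)) = (if x \<in> P then c x else \<zero>)"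
proof -
  have "(\<Oplus>i\<in>P. c i \<otimes> (if x = i then \<one> else \<zero>)) = (\<Oplus>i\<in>P. if x = i then c i else \<zero>)"
    using assms by (intro finsum_cong') auto
  also have "\<dots> = (if x \<in> P then c x else \<zero>)"
  proof (cases "x \<in> P")
    case True
    then show ?thesis
      using assms by (simp add: finsum_singleton)
  next
    case False
    then have "(\<Oplus>i\<in>P. if x = i then c i else \<zero>) = (\<Oplus>i\<in>P. \<zero>)"
      by (intro finsum_cong') auto
    then show ?thesis using False by (simp add: finsum_zero)
  qed
  finally show ?thesis .
qed

lemma ev_product:
  assumes "well_typed R f" "well_typed R g" "c \<in> carrier R"
    and "\<And>p. \<phi> p \<in> carrier R" "\<And>q. \<psi> q \<in> carrier R"
  shows "c \<otimes> (ev f \<phi> \<otimes> ev g \<psi>) = ev f (\<lambda>p. ev g (\<lambda>q. c \<otimes> (\<phi> p \<otimes> \<psi> q)))"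
proof -
  have "ev f (\<lambda>p. ev g (\<lambda>q. c \<otimes> (\<phi> p \<otimes> \<psi> q))) = ev f (\<lambda>p. c \<otimes> ev g \<psi> \<otimes> \<phi> p)"
  proof (intro ev_cong)
    fix p
    have "ev g (\<lambda>q. c \<otimes> (\<phi> p \<otimes> \<psi> q)) = ev g (\<lambda>q. c \<otimes> \<phi> p \<otimes> \<psi> q)"
      using assms by (simp add: m_assoc)
    also have "\<dots> = c \<otimes> \<phi> p \<otimes> ev g \<psi>"
      using assms by (intro ev_mult) auto
    also have "\<dots> = c \<otimes> ev g \<psi> \<otimes> \<phi> p"
      using assms by (simp add: ev_closed m_ac)
    finally show "ev g (\<lambda>q. c \<otimes> (\<phi> p \<otimes> \<psi> q)) = \<dots>" .
  qed (rule assms)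
  also have "\<dots> = c \<otimes> ev g \<psi> \<otimes> ev f \<phi>"
    using assms by (intro ev_mult) (auto intro: ev_closed)
  also have "\<dots> = c \<otimes> (ev f \<phi> \<otimes> ev g \<psi>)"
    using assms by (simp add: ev_closed m_ac)
  finally show ?thesis by simp
qed

text \<open>Turns the sums defining \<open>par_comp\<close> and \<open>par_tensor\<close> into
  iterated evaluations. After exchanging the sum with both evaluations, only the index
  \<open>(F p, G q)\<close> contributes for given \<open>p\<close> and \<open>q\<close>.\<close>

lemma finsum_ev_product:
  assumes fg: "well_typed R f" "well_typed R g" and P: "finite P"
    and c: "\<And>i. i \<in> P \<Longrightarrow> c i \<in> carrier R"
  shows "(\<Oplus>i\<in>P. c i \<otimes> (ev f (\<lambda>p. if F p = fst i then \<one> else \<zero>) \<otimes>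
      ev g (\<lambda>q. if G q = snd i then \<one> else \<zero>))) =
    ev f (\<lambda>p. ev g (\<lambda>q. if (F p, G q) \<in> P then c (F p, G q) else \<zero>))"
proof -
  define \<delta> where "\<delta> p q i = (if (F p, G q) = i then \<one> else \<zero>)" for p q i
  have "(\<Oplus>i\<in>P. c i \<otimes> (ev f (\<lambda>p. if F p = fst i then \<one> else \<zero>) \<otimes>
      ev g (\<lambda>q. if G q = snd i then \<one> else \<zero>))) =
      (\<Oplus>i\<in>P. ev f (\<lambda>p. ev g (\<lambda>q. c i \<otimes> \<delta> p q i)))"
  proof (rule finsum_cong')
    fix i assume i: "i \<in> P"
    have "c i \<otimes> (ev f (\<lambda>p. if F p = fst i then \<one> else \<zero>) \<otimes> ev g (\<lambda>q. if G q = snd i then \<one> else \<zero>)) =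
      ev f (\<lambda>p. ev g (\<lambda>q. c i \<otimes> ((if F p = fst i then \<one> else \<zero>) \<otimes> (if G q = snd i then \<one> else \<zero>))))"
      using fg c[OF i] by (intro ev_product) auto
    also have "\<dots> = ev f (\<lambda>p. ev g (\<lambda>q. c i \<otimes> \<delta> p q i))"
      using fg by (intro ev_cong) (auto simp: \<delta>_def prod_eq_iff)
    finally show "c i \<otimes> (ev f (\<lambda>p. if F p = fst i then \<one> else \<zero>) \<otimes>
        ev g (\<lambda>q. if G q = snd i then \<one> else \<zero>)) = \<dots>" .
  qed (use fg c in \<open>auto simp: \<delta>_def intro!: ev_closed\<close>)
  also have "\<dots> = ev f (\<lambda>p. \<Oplus>i\<in>P. ev g (\<lambda>q. c i \<otimes> \<delta> p q i))"
    using fg P c by (intro ev_finsum[symmetric]) (auto simp: \<delta>_def intro!: ev_closed)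
  also have "\<dots> = ev f (\<lambda>p. ev g (\<lambda>q. \<Oplus>i\<in>P. c i \<otimes> \<delta> p q i))"
    using fg P c by (intro ev_cong ev_finsum[symmetric]) (auto simp: \<delta>_def)
  also have "\<dots> = ev f (\<lambda>p. ev g (\<lambda>q. if (F p, G q) \<in> P then c (F p, G q) else \<zero>))"
    unfolding \<delta>_def using P c by (simp only: finsum_mult_delta)
  finally show ?thesis .
qed

lemma par_diagram_alt:
  "par_diagram R k l D = (\<lambda>E\<in>partitions k l. if D = E then \<one> else \<zero>)"
  unfolding par_diagram_def by (intro restrict_ext) auto

text \<open>The coefficient of a partition \<open>E\<close> is the evaluation at the indicator of
  \<open>E\<close>. In particular, the sums over all partitions reduce to rook diagrams, so stacking
  and juxtaposing are only ever computed for those.\<close>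

lemma expr_to_par_ev:
  assumes "well_typed R f"
  shows "expr_to_par R t f = (\<lambda>E\<in>partitions (src f) (tgt f).
    ev f (\<lambda>p. if rook_diagram (src f) (tgt f) p = E then \<one> else \<zero>))"
  using assms
proof (induction f)
  case Eta
  have "rook_diagram 0 (Suc 0) {} = {{Top (Suc 0)}}"
    by (auto simp: rook_diagram_def)
  then show ?case by (simp add: par_diagram_alt)
next
  case Eps
  have "rook_diagram (Suc 0) 0 {} = {{Bottom (Suc 0)}}"
    by (auto simp: rook_diagram_def)
  then show ?case by (simp add: par_diagram_alt)
next
  case (Ident k)
  have "rook_diagram k k (Id_on {Suc 0..k}) = (\<lambda>i. {Bottom i, Top i}) ` {Suc 0..k}"
    by (auto simp: rook_diagram_def Id_on_def image_iff)
  then show ?case by (simp add: par_id_def par_diagram_alt)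
next
  case (Comp f g)
  define k l m where "k = src f" and "l = tgt f" and "m = src g"
  have fg: "well_typed R f" "well_typed R g" "tgt g = k" "src f = k"
    using Comp.prems by (auto simp: k_def)
  show ?case
  proof (rule ext)
    fix E
    show "expr_to_par R t (Comp f g) E = (\<lambda>E\<in>partitions (src (Comp f g)) (tgt (Comp f g)).
      ev (Comp f g) (\<lambda>p. if rook_diagram (src (Comp f g)) (tgt (Comp f g)) p = E then \<one> else \<zero>)) E"
    proof (cases "E \<in> partitions m l")
      case True
      define P where "P = {(D, D'). D \<in> partitions k l \<and> D' \<in> partitions m k \<and> star D D' = E}"
      have P: "finite P"
        by (rule finite_subset[of _ "partitions k l \<times> partitions m k"])
          (auto simp: P_def finite_partitions)
      have "expr_to_par R t (Comp f g) E = (\<Oplus>i\<in>P. t [^] alpha (fst i) (snd i) \<otimes>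
          (expr_to_par R t f (fst i) \<otimes> expr_to_par R t g (snd i)))"
        using True fg by (simp add: par_comp_def P_def m_def l_def case_prod_unfold)
      also have "\<dots> = (\<Oplus>i\<in>P. t [^] alpha (fst i) (snd i) \<otimes>
          (ev f (\<lambda>p. if rook_diagram k l p = fst i then \<one> else \<zero>) \<otimes>
           ev g (\<lambda>q. if rook_diagram m k q = snd i then \<one> else \<zero>)))"
        unfolding Comp.IH(1)[OF fg(1)] Comp.IH(2)[OF fg(2)] using fg
        by (intro finsum_cong') (auto simp: P_def m_def l_def intro!: m_closed ev_closed)
      also have "\<dots> = ev f (\<lambda>p. ev g (\<lambda>q. if (rook_diagram k l p, rook_diagram m k q) \<in> P
          then t [^] alpha (rook_diagram k l p) (rook_diagram m k q) else \<zero>))"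
        by (rule finsum_ev_product[OF fg(1,2) P, of "\<lambda>i. t [^] alpha (fst i) (snd i)"
              "rook_diagram k l" "rook_diagram m k", unfolded fst_conv snd_conv]) simp
      \<comment> \<open>On rook diagrams \<open>star\<close> is relational composition and
        \<open>alpha\<close> is \<open>loops\<close>, so the condition defining \<open>P\<close>
        becomes a condition on \<open>q O p\<close>.\<close>
      also have "\<dots> = ev f (\<lambda>p. ev g (\<lambda>q. t [^] loops k p q \<otimes>
          (if rook_diagram m l (q O p) = E then \<one> else \<zero>)))"
      proof (intro ev_cong)
        fix p q assume "p \<in> rook_rels (src f) (tgt f)" "q \<in> rook_rels (src g) (tgt g)"
        then have pq: "p \<in> rook_rels k l" "q \<in> rook_rels m k"
          using fg by (auto simp: l_def m_def)
        show "(if (rook_diagram k l p, rook_diagram m k q) \<in> P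
            then t [^] alpha (rook_diagram k l p) (rook_diagram m k q) else \<zero>) =
          t [^] loops k p q \<otimes> (if rook_diagram m l (q O p) = E then \<one> else \<zero>)"
          using rook_diagram_partition[OF pq(1)] rook_diagram_partition[OF pq(2)]
          by (simp add: P_def alpha_rook_diagram[OF pq] star_rook_diagram[OF pq])
      qed (rule fg)+
      finally show ?thesis
        using True fg by (simp add: m_def l_def)
    qed (use fg in \<open>simp add: par_comp_def m_def l_def\<close>)
  qed
next
  case (Tensor f g)
  define k l k' l' where "k = src f" and "l = tgt f" and "k' = src g" and "l' = tgt g"
  note defs = k_def l_def k'_def l'_def
  have fg: "well_typed R f" "well_typed R g"
    using Tensor.prems by auto
  show ?case
  proof (rule ext)
    fix E
    show "expr_to_par R t (Tensor f g) E = (\<lambda>E\<in>partitions (src (Tensor f g)) (tgt (Tensor f g)).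
      ev (Tensor f g) (\<lambda>p. if rook_diagram (src (Tensor f g)) (tgt (Tensor f g)) p = E then \<one> else \<zero>)) E"
    proof (cases "E \<in> partitions (k + k') (l + l')")
      case True
      define P where "P = {(D, D'). D \<in> partitions k l \<and> D' \<in> partitions k' l' \<and> juxtapose k l D D' = E}"
      have P: "finite P"
        by (rule finite_subset[of _ "partitions k l \<times> partitions k' l'"])
          (auto simp: P_def finite_partitions)
      have "expr_to_par R t (Tensor f g) E =
          (\<Oplus>i\<in>P. expr_to_par R t f (fst i) \<otimes> expr_to_par R t g (snd i))"
        using True by (simp add: par_tensor_def P_def defs case_prod_unfold)
      also have "\<dots> = (\<Oplus>i\<in>P. \<one> \<otimes>
          (ev f (\<lambda>p. if rook_diagram k l p = fst i then \<one> else \<zero>) \<otimes>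
           ev g (\<lambda>q. if rook_diagram k' l' q = snd i then \<one> else \<zero>)))"
        unfolding Tensor.IH(1)[OF fg(1)] Tensor.IH(2)[OF fg(2)] using fg
        by (intro finsum_cong') (auto simp: P_def defs ev_closed)
      also have "\<dots> = ev f (\<lambda>p. ev g (\<lambda>q. if (rook_diagram k l p, rook_diagram k' l' q) \<in> P
          then \<one> else \<zero>))"
        using finsum_ev_product[OF fg P, of "\<lambda>i. \<one>"] by simp
      also have "\<dots> = ev f (\<lambda>p. ev g (\<lambda>q.
          if rook_diagram (k + k') (l + l') (p \<union> shift_rel k l q) = E then \<one> else \<zero>))"
      proof (intro ev_cong)
        fix p q assume "p \<in> rook_rels (src f) (tgt f)" "q \<in> rook_rels (src g) (tgt g)"
        then have pq: "p \<in> rook_rels k l" "q \<in> rook_rels k' l'"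
          by (auto simp: defs)
        show "(if (rook_diagram k l p, rook_diagram k' l' q) \<in> P then \<one> else \<zero>) =
          (if rook_diagram (k + k') (l + l') (p \<union> shift_rel k l q) = E then \<one> else \<zero>)"
          using rook_diagram_partition[OF pq(1)] rook_diagram_partition[OF pq(2)]
          by (simp add: P_def juxtapose_rook_diagram[OF pq])
      qed (rule fg)+
      finally show ?thesis
        using True by (simp add: defs)
    qed (simp add: par_tensor_def defs)
  qed
qed (auto simp: par_hom_def)

text \<open>Hence \<open>expr_to_par\<close> is constant on congruence classes, and
  \<open>the_elem\<close> in \<open>to_par\<close> is applied to a singleton.\<close>

lemma expr_to_par_pr_eq:
  assumes "pr_eq R t f g"
  shows "expr_to_par R t f = expr_to_par R t g"
proof -
  note types = pr_eq_typed[OF assms]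
  have "ev f (\<lambda>p. if rook_diagram (src f) (tgt f) p = E then \<one> else \<zero>) =
      ev g (\<lambda>p. if rook_diagram (src f) (tgt f) p = E then \<one> else \<zero>)" for E
    by (rule ev_pr_eq[OF assms]) auto
  then show ?thesis
    unfolding expr_to_par_ev[OF types(1)] expr_to_par_ev[OF types(2)] types(3,4) by simp
qed

end

section \<open>Planarity\<close>

lemma mem_linepath_plane:
  fixes z :: "real ^ 2"
  assumes "z \<in> path_image (linepath (vector [a, c]) (vector [b, d]))"
  obtains u where "0 \<le> u" "u \<le> 1" "z $ 1 = (1 - u) * a + u * b" "z $ 2 = (1 - u) * c + u * d"
proof -
  from assms obtain u where u: "0 \<le> u" "u \<le> 1"
    and z: "z = (1 - u) *\<^sub>R vector [a, c] + u *\<^sub>R (vector [b, d] :: real ^ 2)"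
    by (auto simp: closed_segment_def)
  have "z $ 1 = (1 - u) * a + u * b" "z $ 2 = (1 - u) * c + u * d"
    by (simp_all add: z vector_2)
  with u show ?thesis by (rule that)
qed

lemma vector_eq_plane: "(z :: real ^ 2) = vector [a, b] \<longleftrightarrow> z $ 1 = a \<and> z $ 2 = b"
  by (auto simp: vec_eq_iff forall_2 vector_2)

lemma mem_cbox_plane:
  "(z :: real ^ 2) \<in> cbox (vector [a, b]) (vector [c, d]) \<longleftrightarrow> a \<le> z $ 1 \<and> z $ 1 \<le> c \<and> b \<le> z $ 2 \<and> z $ 2 \<le> d"
  by (auto simp: mem_box_cart forall_2 vector_2)

lemma convex_comb_bounds:
  fixes u :: real
  assumes "0 \<le> u" "u \<le> 1" "lo \<le> a" "a \<le> hi" "lo \<le> b" "b \<le> hi"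
  shows "lo \<le> (1 - u) * a + u * b" "(1 - u) * a + u * b \<le> hi"
proof -
  have "(1 - u) * lo + u * lo \<le> (1 - u) * a + u * b"
    using assms by (intro add_mono mult_left_mono) auto
  then show "lo \<le> (1 - u) * a + u * b" by (simp add: algebra_simps)
  have "(1 - u) * a + u * b \<le> (1 - u) * hi + u * hi"
    using assms by (intro add_mono mult_left_mono) auto
  then show "(1 - u) * a + u * b \<le> hi" by (simp add: algebra_simps)
qed

text \<open>Both paths are prolonged to a larger rectangle, \<open>f\<close> to a path from its left to its right side
  and \<open>g\<close> to a path from its lower to its upper side; the prolongations are disjoint from each
  other, so that the intersection point provided by \<open>fashoda\<close> lies on \<open>f\<close> and \<open>g\<close> themselves.\<close>

lemma crossing_paths_meet:
  fixes f g :: "real \<Rightarrow> real ^ 2"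
  assumes f: "path f" "path_image f \<subseteq> cbox (vector [x0, 0]) (vector [x1, 1])"
      "pathstart f = vector [a, 0]" "pathfinish f = vector [b, 1]"
    and g: "path g" "path_image g \<subseteq> cbox (vector [x0, 0]) (vector [x1, 1])"
      "pathstart g = vector [a', 0]" "pathfinish g = vector [b', 1]"
    and "a < a'" "b' < b"
  shows "path_image f \<inter> path_image g \<noteq> {}"
proof -
  \<comment> \<open>The rectangle grows by 1 on every side. \<open>s1\<close> runs from the new
    lower left corner and stays at abscissae at most \<open>a\<close>, hence left of the vertical
    segment \<open>t1\<close> at \<open>a'\<close>; \<open>s2\<close> runs to the new upper right
    corner and stays at abscissae at least \<open>b\<close>, hence right of \<open>t2\<close> at
    \<open>b'\<close>.\<close>
  define s1 s2 t1 t2 :: "real \<Rightarrow> real ^ 2" where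
    "s1 = linepath (vector [x0 - 1, -1]) (vector [a, 0])" and
    "s2 = linepath (vector [b, 1]) (vector [x1 + 1, 2])" and
    "t1 = linepath (vector [a', -1]) (vector [a', 0])" and
    "t2 = linepath (vector [b', 1]) (vector [b', 2])"
  note st = s1_def s2_def t1_def t2_def
  define F G where "F = s1 +++ f +++ s2" and "G = t1 +++ g +++ t2"
  have ends: "vector [a, 0] \<in> path_image f" "vector [b, 1] \<in> path_image f"
      "vector [a', 0] \<in> path_image g" "vector [b', 1] \<in> path_image g"
    using f g by (metis pathstart_in_path_image pathfinish_in_path_image)+
  have f_box: "x0 \<le> z $ 1 \<and> z $ 1 \<le> x1 \<and> 0 \<le> z $ 2 \<and> z $ 2 \<le> 1" if "z \<in> path_image f" for z
    using that f(2) by (auto simp: mem_cbox_plane)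
  have g_box: "x0 \<le> z $ 1 \<and> z $ 1 \<le> x1 \<and> 0 \<le> z $ 2 \<and> z $ 2 \<le> 1" if "z \<in> path_image g" for z
    using that g(2) by (auto simp: mem_cbox_plane)
  have bounds: "x0 \<le> a" "a \<le> x1" "x0 \<le> b" "b \<le> x1" "x0 \<le> a'" "a' \<le> x1" "x0 \<le> b'" "b' \<le> x1"
    using f_box[OF ends(1)] f_box[OF ends(2)] g_box[OF ends(3)] g_box[OF ends(4)]
    by (simp_all add: vector_2)
  have s1: "x0 - 1 \<le> z $ 1 \<and> z $ 1 \<le> a \<and> -1 \<le> z $ 2 \<and> z $ 2 \<le> 0 \<and> (z $ 2 = 0 \<longrightarrow> z = vector [a, 0])"
    if "z \<in> path_image s1" for z
    using that unfolding s1_def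
  proof (rule mem_linepath_plane)
    fix u assume u: "0 \<le> u" "u \<le> 1" "z $ 1 = (1 - u) * (x0 - 1) + u * a" "z $ 2 = (1 - u) * -1 + u * 0"
    then show ?thesis
      using convex_comb_bounds[of u "x0 - 1" "x0 - 1" a a] bounds
      by (auto simp: vector_eq_plane)
  qed
  have s2: "b \<le> z $ 1 \<and> z $ 1 \<le> x1 + 1 \<and> 1 \<le> z $ 2 \<and> z $ 2 \<le> 2 \<and> (z $ 2 = 1 \<longrightarrow> z = vector [b, 1])"
    if "z \<in> path_image s2" for z
    using that unfolding s2_def
  proof (rule mem_linepath_plane)
    fix u assume u: "0 \<le> u" "u \<le> 1" "z $ 1 = (1 - u) * b + u * (x1 + 1)" "z $ 2 = (1 - u) * 1 + u * 2"
    then show ?thesis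
      using convex_comb_bounds[of u b b "x1 + 1" "x1 + 1"] bounds
      by (auto simp: vector_eq_plane algebra_simps)
  qed
  have t1: "z $ 1 = a' \<and> -1 \<le> z $ 2 \<and> z $ 2 \<le> 0" if "z \<in> path_image t1" for z
    using that unfolding t1_def by (rule mem_linepath_plane) (auto simp: algebra_simps)
  have t2: "z $ 1 = b' \<and> 1 \<le> z $ 2 \<and> z $ 2 \<le> 2" if "z \<in> path_image t2" for z
    using that unfolding t2_def by (rule mem_linepath_plane) (auto simp: algebra_simps)
  have F: "path_image F = path_image s1 \<union> path_image f \<union> path_image s2" "path F"
    using f unfolding F_def st by (simp_all add: path_image_join Un_assoc)
  have G: "path_image G = path_image t1 \<union> path_image g \<union> path_image t2" "path G"
    using g unfolding G_def st by (simp_all add: path_image_join Un_assoc)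
  obtain z where z: "z \<in> path_image F" "z \<in> path_image G"
  proof (rule fashoda[of F G "vector [x0 - 1, -1]" "vector [x1 + 1, 2]"])
    show "path_image F \<subseteq> cbox (vector [x0 - 1, - 1]) (vector [x1 + 1, 2])"
    proof
      fix z assume "z \<in> path_image F"
      then show "z \<in> cbox (vector [x0 - 1, - 1]) (vector [x1 + 1, 2])"
        unfolding F(1) mem_cbox_plane using s1[of z] f_box[of z] s2[of z] bounds by auto
    qed
    show "path_image G \<subseteq> cbox (vector [x0 - 1, - 1]) (vector [x1 + 1, 2])"
    proof
      fix z assume "z \<in> path_image G"
      then show "z \<in> cbox (vector [x0 - 1, - 1]) (vector [x1 + 1, 2])"
        unfolding G(1) mem_cbox_plane using t1[of z] g_box[of z] t2[of z] bounds by auto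
    qed
  qed (use F(2) G(2) in \<open>auto simp: F_def G_def st vector_2\<close>)
  have zg: "z = vector [a', 0]" if "z \<in> path_image t1" "z $ 2 = 0"
    using t1[OF that(1)] that(2) by (simp add: vector_eq_plane)
  have zg': "z = vector [b', 1]" if "z \<in> path_image t2" "z $ 2 = 1"
    using t2[OF that(1)] that(2) by (simp add: vector_eq_plane)
  \<comment> \<open>Outside the strip of heights 0 to 1 the point would lie on prolongations of both
    paths, which their abscissae exclude. Inside the strip a prolongation contributes only its
    junction point, which lies on the original path.\<close>
  have "z \<in> path_image f \<and> z \<in> path_image g"
  proof (cases "z $ 2 < 0 \<or> z $ 2 > 1")
    case True
    then show ?thesis
      using z s1[of z] s2[of z] t1[of z] t2[of z] f_box[of z] g_box[of z] \<open>a < a'\<close> \<open>b' < b\<close>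
      unfolding F(1) G(1) by auto
  next
    case False
    have "z \<in> path_image f"
      using z(1) s1[of z] s2[of z] False ends unfolding F(1) by force
    moreover have "z \<in> path_image g"
      using z(2) t1[of z] t2[of z] False ends zg zg' unfolding G(1) by force
    ultimately show ?thesis by blast
  qed
  then show ?thesis by blast
qed

section \<open>Planar rook diagrams and monotone relations\<close>

lemma rook_blocks:
  assumes "\<forall>u\<in>B. \<forall>v\<in>B. u \<noteq> v \<longrightarrow> is_top u \<noteq> is_top v" "B \<noteq> {}"
  obtains i where "B = {Bottom i}" | j where "B = {Top j}" | i j where "B = {Bottom i, Top j}"
proof -
  have bot: "i = i'" if "Bottom i \<in> B" "Bottom i' \<in> B" for i i'
    using assms(1) that by (metis vertex.disc(3) vertex.inject(1))
  have top: "j = j'" if "Top j \<in> B" "Top j' \<in> B" for j j'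
    using assms(1) that by (metis vertex.disc(4) vertex.inject(2))
  show ?thesis
  proof (cases "\<exists>i. Bottom i \<in> B")
    case True
    then obtain i where i: "Bottom i \<in> B" by blast
    show ?thesis
    proof (cases "\<exists>j. Top j \<in> B")
      case True
      then obtain j where "Top j \<in> B" by blast
      with i bot top have "v \<in> B \<longleftrightarrow> v \<in> {Bottom i, Top j}" for v by (cases v) auto
      then show ?thesis using that(3) by blast
    next
      case False
      with i bot have "v \<in> B \<longleftrightarrow> v \<in> {Bottom i}" for v by (cases v) auto
      then show ?thesis using that(1) by blast
    qed
  next
    case False
    with assms(2) obtain j where "Top j \<in> B" by (metis ex_in_conv vertex.exhaust)
    with False top have "v \<in> B \<longleftrightarrow> v \<in> {Top j}" for v by (cases v) auto
    then show ?thesis using that(2) by blast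
  qed
qed

lemma rook_partition_eq_rook_diagram:
  assumes D: "D \<in> partitions k l" and rook: "is_rook D"
  obtains p where "p \<in> rook_rels k l" "D = rook_diagram k l p"
proof
  define p where "p = {(i, j). {Bottom i, Top j} \<in> D}"
  have part: "partition_on (vertices k l) D"
    using D by (simp add: partitions_def)
  have same: "B = B'" if "B \<in> D" "B' \<in> D" "v \<in> B" "v \<in> B'" for B B' v
    using that partition_onD2[OF part] by (auto simp: disjoint_def)
  have in_vertices: "v \<in> vertices k l" if "B \<in> D" "v \<in> B" for B v
    using that partition_onD1[OF part] by blast
  have block: "\<exists>B\<in>D. v \<in> B" if "v \<in> vertices k l" for v
    using that partition_onD1[OF part] by blast
  have rows: "\<forall>u\<in>B. \<forall>v\<in>B. u \<noteq> v \<longrightarrow> is_top u \<noteq> is_top v" if "B \<in> D" for B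
    using rook that unfolding is_rook_def by blast
  have ne: "B \<noteq> {}" if "B \<in> D" for B
    using that partition_onD3[OF part] by auto
  show "p \<in> rook_rels k l"
  proof (rule rook_relsI)
    show "1 \<le> i \<and> i \<le> k \<and> 1 \<le> j \<and> j \<le> l" if "(i, j) \<in> p" for i j
      using that in_vertices[of "{Bottom i, Top j}" "Bottom i"]
        in_vertices[of "{Bottom i, Top j}" "Top j"] by (auto simp: p_def vertices_def)
    show "j' = j" if "(i, j) \<in> p" "(i, j') \<in> p" for i j j'
      using that same[of "{Bottom i, Top j}" "{Bottom i, Top j'}" "Bottom i"]
      by (auto simp: p_def doubleton_eq_iff)
    show "i' = i" if "(i, j) \<in> p" "(i', j) \<in> p" for i i' j
      using that same[of "{Bottom i, Top j}" "{Bottom i', Top j}" "Top j"]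
      by (auto simp: p_def doubleton_eq_iff)
  qed
  have bottom: "i \<notin> Domain p" if "{Bottom i} \<in> D" for i
  proof
    assume "i \<in> Domain p"
    then obtain j where "{Bottom i, Top j} \<in> D" by (auto simp: p_def)
    from same[OF that this, of "Bottom i"] show False by auto
  qed
  have top: "j \<notin> Range p" if "{Top j} \<in> D" for j
  proof
    assume "j \<in> Range p"
    then obtain i where "{Bottom i, Top j} \<in> D" by (auto simp: p_def)
    from same[OF that this, of "Top j"] show False by auto
  qed
  show "D = rook_diagram k l p"
  proof (intro subset_antisym subsetI)
    fix B assume B: "B \<in> D"
    from rows[OF B] ne[OF B] show "B \<in> rook_diagram k l p"
    proof (cases rule: rook_blocks)
      case (1 i)
      then show ?thesis
        using B bottom[of i] in_vertices[OF B, of "Bottom i"]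
        by (auto simp: rook_diagram_def vertices_def)
    next
      case (2 j)
      then show ?thesis
        using B top[of j] in_vertices[OF B, of "Top j"]
        by (auto simp: rook_diagram_def vertices_def)
    next
      case (3 i j)
      then show ?thesis using B by (simp add: edge_in_rook_diagram p_def)
    qed
  next
    fix B assume "B \<in> rook_diagram k l p"
    then show "B \<in> D"
    proof (cases rule: rook_diagram_cases)
      case (1 i j)
      then show ?thesis by (simp add: p_def)
    next
      case (2 i)
      then obtain B' where B': "B' \<in> D" "Bottom i \<in> B'"
        using block[of "Bottom i"] by (auto simp: vertices_def)
      from rows[OF B'(1)] ne[OF B'(1)] show ?thesis
        by (cases rule: rook_blocks) (use B' 2 in \<open>auto simp: p_def\<close>)
    next
      case (3 j)
      then obtain B' where B': "B' \<in> D" "Top j \<in> B'"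
        using block[of "Top j"] by (auto simp: vertices_def)
      from rows[OF B'(1)] ne[OF B'(1)] show ?thesis
        by (cases rule: rook_blocks) (use B' 3 in \<open>auto simp: p_def\<close>)
    qed
  qed
qed

text \<open>A drawing may choose its edges freely, but here there is no choice: a path from
  \<open>u\<close> to \<open>v\<close> leaves \<open>u\<close> along an edge inside the component,
  and edges of cardinality 2 exclude a return to \<open>u\<close>.\<close>

lemma edge_of_two_element_component:
  assumes "{u, v} \<in> edge_components V E" "u \<noteq> v" "\<forall>e\<in>E. card e = 2"
  shows "{u, v} \<in> E"
proof -
  define r where "r = {(u, v). {u, v} \<in> E}"
  have "sym (r\<^sup>*)"
    by (intro sym_rtrancl symI) (simp add: r_def insert_commute)
  from assms(1) obtain x where "{u, v} = r\<^sup>* `` {x}"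
    unfolding edge_components_def r_def[symmetric] by (auto elim!: quotientE)
  then have cls: "(x, w) \<in> r\<^sup>* \<longleftrightarrow> w \<in> {u, v}" for w
    by blast
  then have ux: "(u, x) \<in> r\<^sup>*"
    using symD[OF \<open>sym (r\<^sup>*)\<close>] by blast
  with cls have "(u, v) \<in> r\<^sup>*"
    by (meson insertCI rtrancl_trans)
  then obtain w where w: "(u, w) \<in> r"
    using assms(2) by (metis converse_rtranclE)
  then have "(x, w) \<in> r\<^sup>*"
    using cls[of u] by (auto intro: rtrancl_into_rtrancl)
  then have "w \<in> {u, v}"
    using cls by blast
  moreover have "w \<noteq> u"
    using w assms(3) by (auto simp: r_def)
  ultimately show ?thesis
    using w by (simp add: r_def)
qed

text \<open>If \<open>i < i'\<close> but \<open>j' < j\<close>, the arcs of the two strands must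
  meet by \<open>crossing_paths_meet\<close>, although edges without a common vertex have disjoint
  arcs. The case \<open>j = j'\<close> fails already for rook relations.\<close>

lemma planar_rook_diagram_monotone:
  assumes p: "p \<in> rook_rels k l" and planar: "is_planar k l (rook_diagram k l p)"
  shows "p \<in> monotone_rels k l"
proof -
  from planar obtain E \<gamma> where drawing: "is_drawing k l (rook_diagram k l p) E \<gamma>"
    by (auto simp: is_planar_def)
  have E: "\<forall>e\<in>E. card e = 2" "edge_components (vertices k l) E = rook_diagram k l p"
    using drawing by (simp_all add: is_drawing_def)
  have arcs: "arc (\<gamma> e)" "{pathstart (\<gamma> e), pathfinish (\<gamma> e)} = position ` e"
      "path_image (\<gamma> e) \<subseteq> rectangle k l" if "e \<in> E" for e
    using drawing that by (simp_all add: is_drawing_def)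
  have disj: "path_image (\<gamma> e) \<inter> path_image (\<gamma> e') \<subseteq> position ` (e \<inter> e')"
    if "e \<in> E" "e' \<in> E" "e \<noteq> e'" for e e'
    using drawing that unfolding is_drawing_def by blast
  have edge: "{Bottom i, Top j} \<in> E" if "(i, j) \<in> p" for i j
  proof (rule edge_of_two_element_component)
    show "{Bottom i, Top j} \<in> edge_components (vertices k l) E"
      using that unfolding E(2) by (simp add: edge_in_rook_diagram)
  qed (use E(1) in simp_all)
  \<comment> \<open>A drawing prescribes only the unordered pair of end points, so an arc may have
    to be reversed to run from bottom to top.\<close>
  have oriented: "\<exists>f. path f \<and> path_image f = path_image (\<gamma> {Bottom i, Top j}) \<and>
      pathstart f = vector [real i, 0] \<and> pathfinish f = vector [real j, 1]" if "(i, j) \<in> p" for i j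
  proof -
    let ?\<gamma> = "\<gamma> {Bottom i, Top j}"
    have "{pathstart ?\<gamma>, pathfinish ?\<gamma>} = {vector [real i, 0], vector [real j, 1]}"
      using arcs(2)[OF edge[OF that]] by simp
    then consider "pathstart ?\<gamma> = vector [real i, 0]" "pathfinish ?\<gamma> = vector [real j, 1]"
      | "pathfinish ?\<gamma> = vector [real i, 0]" "pathstart ?\<gamma> = vector [real j, 1]"
      by (auto simp: doubleton_eq_iff)
    then show ?thesis
    proof cases
      case 1
      then show ?thesis using arc_imp_path[OF arcs(1)[OF edge[OF that]]] by blast
    next
      case 2
      then show ?thesis using arc_imp_path[OF arcs(1)[OF edge[OF that]]]
        by (intro exI[of _ "reversepath ?\<gamma>"]) simp
    qed
  qed
  have "j < j'" if ij: "(i, j) \<in> p" "(i', j') \<in> p" "i < i'" for i j i' j'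
  proof (rule ccontr)
    assume "\<not> j < j'"
    moreover have "j \<noteq> j'"
      using rook_relsD(3)[OF p ij(1), of i'] ij by auto
    ultimately have "j' < j" by simp
    obtain f g where f: "path f" "path_image f = path_image (\<gamma> {Bottom i, Top j})"
        "pathstart f = vector [real i, 0]" "pathfinish f = vector [real j, 1]"
      and g: "path g" "path_image g = path_image (\<gamma> {Bottom i', Top j'})"
        "pathstart g = vector [real i', 0]" "pathfinish g = vector [real j', 1]"
      using oriented[OF ij(1)] oriented[OF ij(2)] by blast
    have "path_image f \<inter> path_image g \<noteq> {}"
    proof (rule crossing_paths_meet[OF f(1) _ f(3,4) g(1) _ g(3,4)])
      show "path_image f \<subseteq> cbox (vector [1, 0]) (vector [real (max k l), 1])"
        "path_image g \<subseteq> cbox (vector [1, 0]) (vector [real (max k l), 1])"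
        using arcs(3)[OF edge[OF ij(1)]] arcs(3)[OF edge[OF ij(2)]]
        by (simp_all only: f(2) g(2) rectangle_def)
    qed (use \<open>i < i'\<close> \<open>j' < j\<close> in auto)
    moreover have "{Bottom i, Top j} \<inter> {Bottom i', Top j'} = {}"
      using \<open>i < i'\<close> \<open>j' < j\<close> by auto
    moreover have "{Bottom i, Top j} \<noteq> {Bottom i', Top j'}"
      using \<open>i < i'\<close> by (auto simp: doubleton_eq_iff)
    ultimately show False
      using disj[OF edge[OF ij(1)] edge[OF ij(2)]] unfolding f(2) g(2) by auto
  qed
  with p show ?thesis by (auto simp: monotone_rels_def)
qed

lemma is_rook_rook_diagram: "is_rook (rook_diagram k l p)"
  unfolding is_rook_def
proof
  fix B assume "B \<in> rook_diagram k l p"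
  then show "card B \<le> 2 \<and> (\<forall>u\<in>B. \<forall>v\<in>B. u \<noteq> v \<longrightarrow> is_top u \<noteq> is_top v)"
    by (cases rule: rook_diagram_cases) auto
qed

text \<open>Straight segments give a drawing: at each height the abscissa of a strand is a convex
  combination of its two ends, so the strict order of the ends persists at every height.\<close>

lemma is_planar_rook_diagram:
  assumes "p \<in> monotone_rels k l"
  shows "is_planar k l (rook_diagram k l p)"
proof -
  have p: "p \<in> rook_rels k l"
    and mono: "(i, j) \<in> p \<Longrightarrow> (i', j') \<in> p \<Longrightarrow> i < i' \<Longrightarrow> j < j'" for i j i' j'
    using assms by (auto simp: monotone_rels_def)
  define E where "E = (\<lambda>(i, j). {Bottom i, Top j}) ` p"
  \<comment> \<open>Arcs are indexed by edges as sets; the descriptions recover the bottom and the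
    top end of such a set.\<close>
  define \<gamma> :: "vertex set \<Rightarrow> real \<Rightarrow> real ^ 2" where
    "\<gamma> e = linepath (vector [real (THE i. Bottom i \<in> e), 0]) (vector [real (THE j. Top j \<in> e), 1])" for e
  have \<gamma>: "\<gamma> {Bottom i, Top j} = linepath (vector [real i, 0]) (vector [real j, 1])" for i j
    by (simp add: \<gamma>_def)
  have on_line: "0 \<le> z $ 2 \<and> z $ 2 \<le> 1 \<and> z $ 1 = (1 - z $ 2) * real i + z $ 2 * real j"
    if "z \<in> path_image (\<gamma> {Bottom i, Top j})" for z i j
    using that unfolding \<gamma> by (rule mem_linepath_plane) auto
  have bounds: "Bottom i \<in> vertices k l" "Top j \<in> vertices k l" "1 \<le> i" "i \<le> k" "1 \<le> j" "j \<le> l"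
    if "(i, j) \<in> p" for i j
    using rook_relsD(1)[OF p that] by (auto simp: vertices_def)
  have E_cases: "\<exists>i j. (i, j) \<in> p \<and> e = {Bottom i, Top j}" if "e \<in> E" for e
    using that by (auto simp: E_def)
  have components: "edge_components (vertices k l) E = rook_diagram k l p"
    unfolding edge_components_def
  proof (rule quotient_rtrancl_eq_partition)
    show "partition_on (vertices k l) (rook_diagram k l p)"
      using rook_diagram_partition[OF p] by (simp add: partitions_def)
    have edges: "(\<exists>i j. (i, j) \<in> p \<and> (u = Bottom i \<and> v = Top j \<or> u = Top j \<and> v = Bottom i))"
      if "{u, v} \<in> E" for u v
      using E_cases[OF that] by (auto simp: doubleton_eq_iff)
    show "y \<in> c" if "c \<in> rook_diagram k l p" "x \<in> c" "(x, y) \<in> {(u, v). {u, v} \<in> E}" for c x y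
    proof -
      from that(3) have "{x, y} \<in> E" by simp
      from edges[OF this] obtain i j
        where ij: "(i, j) \<in> p" "x = Bottom i \<and> y = Top j \<or> x = Top j \<and> y = Bottom i" by blast
      from that(1) show ?thesis
        by (cases rule: rook_diagram_cases)
          (use that(2) ij in \<open>auto dest: rook_relsD(2)[OF p ij(1)] rook_relsD(3)[OF p ij(1)]\<close>)
    qed
    show "(x, y) \<in> {(u, v). {u, v} \<in> E}\<^sup>*" if "c \<in> rook_diagram k l p" "x \<in> c" "y \<in> c" for c x y
      using that(1)
    proof (cases rule: rook_diagram_cases)
      case (1 i j)
      then have "{Bottom i, Top j} \<in> E" "{Top j, Bottom i} \<in> E"
        by (auto simp: E_def insert_commute)
      then show ?thesis using that 1 by (cases "x = y") (auto intro!: r_into_rtrancl)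
    qed (use that in auto)
  qed
  have "is_drawing k l (rook_diagram k l p) E \<gamma>"
    unfolding is_drawing_def
  proof (intro conjI ballI impI)
    fix e assume "e \<in> E"
    then obtain i j where ij: "(i, j) \<in> p" and e: "e = {Bottom i, Top j}"
      using E_cases by blast
    show "e \<subseteq> vertices k l"
      using bounds[OF ij] e by simp
    show "card e = 2"
      by (simp add: e)
    show "arc (\<gamma> e)"
      unfolding e \<gamma> by (rule arc_linepath) (simp add: vector_eq_plane vector_2)
    show "{pathstart (\<gamma> e), pathfinish (\<gamma> e)} = position ` e"
      by (simp add: e \<gamma>)
    show "path_image (\<gamma> e) \<subseteq> rectangle k l"
    proof
      fix z assume "z \<in> path_image (\<gamma> e)"
      from on_line[OF this[unfolded e]] show "z \<in> rectangle k l"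
        using convex_comb_bounds[of "z $ 2" 1 "real i" "real (max k l)" "real j"] bounds[OF ij]
        by (simp add: rectangle_def mem_cbox_plane)
    qed
    show "path_image (\<gamma> e) \<inter> position ` vertices k l = position ` e"
    proof (intro subset_antisym subsetI)
      fix z assume z: "z \<in> path_image (\<gamma> e) \<inter> position ` vertices k l"
      then obtain v where v: "z = position v" by blast
      \<comment> \<open>A vertex has height 0 or 1, where the segment passes only through its own
        ends.\<close>
      show "z \<in> position ` e"
        using on_line[of z i j] z unfolding e v by (cases v) (auto simp: vector_2)
    next
      fix z assume z: "z \<in> position ` e"
      then have "z \<in> path_image (\<gamma> e)"
        unfolding e \<gamma> by (auto simp: path_image_linepath)
      then show "z \<in> path_image (\<gamma> e) \<inter> position ` vertices k l"
        using z bounds[OF ij] unfolding e by blast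
    qed
    fix e' assume "e' \<in> E" "e \<noteq> e'"
    then obtain i' j' where ij': "(i', j') \<in> p" and e': "e' = {Bottom i', Top j'}"
      using E_cases by blast
    have disj: False if "(i, j) \<in> p" "(i', j') \<in> p" "i < i'"
      "z \<in> path_image (\<gamma> {Bottom i, Top j})" "z \<in> path_image (\<gamma> {Bottom i', Top j'})" for i j i' j' z
    proof -
      have "j < j'" using mono that by blast
      note on_line[OF that(4)] on_line[OF that(5)]
      \<comment> \<open>Below height 1 the strictness comes from \<open>i < i'\<close>, at height 1
        from \<open>j < j'\<close>.\<close>
      moreover have "(1 - z $ 2) * real i + z $ 2 * real j < (1 - z $ 2) * real i' + z $ 2 * real j'"
      proof (cases "z $ 2 = 1")
        case False
        then show ?thesis
          using calculation \<open>i < i'\<close> \<open>j < j'\<close>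
          by (intro add_less_le_mono mult_strict_left_mono mult_left_mono) auto
      qed (use \<open>j < j'\<close> in simp)
      ultimately show False by linarith
    qed
    have "i \<noteq> i'"
      using rook_relsD(2)[OF p ij, of j'] ij' \<open>e \<noteq> e'\<close> by (auto simp: e e')
    then show "path_image (\<gamma> e) \<inter> path_image (\<gamma> e') \<subseteq> position ` (e \<inter> e')"
      using disj[OF ij ij'] disj[OF ij' ij] by (fastforce simp: e e' neq_iff)
  qed (rule components)
  then show ?thesis
    by (auto simp: is_planar_def)
qed

lemma planar_rook_diagrams_eq: "planar_rook_diagrams k l = rook_diagram k l ` monotone_rels k l"
proof (intro subset_antisym subsetI)
  fix D assume D: "D \<in> planar_rook_diagrams k l"
  then obtain p where "p \<in> rook_rels k l" "D = rook_diagram k l p"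
    by (auto simp: planar_rook_diagrams_def intro: rook_partition_eq_rook_diagram)
  with D show "D \<in> rook_diagram k l ` monotone_rels k l"
    by (auto simp: planar_rook_diagrams_def intro: planar_rook_diagram_monotone)
next
  fix D assume "D \<in> rook_diagram k l ` monotone_rels k l"
  then show "D \<in> planar_rook_diagrams k l"
    by (auto simp: planar_rook_diagrams_def is_rook_rook_diagram is_planar_rook_diagram monotone_rels_def
        intro: rook_diagram_partition)
qed

section \<open>The basis\<close>

context planar_rook_category
begin

section \<open>Morphism modules of congruence classes\<close>

lemma mem_pr_class: "g \<in> pr_class R t f \<longleftrightarrow> f \<doteq> g"
  by (simp add: pr_class_def)

lemma pr_class_eq: "f \<doteq> g \<Longrightarrow> pr_class R t f = pr_class R t g"
  by (auto simp: pr_class_def intro: pr_eq.trans pr_eq.sym)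

lemma pr_class_eq_iff: "well_typed R f \<Longrightarrow> pr_class R t f = pr_class R t g \<longleftrightarrow> f \<doteq> g"
  by (metis mem_pr_class pr_class_eq pr_eq.refl pr_eq.sym)

lemma exprs_Add: "f \<in> exprs R k l \<Longrightarrow> g \<in> exprs R k l \<Longrightarrow> Add f g \<in> exprs R k l"
  by (simp add: exprs_def)

lemma exprs_Scale: "a \<in> carrier R \<Longrightarrow> f \<in> exprs R k l \<Longrightarrow> Scale a f \<in> exprs R k l"
  by (simp add: exprs_def)

lemma exprs_Zero: "Zero k l \<in> exprs R k l"
  by (simp add: exprs_def)

text \<open>The operation is a union over all representatives; the congruence rule for
  \<open>Add\<close> makes its members coincide.\<close>

lemma pr_hom_add:
  assumes "f \<in> exprs R k l" "g \<in> exprs R k l"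
  shows "pr_class R t f \<oplus>\<^bsub>pr_hom R t k l\<^esub> pr_class R t g = pr_class R t (Add f g)"
proof -
  have const: "pr_class R t (Add f' g') = pr_class R t (Add f g)" if "f \<doteq> f'" "g \<doteq> g'" for f' g'
    using assms that by (intro pr_class_eq pr_eq.sym[OF pr_eq.add_cong]) (auto simp: exprs_def)
  have "f \<doteq> f" "g \<doteq> g"
    using assms by (auto simp: exprs_def intro: pr_eq.refl)
  then have "(\<Union>f'\<in>pr_class R t f. \<Union>g'\<in>pr_class R t g. pr_class R t (Add f' g')) =
      pr_class R t (Add f g)"
    using const unfolding mem_pr_class[symmetric] by blast
  then show ?thesis by (simp add: pr_hom_def)
qed

lemma pr_hom_smult:
  assumes "f \<in> exprs R k l" "a \<in> carrier R"
  shows "a \<odot>\<^bsub>pr_hom R t k l\<^esub> pr_class R t f = pr_class R t (Scale a f)"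
proof -
  have const: "pr_class R t (Scale a f') = pr_class R t (Scale a f)" if "f \<doteq> f'" for f'
    using assms that by (intro pr_class_eq pr_eq.sym[OF pr_eq.scale_cong])
  have "f \<doteq> f"
    using assms by (auto simp: exprs_def intro: pr_eq.refl)
  then have "(\<Union>f'\<in>pr_class R t f. pr_class R t (Scale a f')) = pr_class R t (Scale a f)"
    using const unfolding mem_pr_class[symmetric] by blast
  then show ?thesis by (simp add: pr_hom_def)
qed

lemma carrier_pr_hom: "carrier (pr_hom R t k l) = pr_class R t ` exprs R k l"
  by (simp add: pr_hom_def)

lemma zero_pr_hom: "\<zero>\<^bsub>pr_hom R t k l\<^esub> = pr_class R t (Zero k l)"
  by (simp add: pr_hom_def)

lemma well_typed_exprs: "f \<in> exprs R k l \<Longrightarrow> well_typed R f"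
  by (simp add: exprs_def)

lemma module_pr_hom: "module R (pr_hom R t k l)"
proof (rule moduleI)
  note simps = carrier_pr_hom zero_pr_hom pr_hom_add pr_hom_smult exprs_Add exprs_Scale exprs_Zero
  show "cring R" by (rule R.is_cring)
  show "abelian_group (pr_hom R t k l)"
  proof (rule abelian_groupI)
    fix x assume "x \<in> carrier (pr_hom R t k l)"
    then obtain f where f: "f \<in> exprs R k l" "x = pr_class R t f"
      by (auto simp: carrier_pr_hom)
    then show "\<exists>y\<in>carrier (pr_hom R t k l). y \<oplus>\<^bsub>pr_hom R t k l\<^esub> x = \<zero>\<^bsub>pr_hom R t k l\<^esub>"
      by (intro bexI[of _ "pr_class R t (Scale (\<ominus> \<one>) f)"])
        (simp_all add: simps pr_class_eq[OF pr_eq.add_neg])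
  qed (auto simp: simps pr_class_eq[OF pr_eq.add_assoc] pr_class_eq[OF pr_eq.add_comm]
      pr_class_eq[OF pr_eq.add_zero])
  show "a \<odot>\<^bsub>pr_hom R t k l\<^esub> x \<in> carrier (pr_hom R t k l)"
    if "a \<in> carrier R" "x \<in> carrier (pr_hom R t k l)" for a x
    using that by (auto simp: simps)
  show "(a \<oplus> b) \<odot>\<^bsub>pr_hom R t k l\<^esub> x =
      (a \<odot>\<^bsub>pr_hom R t k l\<^esub> x) \<oplus>\<^bsub>pr_hom R t k l\<^esub> (b \<odot>\<^bsub>pr_hom R t k l\<^esub> x)"
    if "a \<in> carrier R" "b \<in> carrier R" "x \<in> carrier (pr_hom R t k l)" for a b x
    using that by (auto simp: simps pr_class_eq[OF pr_eq.scale_add_left] well_typed_exprs)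
  show "a \<odot>\<^bsub>pr_hom R t k l\<^esub> (x \<oplus>\<^bsub>pr_hom R t k l\<^esub> y) =
      (a \<odot>\<^bsub>pr_hom R t k l\<^esub> x) \<oplus>\<^bsub>pr_hom R t k l\<^esub> (a \<odot>\<^bsub>pr_hom R t k l\<^esub> y)"
    if "a \<in> carrier R" "x \<in> carrier (pr_hom R t k l)" "y \<in> carrier (pr_hom R t k l)" for a x y
    using that by (auto simp: simps pr_class_eq[OF pr_eq.scale_add_right])
  show "(a \<otimes> b) \<odot>\<^bsub>pr_hom R t k l\<^esub> x =
      a \<odot>\<^bsub>pr_hom R t k l\<^esub> (b \<odot>\<^bsub>pr_hom R t k l\<^esub> x)"
    if "a \<in> carrier R" "b \<in> carrier R" "x \<in> carrier (pr_hom R t k l)" for a b x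
    using that by (auto simp: simps pr_class_eq[OF pr_eq.scale_scale] well_typed_exprs)
  show "\<one> \<odot>\<^bsub>pr_hom R t k l\<^esub> x = x" if "x \<in> carrier (pr_hom R t k l)" for x
    using that by (auto simp: simps pr_class_eq[OF pr_eq.scale_one] well_typed_exprs)
qed

text \<open>The congruence has no rule for the scalar \<open>\<zero>\<close>; the identity is read
  off from the module of classes.\<close>

lemma scale_zero:
  assumes "f \<in> exprs R k l"
  shows "Scale \<zero> f \<doteq> Zero k l"
proof -
  interpret M: module R "pr_hom R t k l" by (rule module_pr_hom)
  have "pr_class R t (Scale \<zero> f) = pr_class R t (Zero k l)"
    using M.smult_l_null[of "pr_class R t f"] assms
    by (simp add: carrier_pr_hom zero_pr_hom pr_hom_smult)
  then show ?thesis
    using assms by (subst (asm) pr_class_eq_iff) (auto simp: exprs_def)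
qed

lemma to_par_pr_class:
  assumes "well_typed R f"
  shows "to_par R t (pr_class R t f) = expr_to_par R t f"
proof -
  have "expr_to_par R t g = expr_to_par R t f" if "g \<in> pr_class R t f" for g
    using that expr_to_par_pr_eq[of f g] by (simp add: mem_pr_class)
  moreover have "f \<in> pr_class R t f"
    using assms by (simp add: mem_pr_class pr_eq.refl)
  ultimately have "expr_to_par R t ` pr_class R t f = {expr_to_par R t f}"
    by blast
  then show ?thesis by (simp add: to_par_def)
qed

section \<open>Monomials and uniqueness of representatives\<close>

lemma comp_Scale:
  assumes f: "f \<doteq> Scale a f'" and g: "g \<doteq> Scale b g'" and "src f = tgt g"
  shows "Comp f g \<doteq> Scale (a \<otimes> b) (Comp f' g')"
proof -
  note types = pr_eq_typed[OF f] pr_eq_typed[OF g]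
  have "Comp f g \<doteq> Comp (Scale a f') (Scale b g')"
    using assms by (intro pr_eq.comp_cong)
  also have "\<dots> \<doteq> Scale a (Comp f' (Scale b g'))"
    using types assms(3) by (intro pr_eq.comp_scale_left) (auto simp: exprs_def)
  also have "\<dots> \<doteq> Scale a (Scale b (Comp f' g'))"
    using types assms(3) by (intro pr_eq.scale_cong pr_eq.comp_scale_right) (auto simp: exprs_def)
  also have "\<dots> \<doteq> Scale (a \<otimes> b) (Comp f' g')"
    using types assms(3) by (intro pr_eq.sym[OF pr_eq.scale_scale]) auto
  finally show ?thesis .
qed

lemma tensor_Scale:
  assumes f: "f \<doteq> Scale a f'" and g: "g \<doteq> Scale b g'"
  shows "Tensor f g \<doteq> Scale (a \<otimes> b) (Tensor f' g')"
proof -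
  note types = pr_eq_typed[OF f] pr_eq_typed[OF g]
  have "Tensor f g \<doteq> Tensor (Scale a f') (Scale b g')"
    using assms by (intro pr_eq.tensor_cong)
  also have "\<dots> \<doteq> Scale a (Tensor f' (Scale b g'))"
    using types by (intro pr_eq.tensor_scale_left) auto
  also have "\<dots> \<doteq> Scale a (Scale b (Tensor f' g'))"
    using types by (intro pr_eq.scale_cong pr_eq.tensor_scale_right) auto
  also have "\<dots> \<doteq> Scale (a \<otimes> b) (Tensor f' g')"
    using types by (intro pr_eq.sym[OF pr_eq.scale_scale]) auto
  finally show ?thesis .
qed

lemma equiv_scale_one: "f \<doteq> g \<Longrightarrow> f \<doteq> Scale (t [^] (0 :: nat)) g"
  using pr_eq_typed(2)[of f g] by (auto intro: pr_eq.trans pr_eq.sym[OF pr_eq.scale_one])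

text \<open>Structural induction, with \<open>comp_word_expr\<close> and
  \<open>tensor_word_expr\<close> absorbing products of words. The power of \<open>t\<close> cannot
  be avoided: \<open>Comp Eps Eta\<close> is a monomial.\<close>

lemma monomial_word:
  assumes "is_monomial f" "well_typed R f"
  shows "\<exists>n w. f \<doteq> Scale (t [^] (n :: nat)) (word_expr w)"
  using assms
proof (induction f)
  case Eta
  have "Eta \<doteq> word_expr [Cup]"
    by (auto intro!: pr_eq.sym[OF pr_eq.unit_right])
  then show ?case using equiv_scale_one by blast
next
  case Eps
  have "Eps \<doteq> word_expr [Cap]"
    by (auto intro!: pr_eq.sym[OF pr_eq.unit_right])
  then show ?case using equiv_scale_one by blast
next
  case (Ident k)
  then show ?case using equiv_scale_one Ident_word_expr by blast
next
  case (Comp f g)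
  then obtain n w m v where f: "f \<doteq> Scale (t [^] (n :: nat)) (word_expr w)"
    and g: "g \<doteq> Scale (t [^] (m :: nat)) (word_expr v)" by auto
  have fg: "src f = tgt g" using Comp.prems by simp
  then have len: "length (bottom_row w) = length (top_row v)"
    using pr_eq_typed(3)[OF f] pr_eq_typed(4)[OF g] by simp
  obtain i u where u: "Comp (word_expr w) (word_expr v) \<doteq> Scale (t [^] (i :: nat)) (word_expr u)"
    using comp_word_expr[OF len] by blast
  have "Comp f g \<doteq> Scale (t [^] n \<otimes> t [^] m) (Comp (word_expr w) (word_expr v))"
    by (rule comp_Scale[OF f g fg])
  also have "\<dots> \<doteq> Scale (t [^] n \<otimes> t [^] m) (Scale (t [^] i) (word_expr u))"
    using u by (intro pr_eq.scale_cong) auto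
  also have "\<dots> \<doteq> Scale (t [^] n \<otimes> t [^] m \<otimes> t [^] i) (word_expr u)"
    by (intro pr_eq.sym[OF pr_eq.scale_scale]) auto
  also have "t [^] n \<otimes> t [^] m \<otimes> t [^] i = t [^] (n + m + i)"
    by (simp add: nat_pow_mult)
  finally show ?case by blast
next
  case (Tensor f g)
  then obtain n w m v where f: "f \<doteq> Scale (t [^] (n :: nat)) (word_expr w)"
    and g: "g \<doteq> Scale (t [^] (m :: nat)) (word_expr v)" by auto
  have "Tensor f g \<doteq> Scale (t [^] n \<otimes> t [^] m) (Tensor (word_expr w) (word_expr v))"
    by (rule tensor_Scale[OF f g])
  also have "\<dots> \<doteq> Scale (t [^] n \<otimes> t [^] m) (word_expr (w @ v))"
    by (intro pr_eq.scale_cong tensor_word_expr) auto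
  also have "t [^] n \<otimes> t [^] m = t [^] (n + m)"
    by (simp add: nat_pow_mult)
  finally show ?case by blast
qed auto

lemma expr_to_par_Scale_word:
  assumes "a \<in> carrier R" "E \<in> partitions (length (bottom_row w)) (length (top_row w))"
  shows "expr_to_par R t (Scale a (word_expr w)) E =
    (if rook_diagram (length (bottom_row w)) (length (top_row w)) (word_rel w) = E then a else \<zero>)"
  using assms by (subst expr_to_par_ev) (auto simp: ev_word_expr)

text \<open>Existence holds because a word is a monomial with image its diagram. For uniqueness, a
  representing monomial is \<open>t [^] n\<close> times a word \<open>v\<close>, and its
  coefficients in the partition category must be those of the given diagram.\<close>

lemma represents_iff:
  assumes w: "length (bottom_row w) = k" "length (top_row w) = l"
  shows "represents R t k l x (rook_diagram k l (word_rel w)) \<longleftrightarrow> x = pr_class R t (word_expr w)"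
    (is "represents R t k l x ?D \<longleftrightarrow> _")
proof
  assume x: "x = pr_class R t (word_expr w)"
  have "word_expr w \<in> exprs R k l"
    using w by (simp add: exprs_def)
  moreover have "expr_to_par R t (word_expr w) = par_diagram R k l ?D"
    using w by (simp add: expr_to_par_ev ev_word_expr par_diagram_alt)
  moreover have "word_expr w \<in> pr_class R t (word_expr w)"
    by (simp add: mem_pr_class pr_eq.refl)
  ultimately show "represents R t k l x ?D"
    unfolding represents_def x carrier_pr_hom
    by (auto simp: to_par_pr_class is_monomial_word_expr intro!: bexI[of _ "word_expr w"])
next
  assume rep: "represents R t k l x ?D"
  then obtain f where f: "f \<in> x" "is_monomial f"
    and x_carrier: "x \<in> carrier (pr_hom R t k l)" and par: "to_par R t x = par_diagram R k l ?D"
    by (auto simp: represents_def)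
  obtain g where g: "g \<in> exprs R k l" "x = pr_class R t g"
    using x_carrier by (auto simp: carrier_pr_hom)
  then have "g \<doteq> f" using f(1) by (simp add: mem_pr_class)
  note types = pr_eq_typed[OF this]
  have x: "x = pr_class R t f"
    using g \<open>g \<doteq> f\<close> pr_class_eq by simp
  obtain n v where v: "f \<doteq> Scale (t [^] (n :: nat)) (word_expr v)"
    using monomial_word[OF f(2) types(2)] by blast
  have len: "length (bottom_row v) = k" "length (top_row v) = l"
    using pr_eq_typed(3,4)[OF v] types g by (auto simp: exprs_def)
  let ?D' = "rook_diagram k l (word_rel v)"
  have D: "?D \<in> partitions k l" "?D' \<in> partitions k l"
    using word_rel_rook_rel[of w] word_rel_rook_rel[of v] w len rook_diagram_partition by auto
  have par_eq: "par_diagram R k l ?D E = expr_to_par R t (Scale (t [^] n) (word_expr v)) E" for E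
    using par expr_to_par_pr_eq[OF v] types(2) by (simp add: x to_par_pr_class)
  have eq: "(if ?D = E then \<one> else \<zero>) = (if ?D' = E then t [^] n else \<zero>)" if "E \<in> partitions k l" for E
    using that par_eq[of E] len expr_to_par_Scale_word[of "t [^] n" E v]
    by (simp add: par_diagram_alt del: expr_to_par.simps)
  show "x = pr_class R t (word_expr w)"
  proof (cases "?D' = ?D")
    case True
    \<comment> \<open>The exponent itself may be positive, for instance when
      \<open>t = \<one>\<close>; only the scalar has to be trivial.\<close>
    then have "t [^] n = \<one>" using eq[OF D(1)] by simp
    then have "f \<doteq> word_expr v"
      using v pr_eq.trans[OF _ pr_eq.scale_one[of R "word_expr v" t]] by simp
    also have "\<dots> \<doteq> word_expr w"
      using True w len by (intro word_expr_cong) (auto simp: rook_diagram_eq_iff)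
    finally show ?thesis using x pr_class_eq by simp
  next
    case False
    txt \<open>This happens only over the zero ring, where all expressions of the same type agree.\<close>
    then have "\<one> = \<zero>" using eq[OF D(1)] by simp
    have "h \<doteq> Zero k l" if "h \<in> exprs R k l" for h
    proof -
      have "h \<doteq> Scale \<zero> h"
        using that pr_eq.sym[OF pr_eq.scale_one, of R h] \<open>\<one> = \<zero>\<close> by (simp add: exprs_def)
      also have "\<dots> \<doteq> Zero k l" by (rule scale_zero[OF that])
      finally show ?thesis .
    qed
    moreover have "f \<in> exprs R k l" "word_expr w \<in> exprs R k l"
      using types g w by (auto simp: exprs_def)
    ultimately show ?thesis using x pr_class_eq by metis
  qed
qed

section \<open>Spanning by words\<close>

inductive spanned :: "'a expr \<Rightarrow> bool" where
  word: "spanned (word_expr w)"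
| add: "spanned f \<Longrightarrow> spanned g \<Longrightarrow> src f = src g \<Longrightarrow> tgt f = tgt g \<Longrightarrow> spanned (Add f g)"
| scale: "a \<in> carrier R \<Longrightarrow> spanned f \<Longrightarrow> spanned (Scale a f)"
| equiv: "spanned f \<Longrightarrow> g \<doteq> f \<Longrightarrow> spanned g"

lemma spanned_well_typed: "spanned f \<Longrightarrow> well_typed R f"
  by (induction rule: spanned.induct) (auto dest: pr_eq_typed)

text \<open>Bilinearity is used in one argument at a time: the left factor is a word here, and
  \<open>spanned_comp\<close> then treats general left factors. Only the case of two words needs
  \<open>comp_word_expr\<close>. The tensor product is handled in the same two stages.\<close>

lemma spanned_comp_word:
  assumes "spanned g" "length (bottom_row w) = tgt g"
  shows "spanned (Comp (word_expr w) g)"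
  using assms
proof (induction rule: spanned.induct)
  case (word v)
  then show ?case
    using comp_word_expr[of w v] by simp (meson spanned.intros nat_pow_closed t_closed)
next
  case (add f g)
  then have "spanned (Add (Comp (word_expr w) f) (Comp (word_expr w) g))"
    by (intro spanned.add) auto
  then show ?case
    using add by (rule_tac spanned.equiv) (auto intro!: pr_eq.comp_add_right simp: exprs_def spanned_well_typed)
next
  case (scale a f)
  then have "spanned (Scale a (Comp (word_expr w) f))"
    by (intro spanned.scale) auto
  then show ?case
    using scale by (rule_tac spanned.equiv) (auto intro!: pr_eq.comp_scale_right simp: exprs_def spanned_well_typed)
next
  case (equiv f g)
  then show ?case
    using pr_eq_typed[OF equiv.hyps(2)] by (auto intro!: spanned.equiv[of "Comp (word_expr w) f"] comp_congs)
qed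

lemma spanned_comp:
  assumes "spanned f" "spanned g" "src f = tgt g"
  shows "spanned (Comp f g)"
  using assms
proof (induction rule: spanned.induct)
  case (word w)
  then show ?case by (intro spanned_comp_word) auto
next
  case (add f f')
  then have "spanned (Add (Comp f g) (Comp f' g))"
    by (intro spanned.add) auto
  then show ?case
    using add by (rule_tac spanned.equiv) (auto intro!: pr_eq.comp_add_left simp: exprs_def spanned_well_typed)
next
  case (scale a f)
  then have "spanned (Scale a (Comp f g))"
    by (intro spanned.scale) auto
  then show ?case
    using scale by (rule_tac spanned.equiv) (auto intro!: pr_eq.comp_scale_left simp: exprs_def spanned_well_typed)
next
  case (equiv f f')
  then show ?case
    using pr_eq_typed[OF equiv.hyps(2)] spanned_well_typed[OF equiv.prems(1)]
    by (auto intro!: spanned.equiv[of "Comp f g"] comp_congs)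
qed

lemma spanned_tensor_word:
  assumes "spanned g"
  shows "spanned (Tensor (word_expr w) g)"
  using assms
proof (induction rule: spanned.induct)
  case (word v)
  then show ?case
    using tensor_word_expr[of w v] by (auto intro: spanned.intros)
next
  case (add f g)
  then have "spanned (Add (Tensor (word_expr w) f) (Tensor (word_expr w) g))"
    by (intro spanned.add) auto
  then show ?case
    using add by (rule_tac spanned.equiv) (auto intro!: pr_eq.tensor_add_right simp: exprs_def spanned_well_typed)
next
  case (scale a f)
  then have "spanned (Scale a (Tensor (word_expr w) f))"
    by (intro spanned.scale) auto
  then show ?case
    using scale by (rule_tac spanned.equiv) (auto intro!: pr_eq.tensor_scale_right simp: spanned_well_typed)
next
  case (equiv f g)
  then show ?case
    by (auto intro!: spanned.equiv[of "Tensor (word_expr w) f"] tensor_congs)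
qed

lemma spanned_tensor:
  assumes "spanned f" "spanned g"
  shows "spanned (Tensor f g)"
  using assms
proof (induction rule: spanned.induct)
  case (word w)
  then show ?case by (intro spanned_tensor_word)
next
  case (add f f')
  then have "spanned (Add (Tensor f g) (Tensor f' g))"
    by (intro spanned.add) auto
  then show ?case
    using add by (rule_tac spanned.equiv) (auto intro!: pr_eq.tensor_add_left simp: exprs_def spanned_well_typed)
next
  case (scale a f)
  then have "spanned (Scale a (Tensor f g))"
    by (intro spanned.scale) auto
  then show ?case
    using scale by (rule_tac spanned.equiv) (auto intro!: pr_eq.tensor_scale_left simp: spanned_well_typed)
next
  case (equiv f f')
  then show ?case
    using spanned_well_typed[OF equiv.prems(1)]
    by (auto intro!: spanned.equiv[of "Tensor f g"] tensor_congs)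
qed

lemma exists_word: "\<exists>w. length (bottom_row w) = k \<and> length (top_row w) = l"
  using monotone_rel_word[of "{}" k l] by (auto simp: monotone_rels_def)

lemma well_typed_spanned: "well_typed R f \<Longrightarrow> spanned f"
proof (induction f)
  case Eta
  have "Eta \<doteq> word_expr [Cup]"
    by (auto intro!: pr_eq.sym[OF pr_eq.unit_right])
  then show ?case by (rule spanned.equiv[OF spanned.word])
next
  case Eps
  have "Eps \<doteq> word_expr [Cap]"
    by (auto intro!: pr_eq.sym[OF pr_eq.unit_right])
  then show ?case by (rule spanned.equiv[OF spanned.word])
next
  case (Ident k)
  show ?case by (rule spanned.equiv[OF spanned.word Ident_word_expr])
next
  \<comment> \<open>A zero morphism is \<open>\<zero>\<close> times a word, so some word of type
    \<open>k\<close> to \<open>l\<close> must exist; one drawing the empty relation does.\<close>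
  case (Zero k l)
  obtain w where "length (bottom_row w) = k" "length (top_row w) = l"
    using exists_word by blast
  then have "Zero k l \<doteq> Scale \<zero> (word_expr w)"
    by (intro pr_eq.sym[OF scale_zero]) (simp add: exprs_def)
  then show ?case
    by (rule spanned.equiv[OF spanned.scale[OF zero_closed spanned.word]])
qed (auto intro: spanned.add spanned.scale spanned_comp spanned_tensor)

text \<open>All combinations are taken over the whole finite family \<open>P\<close>, with zero
  coefficients allowed, so that sums and multiples act on coefficients pointwise and no supports
  have to be merged.\<close>

lemma spanned_in_span:
  assumes P: "finite P" and b_closed: "b \<in> P \<rightarrow> carrier (pr_hom R t k l)"
    and words: "\<And>w. length (bottom_row w) = k \<Longrightarrow> length (top_row w) = l \<Longrightarrow>
      pr_class R t (word_expr w) \<in> b ` P"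
    and "spanned f" "f \<in> exprs R k l"
  shows "\<exists>a\<in>P \<rightarrow> carrier R.
    pr_class R t f = (\<Oplus>\<^bsub>pr_hom R t k l\<^esub>i\<in>P. a i \<odot>\<^bsub>pr_hom R t k l\<^esub> b i)"
  using assms(4,5)
proof (induction rule: spanned.induct)
  interpret M: module R "pr_hom R t k l" by (rule module_pr_hom)
  {
    case (word w)
    then obtain i where i: "i \<in> P" "pr_class R t (word_expr w) = b i"
      using words[of w] by (auto simp: exprs_def)
    have "(\<Oplus>\<^bsub>pr_hom R t k l\<^esub>j\<in>P. (if i = j then \<one> else \<zero>) \<odot>\<^bsub>pr_hom R t k l\<^esub> b j) =
        (\<Oplus>\<^bsub>pr_hom R t k l\<^esub>j\<in>P. if i = j then b j else \<zero>\<^bsub>pr_hom R t k l\<^esub>)"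
    proof (rule M.M.finsum_cong')
      show "(\<lambda>j. if i = j then b j else \<zero>\<^bsub>pr_hom R t k l\<^esub>) \<in> P \<rightarrow> carrier (pr_hom R t k l)"
        using b_closed by auto
      show "(if i = j then \<one> else \<zero>) \<odot>\<^bsub>pr_hom R t k l\<^esub> b j =
          (if i = j then b j else \<zero>\<^bsub>pr_hom R t k l\<^esub>)" if "j \<in> P" for j
        using funcset_mem[OF b_closed that] by simp
    qed simp
    also have "\<dots> = b i"
      using i(1) P b_closed by (intro M.M.finsum_singleton) auto
    finally show ?case
      using i(2) by (intro bexI[of _ "\<lambda>j. if i = j then \<one> else \<zero>"]) auto
  next
    case (add f g)
    then have "f \<in> exprs R k l" "g \<in> exprs R k l"
      by (auto simp: exprs_def)
    with add.IH obtain a c where a: "a \<in> P \<rightarrow> carrier R" and c: "c \<in> P \<rightarrow> carrier R"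
      and "pr_class R t f = (\<Oplus>\<^bsub>pr_hom R t k l\<^esub>i\<in>P. a i \<odot>\<^bsub>pr_hom R t k l\<^esub> b i)"
        "pr_class R t g = (\<Oplus>\<^bsub>pr_hom R t k l\<^esub>i\<in>P. c i \<odot>\<^bsub>pr_hom R t k l\<^esub> b i)"
      by blast
    then have "pr_class R t (Add f g) = (\<Oplus>\<^bsub>pr_hom R t k l\<^esub>i\<in>P. a i \<odot>\<^bsub>pr_hom R t k l\<^esub> b i)
        \<oplus>\<^bsub>pr_hom R t k l\<^esub> (\<Oplus>\<^bsub>pr_hom R t k l\<^esub>i\<in>P. c i \<odot>\<^bsub>pr_hom R t k l\<^esub> b i)"
      using pr_hom_add[OF \<open>f \<in> exprs R k l\<close> \<open>g \<in> exprs R k l\<close>] by simp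
    also have "\<dots> = (\<Oplus>\<^bsub>pr_hom R t k l\<^esub>i\<in>P. a i \<odot>\<^bsub>pr_hom R t k l\<^esub> b i \<oplus>\<^bsub>pr_hom R t k l\<^esub>
        c i \<odot>\<^bsub>pr_hom R t k l\<^esub> b i)"
      using a c b_closed by (intro M.M.finsum_addf[symmetric]) auto
    also have "\<dots> = (\<Oplus>\<^bsub>pr_hom R t k l\<^esub>i\<in>P. (a i \<oplus> c i) \<odot>\<^bsub>pr_hom R t k l\<^esub> b i)"
      using a c b_closed by (intro M.M.finsum_cong') (auto simp: M.smult_l_distr Pi_iff)
    finally show ?case
      using a c by (intro bexI[of _ "\<lambda>i. a i \<oplus> c i"]) auto
  next
    case (scale d f)
    then have "f \<in> exprs R k l"
      by (auto simp: exprs_def)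
    with scale.IH obtain a where a: "a \<in> P \<rightarrow> carrier R"
      and "pr_class R t f = (\<Oplus>\<^bsub>pr_hom R t k l\<^esub>i\<in>P. a i \<odot>\<^bsub>pr_hom R t k l\<^esub> b i)"
      by blast
    then have "pr_class R t (Scale d f) = d \<odot>\<^bsub>pr_hom R t k l\<^esub>
        (\<Oplus>\<^bsub>pr_hom R t k l\<^esub>i\<in>P. a i \<odot>\<^bsub>pr_hom R t k l\<^esub> b i)"
      using pr_hom_smult[OF \<open>f \<in> exprs R k l\<close> scale.hyps(1)] by simp
    also have "\<dots> = (\<Oplus>\<^bsub>pr_hom R t k l\<^esub>i\<in>P. d \<odot>\<^bsub>pr_hom R t k l\<^esub> (a i \<odot>\<^bsub>pr_hom R t k l\<^esub> b i))"
      using a b_closed P scale.hyps(1) by (intro M.finsum_smult_ldistr) auto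
    also have "\<dots> = (\<Oplus>\<^bsub>pr_hom R t k l\<^esub>i\<in>P. (d \<otimes> a i) \<odot>\<^bsub>pr_hom R t k l\<^esub> b i)"
      using a b_closed scale.hyps(1) by (intro M.M.finsum_cong') (auto simp: M.smult_assoc1 Pi_iff)
    finally show ?case
      using a scale.hyps(1) by (intro bexI[of _ "\<lambda>i. d \<otimes> a i"]) auto
  next
    case (equiv f g)
    then show ?case
      using pr_eq_typed[OF equiv.hyps(2)] pr_class_eq[OF equiv.hyps(2)] by (auto simp: exprs_def)
  }
qed

text \<open>Lifts a linear combination of classes to a single expression, to which \<open>ev\<close>
  applies. Its evaluation is the same combination of point evaluations, so a suitable \<phi> can
  isolate a coefficient.\<close>

lemma lincomb_ev:
  assumes "finite J" "a \<in> J \<rightarrow> carrier R"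
    and w: "\<And>i. i \<in> J \<Longrightarrow> length (bottom_row (w i)) = k \<and> length (top_row (w i)) = l"
    and b: "\<And>i. i \<in> J \<Longrightarrow> b i = pr_class R t (word_expr (w i))"
  shows "\<exists>f\<in>exprs R k l.
    (\<Oplus>\<^bsub>pr_hom R t k l\<^esub>i\<in>J. a i \<odot>\<^bsub>pr_hom R t k l\<^esub> b i) = pr_class R t f \<and>
    (\<forall>\<phi>. (\<forall>p. \<phi> p \<in> carrier R) \<longrightarrow> ev f \<phi> = (\<Oplus>i\<in>J. a i \<otimes> \<phi> (word_rel (w i))))"
  using assms
proof (induction J rule: finite_induct)
  interpret M: module R "pr_hom R t k l" by (rule module_pr_hom)
  {
    case empty
    show ?case
      by (intro bexI[of _ "Zero k l"]) (auto simp: zero_pr_hom exprs_Zero)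
  next
    case (insert i J)
    obtain f where f: "f \<in> exprs R k l"
        "(\<Oplus>\<^bsub>pr_hom R t k l\<^esub>i\<in>J. a i \<odot>\<^bsub>pr_hom R t k l\<^esub> b i) = pr_class R t f"
        "\<And>\<phi>. (\<And>p. \<phi> p \<in> carrier R) \<Longrightarrow> ev f \<phi> = (\<Oplus>i\<in>J. a i \<otimes> \<phi> (word_rel (w i)))"
      using insert by auto
    have word: "word_expr (w j) \<in> exprs R k l" if "j \<in> insert i J" for j
      using insert.prems(2)[OF that] by (simp add: exprs_def)
    have b_closed: "b j \<in> carrier (pr_hom R t k l)" if "j \<in> insert i J" for j
      using insert.prems(3)[OF that] word[OF that] by (simp add: carrier_pr_hom)
    have ai: "a i \<in> carrier R" using insert.prems(1) by auto
    have "(\<Oplus>\<^bsub>pr_hom R t k l\<^esub>i\<in>insert i J. a i \<odot>\<^bsub>pr_hom R t k l\<^esub> b i) =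
        a i \<odot>\<^bsub>pr_hom R t k l\<^esub> b i \<oplus>\<^bsub>pr_hom R t k l\<^esub> pr_class R t f"
      using insert.hyps insert.prems(1) b_closed f(2) by (subst M.M.finsum_insert) auto
    also have "\<dots> = pr_class R t (Add (Scale (a i) (word_expr (w i))) f)"
      using insert.prems(3)[of i] word[of i] ai f(1)
      by (simp add: pr_hom_smult pr_hom_add exprs_Scale)
    finally have sum: "(\<Oplus>\<^bsub>pr_hom R t k l\<^esub>i\<in>insert i J. a i \<odot>\<^bsub>pr_hom R t k l\<^esub> b i) = \<dots>" .
    have "ev (Add (Scale (a i) (word_expr (w i))) f) \<phi> = (\<Oplus>i\<in>insert i J. a i \<otimes> \<phi> (word_rel (w i)))"
      if "\<And>p. \<phi> p \<in> carrier R" for \<phi>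
      using insert.hyps insert.prems(1) that f(3)
      by (subst finsum_insert) (auto simp: ev_word_expr)
    with sum f(1) word[of i] ai show ?case
      by (intro bexI[of _ "Add (Scale (a i) (word_expr (w i))) f"]) (auto intro: exprs_Add exprs_Scale)
  }
qed

lemma planar_rook_diagram_word:
  assumes "D \<in> planar_rook_diagrams k l"
  obtains w where "length (bottom_row w) = k" "length (top_row w) = l" "rook_diagram k l (word_rel w) = D"
  using assms monotone_rel_word by (fastforce simp: planar_rook_diagrams_eq)

theorem planar_rook_basis:
  shows "\<forall>D\<in>planar_rook_diagrams k l. \<exists>!x. represents R t k l x D"
    and "module_basis R (pr_hom R t k l) (planar_rook_diagrams k l) (\<lambda>D. THE x. represents R t k l x D)"
proof -
  interpret M: module R "pr_hom R t k l" by (rule module_pr_hom)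
  define b where "b D = (THE x. represents R t k l x D)" for D
  have "\<forall>D\<in>planar_rook_diagrams k l. \<exists>w. length (bottom_row w) = k \<and> length (top_row w) = l \<and>
      rook_diagram k l (word_rel w) = D"
    using planar_rook_diagram_word by metis
  \<comment> \<open>The choice of a word for each diagram is harmless: by
    \<open>represents_iff\<close>, its class is the only morphism that represents the
    diagram.\<close>
  then obtain w where "\<forall>D\<in>planar_rook_diagrams k l. length (bottom_row (w D)) = k \<and>
      length (top_row (w D)) = l \<and> rook_diagram k l (word_rel (w D)) = D"
    by metis
  then have w: "length (bottom_row (w D)) = k" "length (top_row (w D)) = l"
      "rook_diagram k l (word_rel (w D)) = D" if "D \<in> planar_rook_diagrams k l" for D
    using that by auto
  have rep: "represents R t k l x D \<longleftrightarrow> x = pr_class R t (word_expr (w D))"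
    if "D \<in> planar_rook_diagrams k l" for x D
    using represents_iff[OF w(1,2)[OF that]] w(3)[OF that] by simp
  then have b: "b D = pr_class R t (word_expr (w D))" if "D \<in> planar_rook_diagrams k l" for D
    using that by (simp add: b_def)
  have b_closed: "b \<in> planar_rook_diagrams k l \<rightarrow> carrier (pr_hom R t k l)"
    using w by (auto simp: b carrier_pr_hom exprs_def)
  have fin: "finite (planar_rook_diagrams k l)"
    by (rule finite_subset[OF _ finite_partitions]) (auto simp: planar_rook_diagrams_def)
  \<comment> \<open>The chosen words suffice for spanning, because the class of any word of this
    type is the basis element of the diagram it draws.\<close>
  have words: "pr_class R t (word_expr v) \<in> b ` planar_rook_diagrams k l"
    if v: "length (bottom_row v) = k" "length (top_row v) = l" for v
  proof (rule image_eqI)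
    let ?D = "rook_diagram k l (word_rel v)"
    show D: "?D \<in> planar_rook_diagrams k l"
      using word_rel_monotone_rel[of v] v by (simp add: planar_rook_diagrams_eq)
    show "pr_class R t (word_expr v) = b ?D"
      using represents_iff[OF v] rep[OF D] b[OF D] by simp
  qed
  show "\<forall>D\<in>planar_rook_diagrams k l. \<exists>!x. represents R t k l x D"
    using rep by simp
  have "module_basis R (pr_hom R t k l) (planar_rook_diagrams k l) b"
  proof
    show "b \<in> planar_rook_diagrams k l \<rightarrow> carrier (pr_hom R t k l)" by (rule b_closed)
    fix x assume "x \<in> carrier (pr_hom R t k l)"
    then obtain f where f: "f \<in> exprs R k l" "x = pr_class R t f"
      by (auto simp: carrier_pr_hom)
    show "\<exists>J a. finite J \<and> J \<subseteq> planar_rook_diagrams k l \<and> a \<in> J \<rightarrow> carrier R \<and>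
        x = (\<Oplus>\<^bsub>pr_hom R t k l\<^esub>i\<in>J. a i \<odot>\<^bsub>pr_hom R t k l\<^esub> b i)"
      using spanned_in_span[OF fin b_closed words well_typed_spanned f(1)] f fin
      by (auto simp: well_typed_exprs)
  next
    fix J a j
    assume J: "finite J" "J \<subseteq> planar_rook_diagrams k l" and a: "a \<in> J \<rightarrow> carrier R"
      and zero: "(\<Oplus>\<^bsub>pr_hom R t k l\<^esub>i\<in>J. a i \<odot>\<^bsub>pr_hom R t k l\<^esub> b i) = \<zero>\<^bsub>pr_hom R t k l\<^esub>"
      and j: "j \<in> J"
    obtain f where f: "f \<in> exprs R k l"
        "(\<Oplus>\<^bsub>pr_hom R t k l\<^esub>i\<in>J. a i \<odot>\<^bsub>pr_hom R t k l\<^esub> b i) = pr_class R t f"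
        "\<And>\<phi>. (\<And>p. \<phi> p \<in> carrier R) \<Longrightarrow> ev f \<phi> = (\<Oplus>i\<in>J. a i \<otimes> \<phi> (word_rel (w i)))"
      using lincomb_ev[OF J(1) a, of w k l b] w b J(2) by blast
    \<comment> \<open>The indicator of the diagram \<open>j\<close> isolates \<open>a j\<close>,
      since the word chosen for a diagram \<open>i\<close> draws \<open>i\<close> itself.\<close>
    define \<phi> where "\<phi> p = (if rook_diagram k l p = j then \<one> else \<zero>)" for p
    have "f \<doteq> Zero k l"
      using f zero by (simp add: zero_pr_hom pr_class_eq_iff[symmetric] well_typed_exprs)
    then have "ev f \<phi> = \<zero>"
      using ev_pr_eq[of f "Zero k l" \<phi>] by (simp add: \<phi>_def)
    moreover have "ev f \<phi> = (\<Oplus>i\<in>J. a i \<otimes> (if j = i then \<one> else \<zero>))"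
    proof -
      have "ev f \<phi> = (\<Oplus>i\<in>J. a i \<otimes> \<phi> (word_rel (w i)))"
        by (rule f(3)) (simp add: \<phi>_def)
      also have "\<dots> = (\<Oplus>i\<in>J. a i \<otimes> (if j = i then \<one> else \<zero>))"
      proof (rule finsum_cong')
        show "a i \<otimes> \<phi> (word_rel (w i)) = a i \<otimes> (if j = i then \<one> else \<zero>)" if "i \<in> J" for i
          using w(3)[of i] that J(2) by (auto simp: \<phi>_def)
      qed (use a in auto)
      finally show ?thesis .
    qed
    moreover have "\<dots> = a j"
      using finsum_mult_delta[OF J(1), of a j] a j by auto
    ultimately show "a j = \<zero>" by simp
  qed
  then show "module_basis R (pr_hom R t k l) (planar_rook_diagrams k l) (\<lambda>D. THE x. represents R t k l x D)"
    by (simp add: b_def[abs_def])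
qed

end

theorem theorem4p8:
  fixes R :: "('a, 'b) ring_scheme" (structure)
    and t :: 'a and k l :: nat
  assumes "cring R" and "t \<in> carrier R"
  shows "(\<forall>D\<in>planar_rook_diagrams k l. \<exists>!x. represents R t k l x D) \<and>
    module_basis R (pr_hom R t k l) (planar_rook_diagrams k l)
      (\<lambda>D. THE x. represents R t k l x D)"
proof -
  interpret planar_rook_category R t
    using assms by (intro planar_rook_category.intro planar_rook_category_axioms.intro)
  show ?thesis
    using planar_rook_basis[of k l] by blast
qed

end
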